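(* For every $-2<\beta<0$ and every integer $n\ge2$, $$\mathsf E D_n=\frac{h_{n-1}}{\mu_\beta}-\frac{\phi_\beta''(0)}{2\mu_\beta^2}-\sum_{k\ge1}\frac{\Gamma(-s_{\beta,k})\Gamma(n)}{\phi_\beta'(s_{\beta,k})\Gamma(n-s_{\beta,k})},$$ and for every fixed integer $r\ge0$, as $n\to\infty$, $$\mathsf E D_n=\frac{h_{n-1}}{\mu_\beta}-\frac{\phi_\beta''(0)}{2\mu_\beta^2}-\sum_{k=1}^{r}\frac{\Gamma(-s_{\beta,k})\Gamma(n)}{\phi_\beta'(s_{\beta,k})\Gamma(n-s_{\beta,k})}+O_{\beta,r}\bigl(n^{s_{\beta,r+1}}\bigr).$$
   Context: $h_m=\sum_{r=1}^m 1/r$ is the harmonic number and $B(a,b)=\Gamma(a)\Gamma(b)/\Gamma(a+b)$ the beta function. For $\beta>-2$ and $\operatorname{Re}z\ge0$ put $\phi_\beta(z)=\int_0^1(1-s^z)s^{\beta+1}(1-s)^\beta\,ds$ and $\mu_\beta=\phi_\beta'(0)$. For $-2<\beta<0$, $\phi_\beta$ extends meromorphically to $\mathbb C$, with simple poles at $-(m+\beta+2)$, $m=0,1,2,\dots$, and its zeros are real and simple and interlace with the poles; the zeros are written as $0=s_{\beta,0}>s_{\beta,1}>s_{\beta,2}>\cdots$. Continuous-time beta-splitting tree on $n$ leaves: a continuous-time Markov chain $\Pi_n$ on partitions of $[n]=\{1,\dots,n\}$ started from the one-block partition, in which different blocks evolve independently, singletons are absorbing, and a block containing $m\ge2$ labels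 waits an exponential time of rate $\phi_\beta(m-1)$ and then splits into an ordered pair of nonempty blocks; the first has size $i$, $1\le i\le m-1$, with probability $q_\beta(m,i)=\frac{1}{2\phi_\beta(m-1)}\binom mi B(i+\beta+1,m-i+\beta+1)$, and, given $i$, the set of labels of the first block is uniform among subsets of size $i$. $D_n$ is the continuous height of a uniformly chosen leaf, i.e. the first time at which a uniformly chosen label of $[n]$ is a singleton block. *)

theory Defs
  imports "HOL-Probability.Probability" "HOL-Complex_Analysis.Complex_Analysis"
begin

section \<open>The function $\phi_\beta$, its meromorphic extension and its zeros\<close>

definition phi_int :: "real \<Rightarrow> complex \<Rightarrow> complex" where
  "phi_int \<beta> z = integral {0..1}
     (\<lambda>s::real. (1 - of_real s powr z) * of_real (s powr (\<beta> + 1) * (1 - s) powr \<beta>))"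

text \<open>
  The integral defines the function on the closed right half-plane only. Being
  \<^emph>\<open>nicely\<close> meromorphic (removable singularities removed, value 0 at poles) makes the
  extension to the plane unique as a total function.
\<close>
definition phi :: "real \<Rightarrow> complex \<Rightarrow> complex" where
  "phi \<beta> = (THE f. f nicely_meromorphic_on UNIV \<and> (\<forall>z. Re z \<ge> 0 \<longrightarrow> f z = phi_int \<beta> z))"

definition mu :: "real \<Rightarrow> complex" where
  "mu \<beta> = deriv (phi \<beta>) 0"

text \<open>The value 0 at a pole is a library convention, so poles are excluded explicitly.\<close>
definition phi_zeros :: "real \<Rightarrow> complex set" where
  "phi_zeros \<beta> = {z. phi \<beta> z = 0 \<and> \<not> is_pole (phi \<beta>) z}"

text \<open>The enumeration of all complex zeros (they are real) in decreasing order, from index 0.\<close>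
definition phi_zero :: "real \<Rightarrow> nat \<Rightarrow> real" where
  "phi_zero \<beta> = (THE s. s 0 = 0 \<and> (\<forall>j k. j < k \<longrightarrow> s k < s j) \<and>
     range (\<lambda>k. complex_of_real (s k)) = phi_zeros \<beta>)"


section \<open>Continuous-time Markov chains on a finite state space\<close>

primrec gen_power :: "'s set \<Rightarrow> ('s \<Rightarrow> 's \<Rightarrow> real) \<Rightarrow> nat \<Rightarrow> 's \<Rightarrow> 's \<Rightarrow> real" where
  "gen_power S Q 0 x y = of_bool (x = y)"
| "gen_power S Q (Suc k) x y = (\<Sum>z\<in>S. Q x z * gen_power S Q k z y)"

text \<open>The entries of the matrix exponential of \<open>t Q\<close>.\<close>
definition transition :: "'s set \<Rightarrow> ('s \<Rightarrow> 's \<Rightarrow> real) \<Rightarrow> real \<Rightarrow> 's \<Rightarrow> 's \<Rightarrow> real" where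
  "transition S Q t x y = (\<Sum>k. t ^ k / fact k * gen_power S Q k x y)"

text \<open>
  A right-continuous process \<open>X\<close> (for the discrete topology on \<open>S\<close>) that starts in \<open>x0\<close> and is
  Markov with generator matrix \<open>Q\<close>.
\<close>
definition ctmc ::
  "'w measure \<Rightarrow> 's set \<Rightarrow> ('s \<Rightarrow> 's \<Rightarrow> real) \<Rightarrow> 's \<Rightarrow> (real \<Rightarrow> 'w \<Rightarrow> 's) \<Rightarrow> bool" where
  "ctmc M S Q x0 X \<longleftrightarrow>
     prob_space M \<and> finite S \<and> x0 \<in> S \<and>
     (\<forall>t\<ge>0. X t \<in> measurable M (count_space S)) \<and>
     (\<forall>\<omega>\<in>space M. \<forall>t\<ge>0. \<forall>\<^sub>F u in at_right t. X u \<omega> = X t \<omega>) \<and>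
     (AE \<omega> in M. X 0 \<omega> = x0) \<and>
     (\<forall>k (t :: nat \<Rightarrow> real) (x :: nat \<Rightarrow> 's).
        0 \<le> t 0 \<longrightarrow> (\<forall>i\<le>k. t i \<le> t (Suc i)) \<longrightarrow> (\<forall>i\<le>Suc k. x i \<in> S) \<longrightarrow>
        \<P>(\<omega> in M. \<forall>i\<le>k. X (t i) \<omega> = x i) > 0 \<longrightarrow>
        \<P>(\<omega> in M. X (t (Suc k)) \<omega> = x (Suc k) \<bar> \<forall>i\<le>k. X (t i) \<omega> = x i) =
          transition S Q (t (Suc k) - t k) (x k) (x (Suc k)))"


section \<open>The beta-splitting tree\<close>

definition split_rate :: "real \<Rightarrow> nat \<Rightarrow> real" where
  "split_rate \<beta> m = Re (phi_int \<beta> (of_nat (m - 1)))"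

definition split_prob :: "real \<Rightarrow> nat \<Rightarrow> nat \<Rightarrow> real" where
  "split_prob \<beta> m i =
     1 / (2 * split_rate \<beta> m) * real (m choose i) * Beta (real i + \<beta> + 1) (real (m - i) + \<beta> + 1)"

text \<open>The block \<open>B\<close> of \<open>P\<close> is replaced by the ordered pair \<open>A\<close>, \<open>B - A\<close>.\<close>
definition split_block :: "nat set set \<Rightarrow> nat set \<Rightarrow> nat set \<Rightarrow> nat set set" where
  "split_block P B A = insert A (insert (B - A) (P - {B}))"

text \<open>
  Distribution of the next partition when \<open>B\<close> is the block that splits: the first block \<open>A\<close> has
  size \<open>i\<close> with probability \<open>split_prob \<beta> (card B) i\<close> and, given its size, is uniform.
\<close>
definition split_kernel :: "real \<Rightarrow> nat set set \<Rightarrow> nat set \<Rightarrow> nat set set \<Rightarrow> real" where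
  "split_kernel \<beta> P B P' =
     (\<Sum>i = 1..card B - 1. split_prob \<beta> (card B) i *
        (\<Sum>A | A \<subseteq> B \<and> card A = i. of_bool (split_block P B A = P') / real (card B choose i)))"

text \<open>
  Blocks evolve independently, so the generator is the sum over the non-singleton blocks of
  rate times (jump kernel minus identity); the subtracted identities form the diagonal.
\<close>
definition split_generator :: "real \<Rightarrow> nat set set \<Rightarrow> nat set set \<Rightarrow> real" where
  "split_generator \<beta> P P' =
     (\<Sum>B | B \<in> P \<and> card B \<ge> 2.
        split_rate \<beta> (card B) * (split_kernel \<beta> P B P' - of_bool (P' = P)))"

text \<open>
  \<open>X\<close> is the partition-valued chain on \<open>n\<close> leaves and \<open>U\<close> a uniform label independent of the
  whole process \<open>X\<close>.
\<close>
definition beta_splitting_tree ::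
  "real \<Rightarrow> nat \<Rightarrow> 'w measure \<Rightarrow> (real \<Rightarrow> 'w \<Rightarrow> nat set set) \<Rightarrow> ('w \<Rightarrow> nat) \<Rightarrow> bool" where
  "beta_splitting_tree \<beta> n M X U \<longleftrightarrow>
     ctmc M {P. partition_on {1..n} P} (split_generator \<beta>) {{1..n}} X \<and>
     U \<in> measurable M (count_space {1..n}) \<and>
     distr M (count_space {1..n}) U = uniform_count_measure {1..n} \<and>
     prob_space.indep_set M
       (sets (vimage_algebra (space M) U (count_space {1..n})))
       (sets (vimage_algebra (space M) (\<lambda>\<omega>. \<lambda>t\<in>{0..}. X t \<omega>)
          (Pi\<^sub>M {0..} (\<lambda>_. count_space {P. partition_on {1..n} P}))))"

definition leaf_height :: "(real \<Rightarrow> 'w \<Rightarrow> nat set set) \<Rightarrow> ('w \<Rightarrow> nat) \<Rightarrow> 'w \<Rightarrow> real" where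
  "leaf_height X U \<omega> = Inf {t. 0 \<le> t \<and> {U \<omega>} \<in> X t \<omega>}"


section \<open>The terms of the expansion\<close>

definition expansion_main :: "real \<Rightarrow> nat \<Rightarrow> complex" where
  "expansion_main \<beta> n = harm (n - 1) / mu \<beta> - (deriv ^^ 2) (phi \<beta>) 0 / (2 * (mu \<beta>)\<^sup>2)"

definition zero_term :: "real \<Rightarrow> nat \<Rightarrow> nat \<Rightarrow> complex" where
  "zero_term \<beta> n k =
     (let s = complex_of_real (phi_zero \<beta> k)
      in Gamma (- s) * Gamma (of_nat n) / (deriv (phi \<beta>) s * Gamma (of_nat n - s)))"

end

theory Submission
  imports Defs "HOL-Real_Asymp.Real_Asymp"
begin

text \<open>
  Write \<open>\<phi>\<close> for \<open>\<phi>\<^sub>\<beta>\<close>, \<open>a\<^sub>m = m + \<beta> + 2\<close> and \<open>c\<^sub>m\<close> for the coefficient of \<open>s ^ m\<close> in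
  \<open>(1 - s) powr \<beta>\<close>, which is positive because \<open>\<beta> < 0\<close>. The argument is elementary: instead of a
  contour integral for a Rice sum it uses partial fractions and a limit under the sum.

  The mean height. The block of a label \<open>u\<close> shrinks from size \<open>m\<close> to size \<open>i\<close> at the rate
  \<open>(m - 1 choose i - 1) B(i + \<beta> + 1, m - i + \<beta> + 1)\<close>. On functions of \<open>m\<close>, minus the generator of this
  chain has the eigenfunctions \<open>m \<mapsto> (m - 1 choose j)\<close> with eigenvalues \<open>\<phi>(j)\<close>
  (\<open>tagged_rate_binomial\<close>). Expanding the constant 1 in them, which is possible for \<open>m \<ge> 2\<close>,
  and dividing by the eigenvalues gives the function
  \<open>d(n) = \<Sum>\<^sub>j (-1)^(j+1) (n - 1 choose j) / \<phi>(j)\<close> that the generator of the block size maps to \<open>-1\<close>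
  at every \<open>n \<ge> 2\<close>. In the full tree, the mean of \<open>d\<close> at the size of the block of \<open>u\<close> therefore has
  minus the probability that \<open>u\<close> is not yet isolated as its derivative in time. Singletons are
  absorbing, so this probability decreases; having a bounded integral, it tends to 0, and with it the
  mean of \<open>d\<close>. Integrating over time gives
  \<open>E D\<^sub>n = d(n)\<close> (\<open>expected_leaf_height\<close>).

  The zeros. Integrating the binomial series term by term yields
  \<open>\<phi>(z) = \<Sum>\<^sub>m c\<^sub>m z / (a\<^sub>m (a\<^sub>m + z))\<close> (\<open>phi_int_eq_stieltjes\<close>), which is also the meromorphic extension.
  The quotient \<open>\<phi>(z) / z\<close> has an imaginary part of the sign opposite to that of \<open>Im z\<close>, so all zeros are
  real. Between two consecutive poles \<open>\<phi>\<close> increases from \<open>-\<infinity>\<close> to \<open>\<infinity>\<close>, so there is exactly one zero in each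
  gap, and besides these only the zero 0 (\<open>phi_zeros_eq\<close>).

  The expansion. If the series for \<open>\<phi>\<close> is cut off after finitely many terms, it is a rational function
  whose reciprocal has simple poles at the zeros. Inserting its partial fractions into \<open>d(n)\<close> and using
  \<open>\<Sum>\<^sub>j (-1)^j (N choose j) / (x + j) = B(x, N + 1)\<close> gives the expansion for the truncated function
  (\<open>finite_rice_sum\<close>). A zero \<open>s\<close> between \<open>- a\<^sub>k\<^sub>+\<^sub>1\<close> and \<open>- a\<^sub>k\<close> has distance less than 1 from the
  pole \<open>- a\<^sub>k\<close>, hence \<open>\<phi>'(s) \<ge> c\<^sub>k\<close>, while \<open>B(- s, n) \<le> 1 / a\<^sub>k\<^sup>2\<close> for \<open>n \<ge> 2\<close>. So the terms of the zero
  series are at most \<open>1 / (c\<^sub>k a\<^sub>k\<^sup>2)\<close>, which is of order \<open>k powr (\<beta> - 1)\<close> and summable, uniformly in the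
  truncation level; Tannery's theorem gives the exact formula (\<open>rice_sum\<close>). Finally,
  \<open>B(y, n) / B(x, n)\<close> decreases in \<open>n\<close> for \<open>y \<ge> x\<close>, so that the remainder after \<open>r\<close> zeros is of the order of
  its first term \<open>B(- s, n)\<close> with \<open>s\<close> the zero number \<open>r + 1\<close>, that is, of order \<open>n powr s\<close>
  (\<open>zero_series_tail\<close>).
\<close>

text \<open>
  Tannery's theorem with a single bound that holds from some index \<open>K\<close> on, for all points of a
  neighbourhood or for all truncation levels at once. Limits are taken through it under the series
  over the poles as well as under the series over the zeros.
\<close>
lemma tannery_uniform:
  fixes f :: "nat \<Rightarrow> 'b \<Rightarrow> 'a :: {real_normed_algebra, banach}"
  assumes "\<And>k. (f k \<longlongrightarrow> g k) F" and "eventually P F"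
    and "\<And>k x. k \<ge> K \<Longrightarrow> P x \<Longrightarrow> norm (f k x) \<le> B k"
    and "summable B" "F \<noteq> bot"
  shows "((\<lambda>x. \<Sum>k. f k x) \<longlongrightarrow> (\<Sum>k. g k)) F"
proof -
  have "eventually (\<lambda>(k, x). norm (f k x) \<le> B k) (at_top \<times>\<^sub>F F)"
    unfolding eventually_prod_filter
    using assms(2,3) eventually_ge_at_top[of K] by (metis (mono_tags, lifting) case_prod_conv)
  with tannerys_theorem[of f g F B] assms show ?thesis by blast
qed

section \<open>Stieltjes series with poles at unit distance\<close>

text \<open>
  For \<open>b = \<beta> + 2\<close> and the binomial weights introduced below this is \<open>\<phi>\<^sub>\<beta>\<close>. The type of the argument
  is left open because the zeros are studied on the real line and the extension in the plane. By
  division by zero, a term contributes nothing at its own pole.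
\<close>
definition stieltjes :: "real \<Rightarrow> (nat \<Rightarrow> real) \<Rightarrow> 'a :: {real_normed_field, banach} \<Rightarrow> 'a" where
  "stieltjes b w z = (\<Sum>m. of_real (w m) * z / (of_real (real m + b) * (of_real (real m + b) + z)))"

definition stieltjes_deriv :: "real \<Rightarrow> (nat \<Rightarrow> real) \<Rightarrow> 'a :: {real_normed_field, banach} \<Rightarrow> 'a" where
  "stieltjes_deriv b w z = (\<Sum>m. of_real (w m) / (of_real (real m + b) + z) ^ 2)"

definition weights :: "real \<Rightarrow> (nat \<Rightarrow> real) \<Rightarrow> bool" where
  "weights b w \<longleftrightarrow> b > 0 \<and> (\<forall>m. w m \<ge> 0) \<and> summable (\<lambda>m. w m / (real m + b) ^ 2)"

text \<open>
  A zero weight produces no pole. With this convention truncated series, and series from which one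
  weight has been removed, are instances of the same definitions.
\<close>
definition off_poles :: "real \<Rightarrow> (nat \<Rightarrow> real) \<Rightarrow> 'a :: real_normed_field \<Rightarrow> bool" where
  "off_poles b w z \<longleftrightarrow> (\<forall>m. w m \<noteq> 0 \<longrightarrow> of_real (real m + b) + z \<noteq> 0)"

lemma norm_inverse_shift_le:
  fixes z :: "'a :: real_normed_field"
  assumes "norm z \<le> R" "2 * R \<le> t" "t > 0"
  shows "norm (inverse (of_real t + z)) \<le> 2 / t"
proof -
  have "t / 2 \<le> norm (of_real t :: 'a) - norm z" using assms by simp
  also have "\<dots> \<le> norm (of_real t + z)" by (metis norm_diff_ineq)
  finally have "inverse (norm (of_real t + z)) \<le> inverse (t / 2)"
    using assms by (intro le_imp_inverse_le) auto
  then show ?thesis by (simp add: norm_inverse)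
qed

text \<open>
  The estimate behind the limits in the point and in the truncation level: once \<open>m\<close> exceeds twice the radius of the region under
  consideration, the term is comparable with that of the convergent series of
  \<open>w m / (m + b)\<^sup>2\<close>.
\<close>
lemma stieltjes_kernel_bound:
  fixes z z' :: "'a :: real_normed_field"
  assumes w: "weights b w" and "norm z \<le> R" "norm z' \<le> R" "2 * R \<le> real m"
  shows "norm (of_real (w m) / ((of_real (real m + b) + z) * (of_real (real m + b) + z')))
      \<le> 4 * (w m / (real m + b)\<^sup>2)"
proof -
  have b: "b > 0" "w m \<ge> 0" using w by (auto simp: weights_def)
  have 1: "norm (inverse (of_real (real m + b) + z)) \<le> 2 / (real m + b)"
    using assms b by (intro norm_inverse_shift_le) auto
  have 2: "norm (inverse (of_real (real m + b) + z')) \<le> 2 / (real m + b)"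
    using assms b by (intro norm_inverse_shift_le) auto
  have "norm (of_real (w m) / ((of_real (real m + b) + z) * (of_real (real m + b) + z')))
     = w m * (norm (inverse (of_real (real m + b) + z)) * norm (inverse (of_real (real m + b) + z')))"
    using b by (simp add: divide_inverse norm_mult norm_inverse)
  also have "\<dots> \<le> w m * (2 / (real m + b) * (2 / (real m + b)))"
    using 1 2 b by (intro mult_left_mono mult_mono) auto
  finally show ?thesis by (simp add: power2_eq_square mult.commute)
qed

lemma summable_stieltjes_kernel:
  fixes z z' :: "'a :: {real_normed_field, banach}"
  assumes w: "weights b w"
  shows "summable (\<lambda>m. of_real (w m) / ((of_real (real m + b) + z) * (of_real (real m + b) + z')))"
proof (rule summable_comparison_test_ev)
  define R where "R = max (norm z) (norm z')"
  show "\<forall>\<^sub>F m in sequentially. norm (of_real (w m) / ((of_real (real m + b) + z) * (of_real (real m + b) + z')))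
      \<le> 4 * (w m / (real m + b)\<^sup>2)"
    using eventually_ge_at_top[of "nat \<lceil>2 * R\<rceil>"]
  proof eventually_elim
    case (elim m)
    then have "2 * R \<le> real m" by linarith
    then show ?case by (intro stieltjes_kernel_bound[OF w, of _ R]) (auto simp: R_def)
  qed
  show "summable (\<lambda>m. 4 * (w m / (real m + b)\<^sup>2))"
    using w by (intro summable_mult) (auto simp: weights_def)
qed

lemma summable_stieltjes:
  fixes z :: "'a :: {real_normed_field, banach}"
  assumes w: "weights b w"
  shows "summable (\<lambda>m. of_real (w m) * z / (of_real (real m + b) * (of_real (real m + b) + z)))"
  using summable_mult[OF summable_stieltjes_kernel[OF w, of 0 z], of z] by (simp add: mult_ac)

lemma summable_stieltjes_deriv:
  fixes z :: "'a :: {real_normed_field, banach}"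
  assumes w: "weights b w"
  shows "summable (\<lambda>m. of_real (w m) / (of_real (real m + b) + z)\<^sup>2)"
  using summable_stieltjes_kernel[OF w, of z z] by (simp add: power2_eq_square)

text \<open>
  The difference quotient is again such a series, and at real points that lie on the same side of
  every pole its terms are nonnegative. Differentiability, monotonicity between the poles and the
  absence of nonreal zeros all rest on this identity.
\<close>
lemma stieltjes_diff:
  fixes z z' :: "'a :: {real_normed_field, banach}"
  assumes w: "weights b w" and z: "off_poles b w z" "off_poles b w z'"
  shows "stieltjes b w z' - stieltjes b w z =
    (z' - z) * (\<Sum>m. of_real (w m) / ((of_real (real m + b) + z) * (of_real (real m + b) + z')))"
proof -
  have "stieltjes b w z' - stieltjes b w z =
    (\<Sum>m. of_real (w m) * z' / (of_real (real m + b) * (of_real (real m + b) + z'))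
        - of_real (w m) * z / (of_real (real m + b) * (of_real (real m + b) + z)))"
    unfolding stieltjes_def using summable_stieltjes[OF w] by (intro suminf_diff)
  also have "\<dots> = (\<Sum>m. (z' - z) * (of_real (w m) / ((of_real (real m + b) + z) * (of_real (real m + b) + z'))))"
  proof (intro suminf_cong)
    fix m
    have "w m \<noteq> 0 \<Longrightarrow> of_real (real m + b) + z \<noteq> 0 \<and> of_real (real m + b) + z' \<noteq> 0"
      using z by (auto simp: off_poles_def)
    moreover have "(of_real (real m + b) :: 'a) \<noteq> 0" using w
      by (metis add_pos_nonneg add.commute of_nat_0_le_iff less_irrefl of_real_eq_0_iff weights_def)
    moreover have "c * z' / (a * (a + z')) - c * z / (a * (a + z)) = (z' - z) * (c / ((a + z) * (a + z')))"
      if "c \<noteq> 0 \<Longrightarrow> a + z \<noteq> 0 \<and> a + z' \<noteq> 0" "a \<noteq> 0" for a c :: 'a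
      using that by (cases "c = 0") (auto simp: divide_simps, simp add: algebra_simps)
    ultimately show "of_real (w m) * z' / (of_real (real m + b) * (of_real (real m + b) + z'))
        - of_real (w m) * z / (of_real (real m + b) * (of_real (real m + b) + z)) =
        (z' - z) * (of_real (w m) / ((of_real (real m + b) + z) * (of_real (real m + b) + z')))"
      by (metis of_real_eq_0_iff)
  qed
  also have "\<dots> = (z' - z) * (\<Sum>m. of_real (w m) / ((of_real (real m + b) + z) * (of_real (real m + b) + z')))"
    by (intro suminf_mult summable_stieltjes_kernel w)
  finally show ?thesis .
qed

text \<open>
  Only finitely many poles lie within distance 1 of a given point, as they are spaced by 1.
\<close>
lemma eventually_off_poles:
  fixes z :: "'a :: real_normed_field"
  shows "eventually (off_poles b w) (at z)"
proof -
  define K where "K = nat \<lceil>norm z + 1 - b\<rceil>"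
  have "eventually (\<lambda>x. x \<noteq> - of_real (real m + b)) (at z)" for m
    by (cases "z = - of_real (real m + b)")
       (auto intro: t1_space_nhds eventually_neq_at_within)
  then have "eventually (\<lambda>x. \<forall>m\<in>{..K}. x \<noteq> - of_real (real m + b)) (at z)"
    by (intro eventually_ball_finite) auto
  moreover have "eventually (\<lambda>x. dist x z < 1) (at z)" 
    by (meson eventually_at zero_less_one)
  ultimately show ?thesis
  proof eventually_elim
    case (elim x)
    show ?case unfolding off_poles_def
    proof safe
      fix m assume *: "of_real (real m + b) + x = 0"
      then have "x = - of_real (real m + b)" by (metis eq_neg_iff_add_eq_0 add.commute)
      moreover have "norm (- of_real (real m + b) :: 'a) = \<bar>real m + b\<bar>" by (metis norm_minus_cancel norm_of_real)
      ultimately have "norm x = \<bar>real m + b\<bar>" "m > K" using elim by (auto simp: not_le[symmetric])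
      moreover have "norm x < norm z + 1" using elim 
        by (smt (verit) dist_norm norm_triangle_sub)
      ultimately show False unfolding K_def by linarith
    qed
  qed
qed

lemma has_field_derivative_stieltjes:
  fixes z :: "'a :: {real_normed_field, banach}"
  assumes w: "weights b w" and z: "off_poles b w z"
  shows "(stieltjes b w has_field_derivative stieltjes_deriv b w z) (at z)"
proof -
  define k where "k = (\<lambda>m x. of_real (w m) / ((of_real (real m + b) + z) * (of_real (real m + b) + x)))"
  have "((\<lambda>x. \<Sum>m. k m x) \<longlongrightarrow> (\<Sum>m. of_real (w m) / (of_real (real m + b) + z)\<^sup>2)) (at z)"
  proof (rule tannery_uniform[where P = "\<lambda>x. dist x z < 1" and B = "\<lambda>m. 4 * (w m / (real m + b)\<^sup>2)"
          and K = "nat \<lceil>2 * (norm z + 1)\<rceil>"])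
    fix m
    show "(k m \<longlongrightarrow> of_real (w m) / (of_real (real m + b) + z)\<^sup>2) (at z)"
    proof (cases "w m = 0")
      case False
      then show ?thesis using z unfolding k_def
        by (auto intro!: tendsto_eq_intros simp: off_poles_def power2_eq_square)
    qed (simp add: k_def)
  next
    show "\<forall>\<^sub>F x in at z. dist x z < 1" by (meson eventually_at zero_less_one)
  next
    fix m x assume *: "nat \<lceil>2 * (norm z + 1)\<rceil> \<le> m" "dist x z < 1"
    then have "norm x \<le> norm z + 1" by (smt (verit) dist_norm norm_triangle_sub)
    with * show "norm (k m x) \<le> 4 * (w m / (real m + b)\<^sup>2)" unfolding k_def
      by (intro stieltjes_kernel_bound[OF w, where R = "norm z + 1"]) linarith+
  next
    show "summable (\<lambda>m. 4 * (w m / (real m + b)\<^sup>2))"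
      using w by (intro summable_mult) (auto simp: weights_def)
  qed simp
  then have "((\<lambda>x. \<Sum>m. k m x) \<longlongrightarrow> stieltjes_deriv b w z) (at z)" by (simp add: stieltjes_deriv_def)
  moreover have "eventually (\<lambda>x. (\<Sum>m. k m x) = (stieltjes b w x - stieltjes b w z) / (x - z)) (at z)"
    using eventually_off_poles[of b w z] eventually_neq_at_within[of z]
  proof eventually_elim
    case (elim x)
    then show ?case using stieltjes_diff[OF w z, of x] by (simp add: k_def)
  qed
  ultimately show ?thesis unfolding has_field_derivative_iff by (rule Lim_transform_eventually)
qed

lemma stieltjes_of_real:
  assumes "weights b w"
  shows "stieltjes b w (of_real x :: 'a :: {real_normed_field, banach}) = of_real (stieltjes b w x)"
proof -
  have "stieltjes b w x = (\<Sum>m. w m * x / ((real m + b) * (real m + b + x)))"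
    by (simp add: stieltjes_def)
  moreover have "summable (\<lambda>m. w m * x / ((real m + b) * (real m + b + x)))"
    using summable_stieltjes[OF assms, of x] by simp
  ultimately show ?thesis by (simp add: suminf_of_real) (simp add: stieltjes_def)
qed

lemma stieltjes_deriv_of_real:
  assumes "weights b w"
  shows "stieltjes_deriv b w (of_real x :: 'a :: {real_normed_field, banach}) = of_real (stieltjes_deriv b w x)"
proof -
  have "stieltjes_deriv b w x = (\<Sum>m. w m / (real m + b + x)\<^sup>2)"
    by (simp add: stieltjes_deriv_def)
  moreover have "summable (\<lambda>m. w m / (real m + b + x)\<^sup>2)"
    using summable_stieltjes_deriv[OF assms, of x] by simp
  ultimately show ?thesis by (simp add: suminf_of_real) (simp add: stieltjes_deriv_def)
qed

lemma weights_update_0: "weights b w \<Longrightarrow> weights b (w(k := 0))"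
  unfolding weights_def by (auto intro: summable_comparison_test' [where g = "\<lambda>m. w m / (real m + b)\<^sup>2" and N = 0])

text \<open>
  Isolates pole \<open>k\<close>: the first summand is regular there.
\<close>
lemma stieltjes_split:
  fixes z :: "'a :: {real_normed_field, banach}"
  assumes w: "weights b w"
  shows "stieltjes b w z = stieltjes b (w(k := 0)) z
    + of_real (w k) * z / (of_real (real k + b) * (of_real (real k + b) + z))"
proof -
  define f where "f = (\<lambda>w m. of_real (w m) * z / (of_real (real m + b) * (of_real (real m + b) + z)))"
  have "(\<Sum>m. f w m) = (\<Sum>m. f (w(k := 0)) m + (if m = k then f w k else 0))"
    by (intro suminf_cong) (auto simp: f_def)
  also have "\<dots> = (\<Sum>m. f (w(k := 0)) m) + (\<Sum>m. if m = k then f w k else 0)"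
    using summable_stieltjes[OF weights_update_0[OF w]]
    by (intro suminf_add[symmetric]) (auto simp: f_def)
  also have "(\<Sum>m. if m = k then f w k else 0) = f w k"
    using sums_unique[OF sums_single[of k "\<lambda>_. f w k"]] by simp
  finally show ?thesis by (simp add: f_def stieltjes_def)
qed

section \<open>Real zeros between the poles\<close>

lemma off_poles_between:
  assumes "- (real (Suc k) + b) < x" "x < - (real k + b)"
  shows "off_poles b w x"
  unfolding off_poles_def
proof safe
  fix m assume "of_real (real m + b) + x = (0::real)"
  then have "real k < real m" "real m < real (Suc k)" using assms by auto
  then have "k < m" "m < Suc k" unfolding of_nat_less_iff by auto
  then show False by linarith
qed

text \<open>
  Between two consecutive poles, \<open>m + b + x\<close> and \<open>m + b + y\<close> have the same sign for every \<open>m\<close>, so the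
  series for the difference quotient is positive.
\<close>
lemma stieltjes_mono_between:
  assumes w: "weights b w" "w k > 0"
    and "- (real (Suc k) + b) < x" "x < y" "y < - (real k + b)"
  shows "stieltjes b w x < stieltjes b w y"
proof -
  have sgn: "0 < (real m + b + x) * (real m + b + y)" for m
  proof (cases "m \<le> k")
    case True
    then have "real m \<le> real k" by simp
    then show ?thesis using assms by (intro mult_neg_neg) auto
  next
    case False
    then have "real m \<ge> real (Suc k)" by simp
    then show ?thesis using assms by (intro mult_pos_pos) auto
  qed
  have "0 < (\<Sum>m. w m / ((real m + b + x) * (real m + b + y)))"
  proof (rule suminf_pos2)
    show "summable (\<lambda>m. w m / ((real m + b + x) * (real m + b + y)))"
      using summable_stieltjes_kernel[OF w(1), of x y] by simp
    show "0 \<le> w m / ((real m + b + x) * (real m + b + y))" for m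
      using sgn[of m] w by (auto simp: weights_def)
    show "0 < w k / ((real k + b + x) * (real k + b + y))"
      using sgn[of k] w by auto
  qed
  then have "0 < (y - x) * (\<Sum>m. w m / ((real m + b + x) * (real m + b + y)))"
    using assms by simp
  also have "\<dots> = stieltjes b w y - stieltjes b w x"
    using stieltjes_diff[OF w(1) off_poles_between[of k b] off_poles_between[of k b], of x y] assms by simp
  finally show ?thesis by simp
qed

lemma stieltjes_isCont:
  fixes x :: "'a :: {real_normed_field, banach}"
  assumes "weights b w" "off_poles b w x" shows "isCont (stieltjes b w) x"
  using has_field_derivative_stieltjes[OF assms] by (rule DERIV_isCont)

lemma off_poles_update_0: "off_poles b (w(k := 0)) (- (real k + b))"
  by (auto simp: off_poles_def)

text \<open>
  Near \<open>- (k + b)\<close> the term of pole \<open>k\<close> is a negative number divided by the small quantity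
  \<open>k + b + x\<close>, and the other terms stay bounded.
\<close>
lemma stieltjes_at_pole:
  assumes w: "weights b w" "w k > 0"
  shows "filterlim (stieltjes b w) at_top (at_left (- (real k + b)))"
    and "filterlim (stieltjes b w) at_bot (at_right (- (real k + b)))"
proof -
  define a where "a = real k + b"
  have a: "a > 0" using w by (simp add: a_def weights_def)
  have S: "stieltjes b w = (\<lambda>x. stieltjes b (w(k := 0)) x + w k * x / (a * (a + x)))"
    using stieltjes_split[OF w(1), of "_ :: real" k] by (intro ext) (simp add: a_def)
  have rest: "(stieltjes b (w(k := 0)) \<longlongrightarrow> stieltjes b (w(k := 0)) (- a)) (at (- a) within T)" for T
    using stieltjes_isCont[OF weights_update_0[OF w(1)] off_poles_update_0]
    unfolding a_def by (metis isContD subset_UNIV tendsto_within_subset)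
  have num: "((\<lambda>x. w k * x / a) \<longlongrightarrow> w k * (- a) / a) (at (- a) within T)" for T
    using a by (intro tendsto_intros) auto
  have neg: "w k * (- a) / a < 0" using a w by (intro divide_neg_pos mult_pos_neg) auto
  have "filterlim (\<lambda>x. a + x) (at_left 0) (at_left (- a))" "filterlim (\<lambda>x. a + x) (at_right 0) (at_right (- a))"
    unfolding filterlim_at by (auto intro!: tendsto_eq_intros simp: eventually_at_filter)
  note inv = filterlim_compose[OF filterlim_inverse_at_bot_neg this(1)]
    filterlim_compose[OF filterlim_inverse_at_top_right this(2)]
  have "filterlim (\<lambda>x. (w k * x / a) * (- (1 / (a + x)))) at_bot (at_left (- a))"
    using inv(1) by (intro filterlim_tendsto_neg_mult_at_bot[OF num neg])
      (simp add: filterlim_uminus_at_bot inverse_eq_divide)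
  then have "filterlim (\<lambda>x. w k * x / (a * (a + x))) at_top (at_left (- a))"
    by (simp add: filterlim_uminus_at_bot)
  then show "filterlim (stieltjes b w) at_top (at_left (- (real k + b)))"
    unfolding S a_def[symmetric] by (rule filterlim_tendsto_add_at_top[OF rest])
  have "filterlim (\<lambda>x. (w k * x / a) * (1 / (a + x))) at_bot (at_right (- a))"
    using inv(2) by (intro filterlim_tendsto_neg_mult_at_bot[OF num neg]) (simp add: inverse_eq_divide)
  then have "filterlim (\<lambda>x. - (w k * x / (a * (a + x)))) at_top (at_right (- a))"
    by (simp add: filterlim_uminus_at_bot)
  then show "filterlim (stieltjes b w) at_bot (at_right (- (real k + b)))"
    unfolding S a_def[symmetric] filterlim_uminus_at_bot minus_add_distrib
    by (rule filterlim_tendsto_add_at_top[OF tendsto_minus[OF rest]])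
qed

text \<open>
  The function increases from \<open>-\<infinity>\<close> to \<open>\<infinity>\<close> between two poles.
\<close>
lemma ex1_stieltjes_zero_between:
  assumes w: "weights b w" "w k > 0" "w (Suc k) > 0"
  shows "\<exists>!x. - (real (Suc k) + b) < x \<and> x < - (real k + b) \<and> stieltjes b w x = 0"
proof (rule ex_ex1I)
  let ?l = "- (real (Suc k) + b)" and ?r = "- (real k + b)" 
  define m where "m = - (real k + b + 1/2)"
  have lr: "?l < m" "m < ?r" by (auto simp: m_def)
  have "eventually (\<lambda>x. x \<in> {m<..<?r}) (at_left ?r)" "eventually (\<lambda>x. x \<in> {?l<..<m}) (at_right ?l)"
    using eventually_at_left_real[OF lr(2)] eventually_at_right_real[OF lr(1)] by auto
  moreover have "eventually (\<lambda>x. stieltjes b w x > 0) (at_left ?r)"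
    using stieltjes_at_pole(1)[OF w(1,2)] by (auto simp: filterlim_at_top_dense)
  moreover have "eventually (\<lambda>x. stieltjes b w x < 0) (at_right ?l)"
    using stieltjes_at_pole(2)[OF w(1,3)] by (auto simp: filterlim_at_bot_dense)
  ultimately have "eventually (\<lambda>x. x \<in> {m<..<?r} \<and> stieltjes b w x > 0) (at_left ?r)"
    "eventually (\<lambda>x. x \<in> {?l<..<m} \<and> stieltjes b w x < 0) (at_right ?l)"
    by (auto elim: eventually_elim2)
  then obtain x y where xy: "m < y" "y < ?r" "stieltjes b w y > 0" "?l < x" "x < m" "stieltjes b w x < 0"
    by (metis (no_types, lifting) eventually_happens greaterThanLessThan_iff trivial_limit_at_left_real trivial_limit_at_right_real)
  have "\<exists>z\<ge>x. z \<le> y \<and> stieltjes b w z = 0"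
    using xy w(1) by (intro IVT) (auto intro!: stieltjes_isCont off_poles_between[of k])
  then show "\<exists>x. ?l < x \<and> x < ?r \<and> stieltjes b w x = 0"
    using xy by (meson le_less_trans less_le_trans)
next
  fix x y
  assume "- (real (Suc k) + b) < x \<and> x < - (real k + b) \<and> stieltjes b w x = 0"
    "- (real (Suc k) + b) < y \<and> y < - (real k + b) \<and> stieltjes b w y = 0"
  then show "x = y"
    using stieltjes_mono_between[OF w(1,2), of x y] stieltjes_mono_between[OF w(1,2), of y x]
    by (cases x y rule: linorder_cases) auto
qed

text \<open>
  Zero number \<open>k\<close> lies to the left of pole \<open>k\<close>. The zero at the origin is not among them, so in the
  decreasing enumeration of all zeros this one has index \<open>k + 1\<close>.
\<close>
definition stieltjes_zero :: "real \<Rightarrow> (nat \<Rightarrow> real) \<Rightarrow> nat \<Rightarrow> real" where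
  "stieltjes_zero b w k = (THE x. - (real (Suc k) + b) < x \<and> x < - (real k + b) \<and> stieltjes b w x = 0)"

lemma stieltjes_zero:
  assumes "weights b w" "w k > 0" "w (Suc k) > 0"
  shows "- (real (Suc k) + b) < stieltjes_zero b w k" "stieltjes_zero b w k < - (real k + b)"
    "stieltjes b w (stieltjes_zero b w k) = 0"
  using theI'[OF ex1_stieltjes_zero_between[OF assms]] unfolding stieltjes_zero_def by blast+

lemma stieltjes_sign:
  assumes w: "weights b w" "w k > 0" "w (Suc k) > 0"
    and x: "- (real (Suc k) + b) < x" "x < - (real k + b)"
  shows "stieltjes b w x < 0 \<longleftrightarrow> x < stieltjes_zero b w k"
    and "0 < stieltjes b w x \<longleftrightarrow> stieltjes_zero b w k < x"
  using stieltjes_mono_between[OF w(1,2), of x "stieltjes_zero b w k"]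
    stieltjes_mono_between[OF w(1,2), of "stieltjes_zero b w k" x] stieltjes_zero[OF w] x
  by (cases x "stieltjes_zero b w k" rule: linorder_cases; force)+

text \<open>
  The point is at distance less than 1 from pole \<open>k\<close>, so the term of that pole alone is at least
  \<open>w k\<close>. At the zeros this bounds the residues of the reciprocal by \<open>1 / w k\<close>, and the bound does not
  change when the series is truncated.
\<close>
lemma stieltjes_deriv_ge:
  assumes w: "weights b w" and "- (real (Suc k) + b) < x" "x < - (real k + b)"
  shows "w k \<le> stieltjes_deriv b w x"
proof -
  have "(real k + b + x)\<^sup>2 \<le> 1" "(real k + b + x)\<^sup>2 > 0" using assms 
    by (auto simp: abs_square_le_1)
  then have "w k * (real k + b + x)\<^sup>2 \<le> w k" using w by (intro mult_left_le) (auto simp: weights_def)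
  then have "w k \<le> w k / (real k + b + x)\<^sup>2" using \<open>(real k + b + x)\<^sup>2 > 0\<close> by (simp add: field_simps)
  also have "\<dots> = (\<Sum>m\<in>{k}. w m / (real m + b + x)\<^sup>2)" by simp
  also have "\<dots> \<le> (\<Sum>m. w m / (real m + b + x)\<^sup>2)"
    using summable_stieltjes_deriv[OF w, of x] w by (intro sum_le_suminf) (auto simp: weights_def)
  finally show ?thesis by (simp add: stieltjes_deriv_def)
qed

lemma stieltjes_pos:
  fixes x :: real
  assumes w: "weights b w" "w 0 > 0" "x > 0"
  shows "stieltjes b w x > 0"
proof -
  have b: "b > 0" using w by (auto simp: weights_def)
  have "(\<Sum>m. w m * x / ((real m + b) * (real m + b + x))) > 0"
    using summable_stieltjes[OF w(1), of x] w b
    by (intro suminf_pos2[of _ 0]) (auto simp: weights_def intro!: divide_nonneg_nonneg)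
  then show ?thesis by (simp add: stieltjes_def)
qed

section \<open>Truncation\<close>

definition trunc :: "nat \<Rightarrow> (nat \<Rightarrow> real) \<Rightarrow> nat \<Rightarrow> real" where
  "trunc M w m = (if m < M then w m else 0)"

lemma weights_trunc: "weights b w \<Longrightarrow> weights b (trunc M w)"
  unfolding weights_def trunc_def
  by (auto intro: summable_comparison_test' [where g = "\<lambda>m. w m / (real m + b)\<^sup>2" and N = 0])

text \<open>
  The argument has to vary together with the truncation level, because the zeros of the truncated
  series move.
\<close>
lemma trunc_limits:
  fixes z :: "nat \<Rightarrow> 'a :: {real_normed_field, banach}"
  assumes w: "weights b w" and z: "z \<longlonglongrightarrow> z0" and off: "off_poles b w z0"
  shows "(\<lambda>M. stieltjes b (trunc M w) (z M)) \<longlonglongrightarrow> stieltjes b w z0"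
    and "(\<lambda>M. stieltjes_deriv b (trunc M w) (z M)) \<longlonglongrightarrow> stieltjes_deriv b w z0"
proof -
  have b: "b > 0" using w by (auto simp: weights_def)
  have nz: "real m + b \<noteq> 0" for m using b by (metis add_nonneg_pos less_irrefl of_nat_0_le_iff)
  define R where "R = norm z0 + 1"
  have ev: "eventually (\<lambda>M. norm (z M) \<le> R) sequentially"
    using order_tendstoD(2)[OF tendsto_norm[OF z], of R] by (auto simp: R_def elim: eventually_mono)
  have lt: "(\<lambda>M. of_real (trunc M w m) :: 'a) \<longlonglongrightarrow> of_real (w m)" for m
    by (rule tendsto_eventually, rule eventually_mono[OF eventually_gt_at_top[of m]]) (auto simp: trunc_def)
  have bnd: "norm (of_real (trunc M w m) / ((of_real (real m + b) + u) * (of_real (real m + b) + v)))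
      \<le> 4 * (w m / (real m + b)\<^sup>2)" if "norm u \<le> R" "norm v \<le> R" "m \<ge> nat \<lceil>2 * R\<rceil>" for m M and u v :: 'a
  proof -
    have "norm (of_real (trunc M w m) / ((of_real (real m + b) + u) * (of_real (real m + b) + v)))
      \<le> 4 * (trunc M w m / (real m + b)\<^sup>2)" 
      using that by (intro stieltjes_kernel_bound[OF weights_trunc[OF w], of _ R]) linarith+
    also have "\<dots> \<le> 4 * (w m / (real m + b)\<^sup>2)" using w 
      by (auto simp: trunc_def weights_def)
    finally show ?thesis .
  qed
  have sum: "summable (\<lambda>m. C * (w m / (real m + b)\<^sup>2))" for C
    using w by (intro summable_mult) (auto simp: weights_def)
  show "(\<lambda>M. stieltjes b (trunc M w) (z M)) \<longlonglongrightarrow> stieltjes b w z0"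
    unfolding stieltjes_def
  proof (rule tannery_uniform[OF _ ev _ sum[of "R * 4"]])
    fix m
    show "(\<lambda>x. of_real (trunc x w m) * z x / (of_real (real m + b) * (of_real (real m + b) + z x)))
         \<longlonglongrightarrow> of_real (w m) * z0 / (of_real (real m + b) * (of_real (real m + b) + z0))"
    proof (cases "w m = 0")
      case False
      have "of_real (real m + b) \<noteq> (0::'a)" using nz of_real_eq_0_iff by blast
      then show ?thesis using off False
        by (intro tendsto_divide tendsto_mult tendsto_add tendsto_const lt z) (auto simp: off_poles_def)
    next
      case True
      then have "trunc M w m = 0" for M by (simp add: trunc_def)
      with True show ?thesis by simp
    qed
  next
    fix m M assume *: "nat \<lceil>2 * R\<rceil> \<le> m" "norm (z M) \<le> R"
    have "norm (of_real (trunc M w m) * z M / (of_real (real m + b) * (of_real (real m + b) + z M))) =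
      norm (z M) * norm (of_real (trunc M w m) / ((of_real (real m + b) + 0) * (of_real (real m + b) + z M)))"
      by (simp add: norm_mult norm_divide)
    also have "\<dots> \<le> R * (4 * (w m / (real m + b)\<^sup>2))"
      using * by (intro mult_mono bnd) (auto simp: R_def)
    finally show "norm (of_real (trunc M w m) * z M / (of_real (real m + b) * (of_real (real m + b) + z M)))
         \<le> R * 4 * (w m / (real m + b)\<^sup>2)" by simp
  qed auto
  show "(\<lambda>M. stieltjes_deriv b (trunc M w) (z M)) \<longlonglongrightarrow> stieltjes_deriv b w z0"
    unfolding stieltjes_deriv_def
  proof (rule tannery_uniform[OF _ ev _ sum[of 4]])
    fix m
    show "(\<lambda>x. of_real (trunc x w m) / (of_real (real m + b) + z x)\<^sup>2)
         \<longlonglongrightarrow> of_real (w m) / (of_real (real m + b) + z0)\<^sup>2"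
    proof (cases "w m = 0")
      case False
      then show ?thesis using off
        by (intro tendsto_divide tendsto_power tendsto_add tendsto_const lt z) (auto simp: off_poles_def)
    next
      case True
      then have "trunc M w m = 0" for M by (simp add: trunc_def)
      with True show ?thesis by simp
    qed
  next
    fix m M assume *: "nat \<lceil>2 * R\<rceil> \<le> m" "norm (z M) \<le> R"
    then show "norm (of_real (trunc M w m) / (of_real (real m + b) + z M)\<^sup>2) \<le> 4 * (w m / (real m + b)\<^sup>2)"
      using bnd[of "z M" "z M" m M] by (simp add: power2_eq_square)
  qed auto
qed

text \<open>
  The sign at a point between the poles tells on which side of the zero the point lies, and from
  some truncation level on the sign no longer changes.
\<close>
lemma trunc_zero_limit:
  assumes w: "weights b w" "w k > 0" "w (Suc k) > 0"
  shows "(\<lambda>M. stieltjes_zero b (trunc M w) k) \<longlonglongrightarrow> stieltjes_zero b w k"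
proof -
  let ?s = "stieltjes_zero b w k"
  note s = stieltjes_zero[OF w]
  note lim = trunc_limits(1)[OF w(1) tendsto_const off_poles_between[of k b]]
  have evw: "eventually (\<lambda>M. trunc M w k = w k \<and> trunc M w (Suc k) = w (Suc k)) sequentially"
    using eventually_gt_at_top[of "Suc k"] by eventually_elim (auto simp: trunc_def)
  have sign: "eventually (\<lambda>M. (stieltjes b (trunc M w) x < 0 \<longleftrightarrow> x < stieltjes_zero b (trunc M w) k)
      \<and> (0 < stieltjes b (trunc M w) x \<longleftrightarrow> stieltjes_zero b (trunc M w) k < x)) sequentially"
    if "- (real (Suc k) + b) < x" "x < - (real k + b)" for x
    using evw by eventually_elim (use stieltjes_sign[OF weights_trunc[OF w(1)] _ _ that] w in auto)
  show ?thesis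
  proof (rule order_tendstoI)
    fix a assume a: "a < ?s"
    define x where "x = max a ((?s - (real (Suc k) + b)) / 2)"
    have x: "- (real (Suc k) + b) < x" "x < ?s" "a \<le> x"
      using a s by (auto simp: x_def max_def field_simps)
    then have "stieltjes b w x < 0" using stieltjes_sign(1)[OF w, of x] s by auto
    then have "eventually (\<lambda>M. stieltjes b (trunc M w) x < 0) sequentially"
      using order_tendstoD(2)[OF lim[of x]] x s by auto
    moreover have "x < - (real k + b)" using x s by linarith
    note sign[OF x(1) this]
    ultimately show "eventually (\<lambda>M. a < stieltjes_zero b (trunc M w) k) sequentially"
      by eventually_elim (use x(3) in auto)
  next
    fix a assume a: "?s < a"
    define x where "x = min a ((?s - (real k + b)) / 2)"
    have x: "x < - (real k + b)" "?s < x" "x \<le> a"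
      using a s by (auto simp: x_def min_def field_simps)
    then have "stieltjes b w x > 0" using stieltjes_sign(2)[OF w, of x] s by auto
    then have "eventually (\<lambda>M. stieltjes b (trunc M w) x > 0) sequentially"
      using order_tendstoD(1)[OF lim[of x]] x s by auto
    moreover have "- (real (Suc k) + b) < x" using x s by linarith
    note sign[OF this x(1)]
    ultimately show "eventually (\<lambda>M. stieltjes_zero b (trunc M w) k < a) sequentially"
      by eventually_elim (use x(3) in auto)
  qed
qed

section \<open>Alternating binomial sums\<close>

text \<open>
  Both sides satisfy \<open>f (N + 1) x = f N x - f N (x + 1)\<close>, the left one by Pascal's rule and the right
  one by the functional equation of the Beta function.
\<close>
lemma sum_alternating_binomial_inverse_shift:
  fixes x :: real
  assumes "x > 0"
  shows "(\<Sum>j\<le>N. (-1) ^ j * real (N choose j) / (x + real j)) = Beta x (real N + 1)"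
  using assms
proof (induction N arbitrary: x)
  case 0
  have "x * Beta x 1 = 1" using 0 
    by (simp add: Beta_def Gamma_plus1 nonpos_Ints_def Gamma_real_pos less_imp_neq[symmetric])
  then show ?case using 0 by (simp add: field_simps)
next
  case (Suc N)
  have "(\<Sum>j\<le>Suc N. (-1) ^ j * real (Suc N choose j) / (x + real j)) =
    (\<Sum>j\<le>Suc N. (-1) ^ j * real (N choose j) / (x + real j))
    - (\<Sum>j\<le>N. (-1) ^ j * real (N choose j) / (x + real (Suc j)))"
    unfolding sum.atMost_Suc_shift[of _ N] 
    by (simp add: sum.distrib[symmetric] sum_negf[symmetric] sum_subtractf[symmetric] diff_divide_distrib del: of_nat_Suc)
       (intro sum.cong refl, simp add: add_divide_distrib distrib_left del: of_nat_Suc)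
  also have "\<dots> = Beta x (real N + 1) - Beta (x + 1) (real N + 1)"
    using Suc.IH[of x] Suc.IH[of "x + 1"] Suc.prems by (simp add: add_ac binomial_eq_0)
  also have "\<dots> = Beta x (real (Suc N) + 1)"
  proof -
    have "x \<notin> \<int>\<^sub>\<le>\<^sub>0" "real N + 1 \<notin> \<int>\<^sub>\<le>\<^sub>0" using Suc.prems by (auto elim!: nonpos_Ints_cases)
    then show ?thesis using Beta_plus1_plus1[of x "real N + 1"] by (simp add: add_ac)
  qed
  finally show ?case .
qed

lemma sum_alternating_binomial_tail:
  assumes "N > 0"
  shows "(\<Sum>j=1..N. (-1) ^ Suc j * real (N choose j)) = 1"
proof -
  have "(\<Sum>j\<le>N. (-1) ^ j * real (N choose j)) = 0"
    using choose_alternating_sum[of N, where 'a = real] assms by simp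
  then have "1 + (\<Sum>j=1..N. (-1) ^ j * real (N choose j)) = 0"
    by (subst (asm) atMost_atLeast0, subst (asm) sum.atLeast_Suc_atMost) auto
  then show ?thesis by (simp add: sum_negf)
qed

text \<open>
  Pascal's rule and absorption show that passing from \<open>N\<close> to \<open>N + 1\<close> adds \<open>1 / (N + 1)\<close>.
\<close>
lemma sum_alternating_binomial_inverse:
  "(\<Sum>j=1..N. (-1) ^ Suc j * real (N choose j) / real j) = harm N"
proof (induction N)
  case 0
  then show ?case by (simp add: harm_def)
next
  case (Suc N)
  have "(\<Sum>j=1..Suc N. (-1) ^ Suc j * real (Suc N choose j) / real j) =
    (\<Sum>j=1..Suc N. (-1) ^ Suc j * real (N choose j) / real j)
    + (\<Sum>j=1..Suc N. (-1) ^ Suc j * real (N choose (j - 1)) / real j)"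
    unfolding sum.distrib[symmetric]
  proof (intro sum.cong refl)
    fix j assume "j \<in> {1..Suc N}"
    then obtain i where "j = Suc i" by (cases j) auto
    then show "(-1) ^ Suc j * real (Suc N choose j) / real j = (-1) ^ Suc j * real (N choose j) / real j +
         (-1) ^ Suc j * real (N choose (j - 1)) / real j"
      by (simp add: add_divide_distrib[symmetric] algebra_simps)
  qed
  also have "(\<Sum>j=1..Suc N. (-1) ^ Suc j * real (N choose j) / real j) = harm N"
    using Suc by simp
  also have "(\<Sum>j=1..Suc N. (-1) ^ Suc j * real (N choose (j - 1)) / real j)
     = (\<Sum>j=1..Suc N. (-1) ^ Suc j * real (Suc N choose j)) / real (Suc N)"
    unfolding sum_divide_distrib
  proof (intro sum.cong refl)
    fix j assume "j \<in> {1..Suc N}"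
    then obtain i where j: "j = Suc i" by (cases j) auto
    have "real (Suc i) * real (Suc N choose Suc i) = real (Suc N) * real (N choose i)"
      using Suc_times_binomial_eq[of N i] by (metis of_nat_mult mult.commute)
    then show "(-1) ^ Suc j * real (N choose (j - 1)) / real j =
        (-1) ^ Suc j * real (Suc N choose j) / real (Suc N)"
      unfolding j by (simp add: field_simps del: of_nat_Suc binomial_Suc_Suc)
  qed
  also have "(\<Sum>j=1..Suc N. (-1) ^ Suc j * real (Suc N choose j)) = 1"
    by (rule sum_alternating_binomial_tail) simp
  finally show ?case by (simp add: harm_Suc inverse_eq_divide)
qed

section \<open>Partial fractions of the reciprocal\<close>

lemma monic_prod_linear:
  fixes x :: "nat \<Rightarrow> 'a :: field"
  assumes "finite I"
  shows "degree (\<Prod>i\<in>I. [:- x i, 1:]) = card I" "coeff (\<Prod>i\<in>I. [:- x i, 1:]) (card I) = 1"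
proof -
  show 1: "degree (\<Prod>i\<in>I. [:- x i, 1:]) = card I"
    by (subst degree_prod_eq_sum_degree) auto
  show "coeff (\<Prod>i\<in>I. [:- x i, 1:]) (card I) = 1"
    using lead_coeff_prod[of "\<lambda>i. [:- x i, 1:]" I] unfolding 1 by simp
qed

lemma poly_eq_0_if_many_roots:
  fixes p :: "'a :: field poly"
  assumes "degree p \<le> M" "coeff p M = 0" "inj_on x {..<M}" "\<And>k. k < M \<Longrightarrow> poly p (x k) = 0"
  shows "p = 0"
  by (rule poly_eqI_degree_lead_coeff[of _ M _ "x ` {..<M}"]) (use assms in \<open>auto simp: card_image\<close>)

text \<open>
  Both \<open>R\<close> and \<open>Q\<close> have degree \<open>M\<close>, which accounts for the constant \<open>1 / L\<close>. The difference
  \<open>Q - R / L\<close> has smaller degree and is therefore given by Lagrange interpolation at the \<open>M\<close> roots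
  of \<open>R\<close>.
\<close>
lemma partial_fractions:
  fixes Q R :: "'a :: field poly"
  assumes deg: "degree R \<le> M" "degree Q \<le> M" and L: "coeff R M = L" "L \<noteq> 0" "coeff Q M = 1"
    and inj: "inj_on x {..<M}" and root: "\<And>k. k < M \<Longrightarrow> poly R (x k) = 0"
    and y: "\<And>k. k < M \<Longrightarrow> y \<noteq> x k"
  shows "poly Q y / poly R y = 1 / L + (\<Sum>k<M. poly Q (x k) / poly (pderiv R) (x k) / (y - x k))"
proof -
  define P where "P = (\<lambda>k. \<Prod>i\<in>{..<M}-{k}. [:- x i, 1:])"
  have polyP: "poly (P k) (x i) = 0" if "i < M" "i \<noteq> k" for i k
    using that by (auto simp: P_def poly_prod)
  have polyP': "poly (P k) (x k) \<noteq> 0" if "k < M" for k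
    using that inj by (auto simp: P_def poly_prod inj_on_def)
  have degP: "degree (P k) < M" if "k < M" for k
    using that by (simp add: P_def monic_prod_linear)
  have mono: "(\<Prod>i<M. [:- x i, 1:]) = [:- x k, 1:] * P k" if "k < M" for k
    using that unfolding P_def by (subst prod.remove[of _ k]) auto
  have R: "R = smult L (\<Prod>i<M. [:- x i, 1:])"
  proof -
    have "R - smult L (\<Prod>i<M. [:- x i, 1:]) = 0"
    proof (rule poly_eq_0_if_many_roots[of _ M x])
      show "degree (R - smult L (\<Prod>i<M. [:- x i, 1:])) \<le> M"
        using deg monic_prod_linear[of "{..<M}" x] by (intro degree_diff_le) (auto intro: order.trans[OF degree_smult_le])
      show "coeff (R - smult L (\<Prod>i<M. [:- x i, 1:])) M = 0"
        using L monic_prod_linear(2)[of "{..<M}" x] by simp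
      show "poly (R - smult L (\<Prod>i<M. [:- x i, 1:])) (x k) = 0" if "k < M" for k
        using root that by (auto simp: poly_prod)
    qed fact
    then show ?thesis by simp
  qed
  have dR: "poly (pderiv R) (x k) = L * poly (P k) (x k)" if "k < M" for k
    unfolding R mono[OF that] pderiv_smult pderiv_mult by (simp add: pderiv_pCons)
  \<comment> \<open>Lagrange interpolation of \<open>Q - R / L\<close> at the roots of \<open>R\<close>\<close>
  let ?T = "Q - smult (1 / L) R - (\<Sum>k<M. smult (poly Q (x k) / poly (P k) (x k)) (P k))"
  have "?T = 0"
  proof (rule poly_eq_0_if_many_roots[of _ M x])
    have *: "degree (\<Sum>k<M. smult (poly Q (x k) / poly (P k) (x k)) (P k)) \<le> M"
      using degP by (intro degree_sum_le) (auto intro: order.trans[OF degree_smult_le] less_imp_le)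
    then show "degree ?T \<le> M"
      using deg by (intro degree_diff_le) (auto intro: order.trans[OF degree_smult_le])
    have "coeff (P k) M = 0" if "k < M" for k using degP[OF that] by (rule coeff_eq_0)
    then show "coeff ?T M = 0"
      using L by (simp add: coeff_sum)
    show "poly ?T (x k) = 0" if "k < M" for k
    proof -
      have "(\<Sum>i<M. poly Q (x i) / poly (P i) (x i) * poly (P i) (x k))
         = (\<Sum>i<M. if i = k then poly Q (x k) else 0)"
        using polyP polyP' that by (intro sum.cong) auto
      then show ?thesis using root that by (simp add: poly_sum)
    qed
  qed fact
  then have "poly ?T y = 0"
    by simp
  then have Qy: "poly Q y = poly R y / L + (\<Sum>k<M. poly Q (x k) / poly (P k) (x k) * poly (P k) y)"
    by (simp add: poly_sum algebra_simps)
  have Ry: "poly R y \<noteq> 0" using L y by (auto simp: R poly_prod)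
  have "poly Q y / poly R y = 1 / L + (\<Sum>k<M. poly Q (x k) / poly (P k) (x k) * poly (P k) y / poly R y)"
    unfolding Qy using Ry by (simp add: add_divide_distrib sum_divide_distrib)
  also have "(\<Sum>k<M. poly Q (x k) / poly (P k) (x k) * poly (P k) y / poly R y)
     = (\<Sum>k<M. poly Q (x k) / poly (pderiv R) (x k) / (y - x k))"
  proof (intro sum.cong refl)
    fix k assume "k \<in> {..<M}" then have k: "k < M" by simp
    have "poly R y = L * ((y - x k) * poly (P k) y)" unfolding R mono[OF k] by (simp add: algebra_simps)
    moreover have "poly (P k) y \<noteq> 0" using y by (auto simp: P_def poly_prod)
    moreover have quot: "a / c * p / (L * (d * p)) = a / (L * c) / d" if "p \<noteq> 0" "d \<noteq> 0" "c \<noteq> 0" for a c p d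
      using that L by (simp add: field_simps)
    ultimately show "poly Q (x k) / poly (P k) (x k) * poly (P k) y / poly R y
       = poly Q (x k) / poly (pderiv R) (x k) / (y - x k)"
      using L y[OF k] polyP'[OF k] quot[of "poly (P k) y" "y - x k" "poly (P k) (x k)"] by (simp add: dR[OF k])
  qed
  finally show ?thesis .
qed

text \<open>
  All zeros in decreasing order, starting with the zero at the origin.
\<close>
definition node :: "real \<Rightarrow> (nat \<Rightarrow> real) \<Rightarrow> nat \<Rightarrow> real" where
  "node b w k = (case k of 0 \<Rightarrow> 0 | Suc i \<Rightarrow> stieltjes_zero b w i)"

lemma stieltjes_finite:
  assumes "\<forall>m\<ge>M. w m = 0"
  shows "stieltjes b w x = (\<Sum>m<M. w m * x / ((real m + b) * (real m + b + x)))"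
proof -
  have "(\<Sum>m. w m * x / ((real m + b) * (real m + b + x))) = (\<Sum>m<M. w m * x / ((real m + b) * (real m + b + x)))"
    using assms by (intro suminf_finite) auto
  then show ?thesis by (simp add: stieltjes_def)
qed

lemma node_facts:
  assumes w: "weights b w" and pos: "\<forall>m<M. w m > 0"
  shows "k < M \<Longrightarrow> stieltjes b w (node b w k) = 0"
    and "k < M \<Longrightarrow> off_poles b w (node b w k)"
    and "k < M \<Longrightarrow> j < k \<Longrightarrow> node b w k < node b w j"
proof -
  have b: "b > 0" using w by (auto simp: weights_def)
  have z: "- (real (Suc i) + b) < stieltjes_zero b w i" "stieltjes_zero b w i < - (real i + b)"
    "stieltjes b w (stieltjes_zero b w i) = 0" if "Suc i < M" for i
    using stieltjes_zero[OF w, of i] pos that by auto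
  show "k < M \<Longrightarrow> stieltjes b w (node b w k) = 0"
    using z by (auto simp: node_def stieltjes_def split: nat.split)
  show "k < M \<Longrightarrow> off_poles b w (node b w k)"
    using z b by (auto simp: node_def off_poles_def[of _ _ "0 :: real"] split: nat.split intro!: off_poles_between)
  show "k < M \<Longrightarrow> j < k \<Longrightarrow> node b w k < node b w j"
  proof -
    assume jk: "k < M" "j < k"
    then obtain i where i: "k = Suc i" by (cases k) auto
    show ?thesis
    proof (cases j)
      case 0
      then show ?thesis using z(2)[of i] b i jk by (simp add: node_def)
    next
      case (Suc l)
      then have "real (Suc l) \<le> real i" using i jk by simp
      then show ?thesis using z(2)[of i] z(1)[of l] i jk Suc by (simp add: node_def)
    qed
  qed
qed

text \<open>
  With finitely many poles the series is a quotient \<open>R / Q\<close> of polynomials of degree \<open>M\<close>, where \<open>Q\<close>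
  is the product of the factors \<open>m + b + x\<close>. The nodes are the roots of \<open>R\<close>, and there the derivative
  of \<open>R\<close> equals the derivative of the series times \<open>Q\<close>.
\<close>
lemma finite_partial_fractions:
  fixes y :: real
  assumes w: "weights b w" and pos: "\<forall>m<M. w m > 0" and fin: "\<forall>m\<ge>M. w m = 0"
    and M: "M > 0" and y: "y > 0"
  shows "1 / stieltjes b w y = 1 / (\<Sum>m<M. w m / (real m + b))
    + (\<Sum>k<M. 1 / stieltjes_deriv b w (node b w k) / (y - node b w k))"
proof -
  have b: "b > 0" using w by (auto simp: weights_def)
  have apos: "real m + b > 0" for m using b by simp
  note nf = node_facts[OF w pos]
  define c where "c = (\<lambda>m. - (real m + b))"
  define Q where "Q = (\<Prod>m<M. [:- c m, 1:])"
  define T where "T = (\<lambda>m. [:- 0, 1:] * (\<Prod>i\<in>{..<M}-{m}. [:- c i, 1:]))"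
  define R where "R = (\<Sum>m<M. smult (w m / (real m + b)) (T m))"
  define L where "L = (\<Sum>m<M. w m / (real m + b))"
  have L: "L > 0" unfolding L_def using M pos apos by (intro sum_pos) auto
  have degT: "degree (T m) = M" "coeff (T m) M = 1" if "m < M" for m
  proof -
    have ne: "(\<Prod>i\<in>{..<M}-{m}. [:- c i, 1:]) \<noteq> 0" by simp
    have 1: "degree (\<Prod>i\<in>{..<M}-{m}. [:- c i, 1:]) = M - 1" "coeff (\<Prod>i\<in>{..<M}-{m}. [:- c i, 1:]) (M - 1) = 1"
      using monic_prod_linear[of "{..<M}-{m}" c] that by auto
    show "degree (T m) = M" unfolding T_def using 1 ne M by (subst degree_mult_eq) auto
    show "coeff (T m) M = 1" unfolding T_def using 1 M by (cases M) auto
  qed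
  have RS: "poly R x = stieltjes b w x * poly Q x" if "off_poles b w x" for x
  proof -
    have "poly R x = (\<Sum>m<M. w m * x / ((real m + b) * (real m + b + x)) * poly Q x)"
      unfolding R_def poly_sum
    proof (intro sum.cong refl)
      fix m assume "m \<in> {..<M}"
      then have m: "m < M" "real m + b + x \<noteq> 0" using that pos by (auto simp: off_poles_def)
      have "Q = [:- c m, 1:] * (\<Prod>i\<in>{..<M}-{m}. [:- c i, 1:])"
        unfolding Q_def using m by (subst prod.remove[of _ m]) auto
      then have Qx: "poly Q x = (real m + b + x) * poly (\<Prod>i\<in>{..<M}-{m}. [:- c i, 1:]) x"
        by (simp only: poly_mult) (simp add: c_def)
      show "poly (smult (w m / (real m + b)) (T m)) x = w m * x / ((real m + b) * (real m + b + x)) * poly Q x"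
        unfolding Qx T_def poly_smult poly_mult using m apos by simp
    qed
    then show ?thesis by (simp add: sum_distrib_right stieltjes_finite[OF fin])
  qed
  have Qnz: "poly Q x \<noteq> 0" if "off_poles b w x" for x
    unfolding Q_def poly_prod
  proof (subst prod_zero_iff, simp, safe)
    fix m assume "m < M" "poly [:- c m, 1:] x = 0"
    then show False using that pos by (auto simp: off_poles_def c_def add.commute)
  qed
  have offy: "off_poles b w y" using y apos by (auto simp: off_poles_def add_pos_pos less_imp_neq[symmetric])
  have "poly Q y / poly R y = 1 / L + (\<Sum>k<M. poly Q (node b w k) / poly (pderiv R) (node b w k) / (y - node b w k))"
  proof (rule partial_fractions)
    show "degree R \<le> M" unfolding R_def using degT
      by (intro degree_sum_le) (auto intro: order.trans[OF degree_smult_le])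
    show "coeff R M = L" unfolding R_def L_def using degT by (simp add: coeff_sum)
    show "degree Q \<le> M" "coeff Q M = 1" unfolding Q_def using monic_prod_linear[of "{..<M}" c] by auto
    show "inj_on (node b w) {..<M}"
      by (intro linorder_inj_onI') (use nf(3) in force)
    show "poly R (node b w k) = 0" if "k < M" for k using RS nf that by simp
    show "y \<noteq> node b w k" if "k < M" for k
    proof -
      have "node b w k \<le> 0" using nf(3)[where k = k and j = 0] that by (cases "k = 0") (auto simp: node_def[of _ _ 0])
      then show ?thesis using y by simp
    qed
  qed (use L in auto)
  also have "poly Q y / poly R y = 1 / stieltjes b w y" using RS[OF offy] Qnz[OF offy] by simp
  also have "(\<Sum>k<M. poly Q (node b w k) / poly (pderiv R) (node b w k) / (y - node b w k)) =
     (\<Sum>k<M. 1 / stieltjes_deriv b w (node b w k) / (y - node b w k))"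
  proof (intro sum.cong refl)
    fix k assume "k \<in> {..<M}"
    then have k: "k < M" by simp
    let ?x = "node b w k"
    have "((\<lambda>x. stieltjes b w x * poly Q x) has_field_derivative
       (stieltjes_deriv b w ?x * poly Q ?x + poly (pderiv Q) ?x * stieltjes b w ?x)) (at ?x)"
      by (intro derivative_intros has_field_derivative_stieltjes w nf k poly_DERIV)
    moreover have "eventually (\<lambda>x. stieltjes b w x * poly Q x = poly R x) (nhds ?x)"
      using eventually_off_poles[of b w ?x] nf(2)[OF k] RS
      by (auto simp: eventually_nhds_conv_at elim: eventually_mono)
    ultimately have "(poly R has_field_derivative (stieltjes_deriv b w ?x * poly Q ?x)) (at ?x)"
      using nf(1)[OF k] by (subst (asm) DERIV_cong_ev) auto
    then have "poly (pderiv R) ?x = stieltjes_deriv b w ?x * poly Q ?x" 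
      using poly_DERIV DERIV_unique by blast
    then show "poly Q ?x / poly (pderiv R) ?x / (y - ?x) = 1 / stieltjes_deriv b w ?x / (y - ?x)"
      using Qnz[OF nf(2)[OF k]] by simp
  qed
  finally show ?thesis by (simp add: L_def)
qed

text \<open>
  For the binomial weights this is \<open>- \<phi>\<^sub>\<beta>''(0) / 2\<close>.
\<close>
definition cube_sum :: "real \<Rightarrow> (nat \<Rightarrow> real) \<Rightarrow> real" where
  "cube_sum b w = (\<Sum>m. w m / (real m + b) ^ 3)"

lemma cube_weight_le:
  assumes w: "weights b w" and "m \<ge> 1"
  shows "w m / (real m + b) ^ 3 \<le> w m / (real m + b)\<^sup>2" "0 \<le> w m / (real m + b) ^ 3"
proof -
  have b: "b > 0" "w m \<ge> 0" using w by (auto simp: weights_def)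
  then have "(real m + b)\<^sup>2 \<le> (real m + b) ^ 3" "(real m + b)\<^sup>2 > 0" "(real m + b) ^ 3 > 0"
    using assms(2) by (auto intro!: power_increasing)
  then show "w m / (real m + b) ^ 3 \<le> w m / (real m + b)\<^sup>2" "0 \<le> w m / (real m + b) ^ 3"
    using b by (auto intro!: divide_left_mono)
qed

lemma summable_cube:
  assumes w: "weights b w"
  shows "summable (\<lambda>m. w m / (real m + b) ^ 3)"
  by (rule summable_comparison_test'[of "\<lambda>m. w m / (real m + b)\<^sup>2" 1])
     (use w cube_weight_le[OF w] in \<open>auto simp: weights_def\<close>)

lemma stieltjes_deriv_0_pos:
  assumes "weights b w" "w 0 > 0"
  shows "stieltjes_deriv b w (0 :: real) > 0"
proof -
  have b: "b > 0" using assms by (auto simp: weights_def)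
  have "(\<Sum>m. w m / (real m + b)\<^sup>2) > 0"
    using assms b by (intro suminf_pos2[of _ 0]) (auto simp: weights_def)
  then show ?thesis by (simp add: stieltjes_deriv_def)
qed

text \<open>
  Two ways to compute the limit at 0 of the reciprocal minus its polar part. The right-hand side is
  the form in which the limit of infinitely many poles can be taken.
\<close>
lemma finite_partial_fractions_constant:
  assumes w: "weights b w" and pos: "\<forall>m<M. w m > 0" and fin: "\<forall>m\<ge>M. w m = 0"
    and M: "M > 0"
  shows "1 / (\<Sum>m<M. w m / (real m + b)) - (\<Sum>k=1..<M. 1 / stieltjes_deriv b w (node b w k) / node b w k)
    = cube_sum b w / (stieltjes_deriv b w 0)\<^sup>2" (is "?C = _")
proof -
  have b: "b > 0" using w by (auto simp: weights_def)
  have apos: "real m + b > 0" for m using b by simp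
  define \<mu> where "\<mu> = stieltjes_deriv b w (0::real)"
  have \<mu>0: "\<mu> > 0" unfolding \<mu>_def using w pos M by (intro stieltjes_deriv_0_pos) auto
  have \<mu>: "\<mu> = (\<Sum>m<M. w m / (real m + b)\<^sup>2)"
    using fin unfolding \<mu>_def stieltjes_deriv_def by (subst suminf_finite[of "{..<M}"]) auto
  have cube: "cube_sum b w = (\<Sum>m<M. w m / (real m + b) ^ 3)"
    using fin unfolding cube_sum_def by (subst suminf_finite[of "{..<M}"]) auto
  define H where "H = (\<lambda>y. \<Sum>m<M. w m / ((real m + b) * (real m + b + y)))"
  define G where "G = (\<lambda>y. \<Sum>m<M. w m / ((real m + b)\<^sup>2 * (real m + b + y)))"
  have lhs: "1 / stieltjes b w y - 1 / (\<mu> * y) = G y / (\<mu> * H y)" if y: "y > 0" for y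
  proof -
    have S: "stieltjes b w y = y * H y"
      by (subst stieltjes_finite[of M]) (auto simp: fin H_def sum_distrib_left mult_ac)
    have "H y > 0" unfolding H_def using M pos apos y by (intro sum_pos) (auto simp: add_pos_pos)
    have "\<mu> - H y = y * G y"
      unfolding \<mu> H_def G_def sum_distrib_left sum_subtractf[symmetric]
    proof (intro sum.cong refl)
      fix m
      have "w / a\<^sup>2 - w / (a * (a + y)) = y * (w / (a\<^sup>2 * (a + y)))" if "a > 0" for a w :: real
      proof -
        have "a + y > 0" using that y by simp
        then have "w * (a + y) / (a\<^sup>2 * (a + y)) - a * w / (a * (a * (a + y))) = y * (w / (a\<^sup>2 * (a + y)))"
          using that by (simp add: diff_divide_distrib[symmetric] power2_eq_square algebra_simps)
        then show ?thesis using that \<open>a + y > 0\<close> by simp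
      qed
      from this[of "real m + b" "w m"] apos 
      show "w m / (real m + b)\<^sup>2 - w m / ((real m + b) * (real m + b + y)) = y * (w m / ((real m + b)\<^sup>2 * (real m + b + y)))"
        by simp
    qed
    have "1 / (y * H y) - 1 / (\<mu> * y) = (\<mu> - H y) / (\<mu> * y * H y)"
      using y \<mu>0 \<open>H y > 0\<close> by (simp add: field_simps)
    then have "1 / stieltjes b w y - 1 / (\<mu> * y) = (y * G y) / (\<mu> * y * H y)"
      unfolding S \<open>\<mu> - H y = y * G y\<close> .
    then show ?thesis using y by simp
  qed
  define rest where "rest = (\<lambda>y. 1 / (\<Sum>m<M. w m / (real m + b)) + (\<Sum>k=1..<M. 1 / stieltjes_deriv b w (node b w k) / (y - node b w k)))"
  have "G y / (\<mu> * H y) = rest y" if y: "y > 0" for y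
  proof -
    have "{..<M} = insert 0 {1..<M}" using M by auto
    then show ?thesis using lhs[OF y] finite_partial_fractions[OF w pos fin M y]
      by (simp add: rest_def \<mu>_def node_def[of _ _ 0])
  qed
  then have ev: "eventually (\<lambda>y. G y / (\<mu> * H y) = rest y) (at_right 0)"
    by (auto simp: eventually_at_filter)
  have nneg: "node b w k \<noteq> 0" if "k \<in> {1..<M}" for k
    using node_facts(3)[OF w pos, of k 0] that by (auto simp: node_def[of _ _ 0])
  have "(rest \<longlongrightarrow> ?C) (at_right 0)"
  proof -
    have "(rest \<longlongrightarrow> 1 / (\<Sum>m<M. w m / (real m + b)) + (\<Sum>k=1..<M. 1 / stieltjes_deriv b w (node b w k) / (0 - node b w k))) (at_right 0)"
      unfolding rest_def
      by (rule tendsto_add[OF tendsto_const], rule tendsto_sum, rule tendsto_divide[OF tendsto_const tendsto_diff[OF tendsto_ident_at tendsto_const]])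
         (use nneg in auto)
    then show ?thesis by (simp add: sum_negf)
  qed
  moreover have "((\<lambda>y. G y / (\<mu> * H y)) \<longlongrightarrow> cube_sum b w / (\<mu> * \<mu>)) (at_right 0)"
  proof -
    have "(G \<longlongrightarrow> cube_sum b w) (at_right 0)" unfolding G_def cube
      using apos by (auto intro!: tendsto_eq_intros simp: power3_eq_cube power2_eq_square less_imp_neq[symmetric] simp del: add_eq_0_iff)
    moreover have "(H \<longlongrightarrow> \<mu>) (at_right 0)" unfolding H_def \<mu>
      using apos by (auto intro!: tendsto_eq_intros simp: power2_eq_square less_imp_neq[symmetric])
    ultimately show ?thesis using \<mu>0 by (intro tendsto_intros) auto
  qed
  ultimately show ?thesis
    using tendsto_unique[OF trivial_limit_at_right_real _ Lim_transform_eventually[OF _ ev]]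
    by (simp add: \<mu>_def power2_eq_square)
qed

text \<open>
  Summing the partial fractions over \<open>j\<close>: the pole at 0 gives the harmonic number, every other pole a
  Beta function. The index \<open>j = 0\<close> is absent, which leaves the term \<open>- 1 / x\<close> for each node \<open>x\<close>;
  together with the constant \<open>1 / L\<close> these add up to the second summand.
\<close>
lemma finite_rice_sum:
  assumes w: "weights b w" and pos: "\<forall>m<M. w m > 0" and fin: "\<forall>m\<ge>M. w m = 0"
    and M: "M > 0" and N: "N > 0"
  shows "(\<Sum>j=1..N. (-1) ^ Suc j * real (N choose j) / stieltjes b w (real j)) =
    harm N / stieltjes_deriv b w 0 + cube_sum b w / (stieltjes_deriv b w 0)\<^sup>2
    - (\<Sum>k=1..<M. Beta (- node b w k) (real N + 1) / stieltjes_deriv b w (node b w k))"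
proof -
  define A where "A = 1 / (\<Sum>m<M. w m / (real m + b))"
  define D where "D = (\<lambda>k. stieltjes_deriv b w (node b w k))"
  define x where "x = node b w"
  have D0: "D 0 = stieltjes_deriv b w 0" "x 0 = 0" by (simp_all add: D_def node_def x_def)
  define e where "e = (\<lambda>j. (-1) ^ Suc j * real (N choose j))"
  have xneg: "x k < 0" if "k \<in> {1..<M}" for k
    using node_facts(3)[OF w pos, where k = k and j = 0] that by (auto simp: node_def[of _ _ 0] x_def)
  have inner: "(\<Sum>j=1..N. e j / (real j - x k)) = - 1 / x k - Beta (- x k) (real N + 1)" if "k \<in> {1..<M}" for k
  proof -
    have "Beta (- x k) (real N + 1) = (\<Sum>j=0..N. (-1) ^ j * real (N choose j) / (real j - x k))"
      using sum_alternating_binomial_inverse_shift[of "- x k" N] xneg[OF that] by (simp add: atMost_atLeast0 add.commute)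
    also have "\<dots> = - 1 / x k + (\<Sum>j=1..N. (-1) ^ j * real (N choose j) / (real j - x k))"
      by (subst sum.atLeast_Suc_atMost) auto
    finally show ?thesis by (simp add: e_def sum_negf)
  qed
  have "(\<Sum>j=1..N. e j / stieltjes b w (real j)) = (\<Sum>j=1..N. e j * A + (e j / real j / D 0 + (\<Sum>k=1..<M. e j / (real j - x k) / D k)))"
  proof (intro sum.cong refl)
    fix j assume "j \<in> {1..N}"
    then have j: "real j > 0" by simp
    have "{..<M} = insert 0 {1..<M}" using M by auto
    then have "1 / stieltjes b w (real j) = A + (1 / D 0 / real j + (\<Sum>k=1..<M. 1 / D k / (real j - x k)))"
      using finite_partial_fractions[OF w pos fin M j] by (simp add: A_def D_def x_def node_def[of _ _ 0])
    then have "e j * (1 / stieltjes b w (real j)) = e j * A + e j * (1 / D 0 / real j) + e j * (\<Sum>k=1..<M. 1 / D k / (real j - x k))"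
      by (simp only: distrib_left add.assoc)
    then show "e j / stieltjes b w (real j) = e j * A + (e j / real j / D 0 + (\<Sum>k=1..<M. e j / (real j - x k) / D k))"
      by (simp add: sum_distrib_left mult.commute)
  qed
  also have "\<dots> = (\<Sum>j=1..N. e j) * A + (\<Sum>j=1..N. e j / real j) / D 0 + (\<Sum>k=1..<M. (\<Sum>j=1..N. e j / (real j - x k)) / D k)"
    unfolding sum.distrib sum_distrib_right sum_divide_distrib
    using sum.swap[of "\<lambda>j k. e j / (real j - x k) / D k" "{1..<M}" "{1..N}"] by simp
  also have "(\<Sum>j=1..N. e j) = 1" unfolding e_def using sum_alternating_binomial_tail[OF N] .
  also have "(\<Sum>j=1..N. e j / real j) = harm N" unfolding e_def by (rule sum_alternating_binomial_inverse)
  also have "(\<Sum>k=1..<M. (\<Sum>j=1..N. e j / (real j - x k)) / D k) = (\<Sum>k=1..<M. - 1 / x k / D k - Beta (- x k) (real N + 1) / D k)"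
    by (intro sum.cong refl) (subst inner, auto simp: diff_divide_distrib)
  also have "\<dots> = - (\<Sum>k=1..<M. 1 / D k / x k) - (\<Sum>k=1..<M. Beta (- x k) (real N + 1) / D k)"
    by (simp add: sum_subtractf sum_negf mult.commute)
  finally show ?thesis
    using finite_partial_fractions_constant[OF w pos fin M]
    by (simp add: D0 e_def A_def) (simp add: D_def x_def)
qed

section \<open>The Rice sum with infinitely many poles\<close>

lemma Beta_2_bound:
  fixes x a :: real
  assumes "0 < a" "a \<le> x" "y \<ge> 2"
  shows "Beta x y \<le> 1 / a\<^sup>2"
proof -
  have "Beta x y \<le> Beta a 2" using assms by (intro Beta_real_mono) auto
  also have "Beta a 2 = 1 / (a * (a + 1))"
    using sum_alternating_binomial_inverse_shift[of a 1] assms by (simp add: field_simps)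
  also have "\<dots> \<le> 1 / a\<^sup>2" using assms by (intro divide_left_mono) (auto simp: power2_eq_square)
  finally show ?thesis .
qed

lemma Beta_nonneg: "0 < x \<Longrightarrow> 0 < y \<Longrightarrow> 0 \<le> Beta x (y :: real)"
  by (simp add: Beta_def Gamma_real_pos less_imp_le)

text \<open>
  The bound involves the weights only, so that it is the same for every truncation that keeps the
  weights \<open>i\<close> and \<open>i + 1\<close>. It is the dominating sequence for the limit of infinitely many poles.
\<close>
lemma zero_summand_bound:
  assumes w: "weights b w" "w i > 0" "w (Suc i) > 0" and N: "N > 0"
  shows "\<bar>Beta (- stieltjes_zero b w i) (real N + 1) / stieltjes_deriv b w (stieltjes_zero b w i)\<bar> \<le> 1 / (w i * (real i + b)\<^sup>2)"
proof -
  have b: "b > 0" using w by (auto simp: weights_def)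
  note s = stieltjes_zero[OF w]
  have D: "w i \<le> stieltjes_deriv b w (stieltjes_zero b w i)" using s by (intro stieltjes_deriv_ge w)
  have a: "real i + b > 0" using b by simp
  have B: "0 \<le> Beta (- stieltjes_zero b w i) (real N + 1)" "Beta (- stieltjes_zero b w i) (real N + 1) \<le> 1 / (real i + b)\<^sup>2"
    using s a N by (auto intro!: Beta_nonneg Beta_2_bound)
  have "Beta (- stieltjes_zero b w i) (real N + 1) / stieltjes_deriv b w (stieltjes_zero b w i) \<le> (1 / (real i + b)\<^sup>2) / w i"
    using B D w by (intro frac_le) auto
  then show ?thesis using B D w by (simp add: mult.commute)
qed

text \<open>
  The limit of the finite Rice sums as the truncation is lifted; the number of summands in the last
  series grows with the truncation level, which Tannery's theorem allows. For the binomial weights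
  the dominating sequence is of order \<open>i powr (\<beta> - 1)\<close>.
\<close>
lemma rice_sum:
  assumes w: "weights b w" and pos: "\<And>m. w m > 0" and N: "N > 0"
    and summ: "summable (\<lambda>i. 1 / (w i * (real i + b)\<^sup>2))"
  defines "s \<equiv> stieltjes_zero b w"
  shows "summable (\<lambda>i. Beta (- s i) (real N + 1) / stieltjes_deriv b w (s i))"
    and "(\<Sum>j=1..N. (-1) ^ Suc j * real (N choose j) / stieltjes b w (real j)) =
    harm N / stieltjes_deriv b w 0 + cube_sum b w / (stieltjes_deriv b w 0)\<^sup>2
    - (\<Sum>i. Beta (- s i) (real N + 1) / stieltjes_deriv b w (s i))"
proof -
  have b: "b > 0" using w by (auto simp: weights_def)
  have apos: "real m + b > 0" for m using b by simp
  let ?t = "\<lambda>w i. Beta (- stieltjes_zero b w i) (real N + 1) / stieltjes_deriv b w (stieltjes_zero b w i)"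
  show "summable (\<lambda>i. Beta (- s i) (real N + 1) / stieltjes_deriv b w (s i))"
    unfolding s_def using zero_summand_bound[OF w pos pos N] 
    by (intro summable_comparison_test'[OF summ, of 0]) auto
  \<comment> \<open>zero \<open>i\<close> of the truncated series lies between the poles \<open>i\<close> and \<open>i + 1\<close>, both of which must survive\<close>
  define f where "f = (\<lambda>i M. if Suc i < M then ?t (trunc M w) i else 0)"
  have pos': "\<forall>m<M. trunc M w m > 0" for M using pos by (simp add: trunc_def)
  have fin': "\<forall>m\<ge>M. trunc M w m = 0" for M by (simp add: trunc_def)
  have off: "off_poles b w (0 :: real)" using apos by (auto simp: off_poles_def less_imp_neq[symmetric])
  have lim_s: "(\<lambda>M. stieltjes b (trunc M w) (real j)) \<longlonglongrightarrow> stieltjes b w (real j)" for j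
  proof (intro trunc_limits w tendsto_const)
    have "real m + b + real j > 0" for m using b by simp
    then show "off_poles b w (real j)" by (auto simp: off_poles_def less_imp_neq[symmetric])
  qed
  have lim_d: "(\<lambda>M. stieltjes_deriv b (trunc M w) 0) \<longlonglongrightarrow> stieltjes_deriv b w (0::real)"
    by (intro trunc_limits w tendsto_const off)
  have lim_c: "(\<lambda>M. cube_sum b (trunc M w)) \<longlonglongrightarrow> cube_sum b w"
    unfolding cube_sum_def
  proof (rule tannery_uniform[where P = "\<lambda>_. True"])
    show "(\<lambda>M. trunc M w m / (real m + b) ^ 3) \<longlonglongrightarrow> w m / (real m + b) ^ 3" for m
      by (rule tendsto_eventually, rule eventually_mono[OF eventually_gt_at_top[of m]]) (auto simp: trunc_def)
    show "norm (trunc M w m / (real m + b) ^ 3) \<le> w m / (real m + b)\<^sup>2" if "m \<ge> 1" for m M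
      using cube_weight_le[OF w that] by (auto simp: trunc_def)
    show "summable (\<lambda>m. w m / (real m + b)\<^sup>2)" using w by (simp add: weights_def)
  qed auto
  have lim_f: "(\<lambda>M. \<Sum>i. f i M) \<longlonglongrightarrow> (\<Sum>i. ?t w i)"
  proof (rule tannery_uniform[where P = "\<lambda>_. True"])
    fix i
    note si = stieltjes_zero[OF w pos pos, of i]
    have lz: "(\<lambda>M. stieltjes_zero b (trunc M w) i) \<longlonglongrightarrow> stieltjes_zero b w i"
      by (rule trunc_zero_limit[OF w pos pos])
    have "stieltjes_zero b w i < 0" using si apos[of i] by linarith
    then have "(\<lambda>M. Beta (- stieltjes_zero b (trunc M w) i) (real N + 1)) \<longlonglongrightarrow> Beta (- stieltjes_zero b w i) (real N + 1)"
      unfolding Beta_def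
      by (intro tendsto_intros lz) (auto elim!: nonpos_Ints_cases simp: Gamma_eq_zero_iff)
    moreover have "(\<lambda>M. stieltjes_deriv b (trunc M w) (stieltjes_zero b (trunc M w) i)) \<longlonglongrightarrow> stieltjes_deriv b w (stieltjes_zero b w i)"
      using si by (intro trunc_limits w lz off_poles_between)
    moreover have "stieltjes_deriv b w (stieltjes_zero b w i) \<noteq> 0"
      using stieltjes_deriv_ge[OF w si(1,2)] pos[of i] by auto
    ultimately have "(\<lambda>M. ?t (trunc M w) i) \<longlonglongrightarrow> ?t w i" by (intro tendsto_divide)
    moreover have "eventually (\<lambda>M. ?t (trunc M w) i = f i M) sequentially"
      using eventually_gt_at_top[of "Suc i"] by eventually_elim (simp add: f_def)
    ultimately show "f i \<longlonglongrightarrow> ?t w i" by (rule Lim_transform_eventually)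
  next
    fix i M assume "i \<ge> (0::nat)"
    show "norm (f i M) \<le> 1 / (w i * (real i + b)\<^sup>2)"
    proof (cases "Suc i < M")
      case True
      then have "trunc M w i = w i" by (simp add: trunc_def)
      then show ?thesis using True zero_summand_bound[OF weights_trunc[OF w] _ _ N, of M i] pos'[of M] pos[of i]
        by (simp add: f_def)
    next
      case False
      then show ?thesis using pos[of i] apos[of i] by (simp add: f_def)
    qed
  qed (use summ in auto)
  let ?L = "\<lambda>w. \<Sum>j=1..N. (-1) ^ Suc j * real (N choose j) / stieltjes b w (real j)"
  let ?R = "\<lambda>w. harm N / stieltjes_deriv b w 0 + cube_sum b w / (stieltjes_deriv b w 0)\<^sup>2"
  have eq: "?L (trunc M w) = ?R (trunc M w) - (\<Sum>i. f i M)" if M: "M > 0" for M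
  proof -
    have "(\<Sum>k=1..<M. Beta (- node b (trunc M w) k) (real N + 1) / stieltjes_deriv b (trunc M w) (node b (trunc M w) k))
      = (\<Sum>i<M-1. f i M)"
      by (rule sum.reindex_bij_witness[of _ Suc "\<lambda>k. k - 1"]) (auto simp: f_def node_def split: nat.split)
    also have "\<dots> = (\<Sum>i. f i M)" by (intro suminf_finite[symmetric]) (auto simp: f_def)
    finally show ?thesis using finite_rice_sum[OF weights_trunc[OF w] pos' fin' M N] by simp
  qed
  have d0: "stieltjes_deriv b w (0::real) \<noteq> 0" using stieltjes_deriv_0_pos[OF w pos] by simp
  have "(\<lambda>M. ?L (trunc M w)) \<longlonglongrightarrow> ?L w"
    by (intro tendsto_intros lim_s) (use stieltjes_pos[OF w pos] in \<open>simp add: less_imp_neq[symmetric]\<close>)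
  note l1 = this
  have l2: "(\<lambda>M. ?R (trunc M w) - (\<Sum>i. f i M)) \<longlonglongrightarrow> ?R w - (\<Sum>i. ?t w i)"
    using d0 by (intro tendsto_intros lim_d lim_c lim_f) auto
  have l3: "eventually (\<lambda>M. ?L (trunc M w) = ?R (trunc M w) - (\<Sum>i. f i M)) sequentially"
    using eventually_gt_at_top[of 0] by eventually_elim (rule eq)
  show "(\<Sum>j=1..N. (-1) ^ Suc j * real (N choose j) / stieltjes b w (real j)) =
    harm N / stieltjes_deriv b w 0 + cube_sum b w / (stieltjes_deriv b w 0)\<^sup>2
    - (\<Sum>i. Beta (- s i) (real N + 1) / stieltjes_deriv b w (s i))"
    unfolding s_def by (rule LIMSEQ_unique[OF Lim_transform_eventually[OF l1 l3] l2])
qed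

section \<open>Decay of the tail of the zero series\<close>

text \<open>
  When \<open>n\<close> grows by one, \<open>Beta y n / Beta x n\<close> is multiplied by \<open>(x + n) / (y + n) \<le> 1\<close>.
\<close>
lemma Beta_ratio_le:
  fixes x y :: real
  assumes "0 < x" "x \<le> y" "n \<ge> 2"
  shows "Beta y (real n) * Beta x 2 \<le> Beta y 2 * Beta x (real n)"
  using assms(3)
proof (induction n rule: dec_induct)
  case (step n)
  have n: "real n \<notin> \<int>\<^sub>\<le>\<^sub>0" "real n > 0" using step by (auto elim!: nonpos_Ints_cases)
  have rec: "Beta z (real (Suc n)) = real n / (z + real n) * Beta z (real n)" if "z > 0" for z :: real
    using Beta_plus1_right[OF n(1), of z] that n by (simp add: field_simps add_ac)
  have "Beta y (real (Suc n)) * Beta x 2 = real n / (y + real n) * (Beta y (real n) * Beta x 2)"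
    using rec[of y] assms by simp
  also have "\<dots> \<le> real n / (x + real n) * (Beta y 2 * Beta x (real n))"
    using assms n by (intro mult_mono divide_left_mono step.IH) (auto simp: Beta_nonneg)
  also have "\<dots> = Beta y 2 * Beta x (real (Suc n))" using rec[of x] assms by simp
  finally show ?case .
qed auto

lemma Beta_bigo:
  fixes x :: real
  assumes "x > 0"
  shows "(\<lambda>n. Beta x (real n)) \<in> O(\<lambda>n. real n powr (- x))"
proof (rule bigoI_tendsto[where c = "Gamma x"])
  have x: "x \<notin> \<int>\<^sub>\<le>\<^sub>0" using assms by (auto elim!: nonpos_Ints_cases)
  have "eventually (\<lambda>n. Gamma_series' x n = Beta x (real n) / real n powr (- x)) sequentially"
    using eventually_gt_at_top[of 0]
  proof eventually_elim
    case (elim n)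
    have "Gamma (real n) = fact (n - 1)" using Gamma_fact[of "n - 1", where 'a = real] elim by simp
    moreover have "Gamma (x + real n) > 0" using assms by (intro Gamma_real_pos) auto
    moreover have "Gamma x > 0" using assms by (intro Gamma_real_pos)
    ultimately show ?case using elim pochhammer_Gamma[OF x, of n] 
      by (simp add: Gamma_series'_def Beta_def powr_def exp_minus divide_inverse)
  qed
  then show "(\<lambda>n. Beta x (real n) / real n powr (- x)) \<longlonglongrightarrow> Gamma x"
    using Gamma_series'_LIMSEQ[of x] by (rule Lim_transform_eventually[rotated])
  show "eventually (\<lambda>n. real n powr (- x) \<noteq> 0) sequentially"
    using eventually_gt_at_top[of 0] by eventually_elim simp
qed

text \<open>
  Relative to the first term, no term of the tail is larger at \<open>n\<close> than at \<open>2\<close>, so the tail is at most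
  a constant multiple of its first term.
\<close>
lemma zero_series_tail:
  assumes w: "weights b w" and pos: "\<And>m. w m > 0"
    and summ: "summable (\<lambda>i. 1 / (w i * (real i + b)\<^sup>2))"
  defines "s \<equiv> stieltjes_zero b w"
  shows "(\<lambda>n. \<Sum>i. Beta (- s (i + r)) (real n) / stieltjes_deriv b w (s (i + r))) \<in> O(\<lambda>n. real n powr s r)"
proof -
  have b: "b > 0" using w by (auto simp: weights_def)
  note z = stieltjes_zero[OF w pos pos, folded s_def]
  have sneg: "s i < 0" for i
  proof -
    have "0 < real i + b" using b by simp
    then show ?thesis using z(2)[of i] by simp
  qed
  have smono: "s (i + r) \<le> s r" for i
  proof (cases i)
    case (Suc j)
    then have "real (Suc r) \<le> real (i + r)" by simp
    then show ?thesis using z(2)[of "i + r"] z(1)[of r] by linarith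
  qed simp
  have Dpos: "stieltjes_deriv b w (s i) > 0" for i
    using stieltjes_deriv_ge[OF w z(1,2), of i] pos[of i] by linarith
  have sums: "summable (\<lambda>i. Beta (- s (i + r)) (real n) / stieltjes_deriv b w (s (i + r)))" if "n \<ge> 2" for n
    using rice_sum(1)[OF w pos _ summ, of "n - 1"] that
    by (subst summable_iff_shift) (simp add: s_def of_nat_diff)
  define C where "C = (\<Sum>i. Beta (- s (i + r)) 2 / stieltjes_deriv b w (s (i + r))) / Beta (- s r) 2"
  have B2: "Beta (- s r) 2 > 0" using sneg[of r] by (simp add: Beta_def Gamma_real_pos)
  have "norm (\<Sum>i. Beta (- s (i + r)) (real n) / stieltjes_deriv b w (s (i + r))) \<le> C * norm (Beta (- s r) (real n))"
    if n: "n \<ge> 2" for n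
  proof -
    have Bn: "Beta (- s i) (real n) \<ge> 0" for i using sneg[of i] n by (intro Beta_nonneg) auto
    have "(\<Sum>i. Beta (- s (i + r)) (real n) / stieltjes_deriv b w (s (i + r)))
       \<le> (\<Sum>i. Beta (- s (i + r)) 2 / stieltjes_deriv b w (s (i + r)) * (Beta (- s r) (real n) / Beta (- s r) 2))"
    proof (rule suminf_le)
      fix i
      have "Beta (- s (i + r)) (real n) \<le> Beta (- s (i + r)) 2 * (Beta (- s r) (real n) / Beta (- s r) 2)"
        using Beta_ratio_le[of "- s r" "- s (i + r)" n] smono[of i] sneg n B2 by (simp add: field_simps)
      then have "Beta (- s (i + r)) (real n) / stieltjes_deriv b w (s (i + r)) \<le> 
         (Beta (- s (i + r)) 2 * (Beta (- s r) (real n) / Beta (- s r) 2)) / stieltjes_deriv b w (s (i + r))"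
        using Dpos[of "i + r"] by (intro divide_right_mono) auto
      then show "Beta (- s (i + r)) (real n) / stieltjes_deriv b w (s (i + r)) \<le> 
         Beta (- s (i + r)) 2 / stieltjes_deriv b w (s (i + r)) * (Beta (- s r) (real n) / Beta (- s r) 2)"
        by (simp add: mult_ac)
    next
      show "summable (\<lambda>i. Beta (- s (i + r)) 2 / stieltjes_deriv b w (s (i + r)) * (Beta (- s r) (real n) / Beta (- s r) 2))"
        using sums[of 2] by (intro summable_mult2) simp
    qed (rule sums[OF n])
    also have "\<dots> = C * Beta (- s r) (real n)"
      using sums[of 2] by (subst suminf_mult2[symmetric]) (auto simp: C_def)
    finally have "(\<Sum>i. Beta (- s (i + r)) (real n) / stieltjes_deriv b w (s (i + r))) \<le> C * Beta (- s r) (real n)" .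
    moreover have "0 \<le> (\<Sum>i. Beta (- s (i + r)) (real n) / stieltjes_deriv b w (s (i + r)))"
      using Dpos Bn by (intro suminf_nonneg sums[OF n] divide_nonneg_nonneg) (auto intro: less_imp_le)
    ultimately show ?thesis using Bn[of r] by simp
  qed
  then have "(\<lambda>n. \<Sum>i. Beta (- s (i + r)) (real n) / stieltjes_deriv b w (s (i + r))) \<in> O(\<lambda>n. Beta (- s r) (real n))"
    by (intro bigoI[of _ C] eventually_mono[OF eventually_ge_at_top[of 2]]) auto
  also have "(\<lambda>n. Beta (- s r) (real n)) \<in> O(\<lambda>n. real n powr s r)"
    using Beta_bigo[of "- s r"] sneg by simp
  finally show ?thesis .
qed

section \<open>The integral as a Stieltjes series\<close>

lemma norm_exp_minus_one_le:
  fixes u :: complex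
  assumes "Re u \<le> 0"
  shows "norm (1 - exp u) \<le> norm u"
proof -
  have "norm (exp 0 - exp u) \<le> 1 * norm (0 - u)"
  proof (rule field_differentiable_bound)
    show "convex {z. Re z \<le> 0}" by (rule convex_halfspace_Re_le)
    show "(exp has_field_derivative exp z) (at z within {z. Re z \<le> 0})" for z :: complex
      by (rule DERIV_exp[THEN has_field_derivative_at_within])
  qed (use assms in auto)
  then show ?thesis by simp
qed

text \<open>
  The coefficient of \<open>s ^ m\<close> in \<open>(1 - s) powr \<beta>\<close>.
\<close>
definition binomial_weight :: "real \<Rightarrow> nat \<Rightarrow> real" where
  "binomial_weight \<beta> m = (-1) ^ m * (\<beta> gchoose m)"

lemma binomial_weight_pos:
  assumes "\<beta> < 0"
  shows "binomial_weight \<beta> m > 0"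
proof -
  have "binomial_weight \<beta> m = pochhammer (- \<beta>) m / fact m"
    by (simp add: binomial_weight_def gbinomial_pochhammer flip: power_mult_distrib)
  then show ?thesis using assms by (simp add: pochhammer_pos)
qed

lemma binomial_weight_sums:
  assumes "0 \<le> s" "s < 1"
  shows "(\<lambda>m. binomial_weight \<beta> m * s ^ m) sums ((1 - s) powr \<beta>)"
  using gen_binomial_real[of "- s" \<beta>] assms
  by (simp add: binomial_weight_def mult.commute mult.left_commute power_minus')

lemma binomial_weight_asymp:
  assumes "\<beta> < 0"
  shows "(\<lambda>m. binomial_weight \<beta> m / real m powr (- \<beta> - 1)) \<longlonglongrightarrow> inverse (Gamma (- \<beta>))"
proof (rule Lim_transform_eventually[OF gbinomial_asymptotic[of \<beta>]])
  show "eventually (\<lambda>n. (\<beta> gchoose n) / ((- 1) ^ n / exp ((\<beta> + 1) * of_real (ln (real n))))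
     = binomial_weight \<beta> n / real n powr (- \<beta> - 1)) sequentially"
    using eventually_gt_at_top[of 0]
  proof eventually_elim
    case (elim n)
    have "real n powr (- \<beta> - 1) = inverse (exp ((\<beta> + 1) * ln (real n)))"
      using elim by (simp add: powr_def exp_minus[symmetric] algebra_simps)
    moreover have "1 / ((- 1) ^ n :: real) = (-1) ^ n" by (simp add: power_one_over[symmetric])
    ultimately show ?case by (simp add: binomial_weight_def divide_inverse mult_ac)
  qed
qed

text \<open>
  The weights are of order \<open>m powr (- \<beta> - 1)\<close>. The terms of the two series are therefore of order
  \<open>m powr (- \<beta> - 3)\<close> and \<open>m powr (\<beta> - 1)\<close>; the first is summable because of \<open>-2 < \<beta>\<close>, the second
  because of \<open>\<beta> < 0\<close>.
\<close>
lemma weights_binomial: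
  assumes "-2 < \<beta>" "\<beta> < 0"
  shows "weights (\<beta> + 2) (binomial_weight \<beta>)"
    and "summable (\<lambda>m. 1 / (binomial_weight \<beta> m * (real m + (\<beta> + 2))\<^sup>2))"
proof -
  have G: "Gamma (- \<beta>) > 0" using assms by (intro Gamma_real_pos) auto
  have nz: "eventually (\<lambda>m. real m powr p \<noteq> 0) sequentially" for p
    using eventually_gt_at_top[of 0] by eventually_elim simp
  have w: "binomial_weight \<beta> \<in> O(\<lambda>m. real m powr (- \<beta> - 1))"
    by (rule bigoI_tendsto[OF binomial_weight_asymp[OF assms(2)] nz])
  have w': "(\<lambda>m. 1 / binomial_weight \<beta> m) \<in> O(\<lambda>m. real m powr (\<beta> + 1))"
  proof (rule bigoI_tendsto[OF _ nz])
    have "(\<lambda>m. inverse (binomial_weight \<beta> m / real m powr (- \<beta> - 1))) \<longlonglongrightarrow> inverse (inverse (Gamma (- \<beta>)))"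
      using G by (intro tendsto_inverse binomial_weight_asymp assms) auto
    moreover have "inverse (binomial_weight \<beta> m / real m powr (- \<beta> - 1)) = 1 / binomial_weight \<beta> m / real m powr (\<beta> + 1)" for m
      using powr_minus[of "real m" "\<beta> + 1"] by (simp add: divide_inverse)
    ultimately show "(\<lambda>m. 1 / binomial_weight \<beta> m / real m powr (\<beta> + 1)) \<longlonglongrightarrow> inverse (inverse (Gamma (- \<beta>)))" by simp
  qed
  have sq: "(\<lambda>m. 1 / (real m + (\<beta> + 2))\<^sup>2) \<in> O(\<lambda>m. real m powr (-2))"
    using assms by real_asymp
  have "(\<lambda>m. binomial_weight \<beta> m * (1 / (real m + (\<beta> + 2))\<^sup>2)) \<in> O(\<lambda>m. real m powr (- \<beta> - 1) * real m powr (-2))"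
    by (rule landau_o.big.mult[OF w sq])
  moreover have "summable (\<lambda>m. norm (real m powr (- \<beta> - 1) * real m powr (-2)))"
    using assms by (simp add: powr_add[symmetric] summable_real_powr_iff)
  ultimately have "summable (\<lambda>m. binomial_weight \<beta> m * (1 / (real m + (\<beta> + 2))\<^sup>2))"
    by (rule summable_comparison_test_bigo[rotated])
  then show "weights (\<beta> + 2) (binomial_weight \<beta>)"
    using assms binomial_weight_pos[OF assms(2)] by (auto simp: weights_def less_imp_le)
  have "(\<lambda>m. 1 / binomial_weight \<beta> m * (1 / (real m + (\<beta> + 2))\<^sup>2)) \<in> O(\<lambda>m. real m powr (\<beta> + 1) * real m powr (-2))"
    by (rule landau_o.big.mult[OF w' sq])
  moreover have "summable (\<lambda>m. norm (real m powr (\<beta> + 1) * real m powr (-2)))"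
    using assms by (simp add: powr_add[symmetric] summable_real_powr_iff)
  ultimately have "summable (\<lambda>m. 1 / binomial_weight \<beta> m * (1 / (real m + (\<beta> + 2))\<^sup>2))"
    by (rule summable_comparison_test_bigo[rotated])
  then show "summable (\<lambda>m. 1 / (binomial_weight \<beta> m * (real m + (\<beta> + 2))\<^sup>2))" by simp
qed

lemma has_integral_complex_powr:
  assumes "Re w > 0"
  shows "((\<lambda>s::real. of_real s powr (w - 1)) has_integral 1 / w) {0..1}"
proof -
  have w: "w \<noteq> 0" using assms by auto
  have "((\<lambda>s::real. of_real s powr (w - 1)) has_integral (of_real 1 powr w / w - of_real 0 powr w / w)) {0..1}"
  proof (rule fundamental_theorem_of_calculus_interior)
    show "continuous_on {0..1} (\<lambda>s::real. of_real s powr w / w)"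
      using w assms by (intro continuous_intros) auto
    fix s :: real assume s: "s \<in> {0<..<1}"
    have "((\<lambda>z. z powr w / w) has_field_derivative of_real s powr (w - 1)) (at (of_real s))"
      using s w by (auto intro!: derivative_eq_intros has_field_derivative_powr simp: complex_nonpos_Reals_iff)
    then show "((\<lambda>s::real. of_real s powr w / w) has_vector_derivative of_real s powr (w - 1)) (at s)"
      by (rule has_vector_derivative_real_field)
  qed simp
  then show ?thesis by simp
qed

lemma has_integral_phi_term:
  assumes "a > 0" "Re z \<ge> 0"
  shows "((\<lambda>s::real. (1 - of_real s powr z) * of_real (s powr (a - 1))) has_integral
    z / (of_real a * (of_real a + z))) {0..1}"
proof -
  have a: "Re (of_real a) > 0" "Re (of_real a + z) > 0" using assms by auto
  then have nz: "complex_of_real a \<noteq> 0" "complex_of_real a + z \<noteq> 0" by (metis less_irrefl zero_complex.simps(1))+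
  have "((\<lambda>s::real. of_real s powr (of_real a - 1) - of_real s powr (of_real a + z - 1)) has_integral
     (1 / of_real a - 1 / (of_real a + z))) {0..1}"
    by (intro has_integral_diff has_integral_complex_powr a)
  moreover have "1 / of_real a - 1 / (of_real a + z) = z / (of_real a * (of_real a + z))"
    using nz by (simp add: field_simps)
  moreover have "of_real s powr (of_real a - 1) - of_real s powr (of_real a + z - 1) =
      (1 - of_real s powr z) * of_real (s powr (a - 1))" if "s \<in> {0..1}" for s :: real
  proof (cases "s = 0")
    case False
    have "complex_of_real s powr (of_real a - 1) = of_real (s powr (a - 1))"
      using powr_of_real[of s "a - 1"] that by simp
    moreover have "complex_of_real s powr (of_real a + z - 1) = of_real s powr z * of_real s powr (of_real a - 1)"
      using False by (simp add: powr_add[symmetric] algebra_simps)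
    ultimately show ?thesis by (simp add: algebra_simps)
  qed simp
  ultimately show ?thesis using has_integral_cong[of "{0..1::real}"] by (metis (no_types, lifting))
qed

text \<open>
  Expand \<open>(1 - s) powr \<beta>\<close> into its binomial series and integrate term by term. A dominating function
  has to keep the zero of \<open>1 - s powr z\<close> at \<open>s = 1\<close>: by
  \<open>\<bar>1 - s powr z\<bar> \<le> \<bar>z\<bar> ln (1 / s) \<le> \<bar>z\<bar> (s powr (- \<epsilon>) - 1) / \<epsilon>\<close> the question is reduced to power
  integrals, and monotone convergence shows that the bound is integrable.
\<close>
lemma phi_int_eq_stieltjes:
  assumes \<beta>: "-2 < \<beta>" "\<beta> < 0" and z: "Re z \<ge> 0"
  shows "phi_int \<beta> z = stieltjes (\<beta> + 2) (binomial_weight \<beta>) z"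
proof -
  let ?w = "binomial_weight \<beta>" and ?b = "\<beta> + 2"
  \<comment> \<open>half of the exponent margin at \<open>s = 0\<close>, so that \<open>s powr (\<beta> + 1 - \<epsilon>)\<close> is still integrable there\<close>
  define \<epsilon> where "\<epsilon> = ?b / 2"
  have \<epsilon>: "\<epsilon> > 0" "\<epsilon> < ?b" using \<beta> by (auto simp: \<epsilon>_def)
  note w = weights_binomial[OF \<beta>]
  have wpos: "?w m > 0" for m by (rule binomial_weight_pos[OF \<beta>(2)])
  define p where "p = (\<lambda>k s. \<Sum>m<k. ?w m * s powr (real m + ?b - 1))"
  define g where "g = (\<lambda>s. s powr (\<beta> + 1) * (1 - s) powr \<beta>)"
  have p_lim: "(\<lambda>k. p k s) \<longlonglongrightarrow> g s" if "0 \<le> s" "s < 1" for s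
  proof -
    have "p k s = s powr (\<beta> + 1) * (\<Sum>m<k. ?w m * s ^ m)" for k
    proof (cases "s = 0")
      case False
      then have "s powr (real m + ?b - 1) = s powr (\<beta> + 1) * s ^ m" for m
        using that by (simp add: powr_add[symmetric] powr_realpow[symmetric] algebra_simps)
      then show ?thesis by (simp add: p_def sum_distrib_left mult_ac)
    qed (simp add: p_def)
    then show ?thesis using binomial_weight_sums[OF that, of \<beta>]
      unfolding g_def by (auto simp: sums_def intro!: tendsto_mult)
  qed
  have p_mono: "0 \<le> p k s" "p k s \<le> p (Suc k) s" for k s
    using wpos by (auto simp: p_def less_imp_le intro!: sum_nonneg)
  define c where "c = (\<lambda>s. norm z / \<epsilon> * (s powr (- \<epsilon>) - 1))"
  have c_bound: "norm (1 - complex_of_real s powr z) \<le> c s" if s: "0 < s" "s \<le> 1" for s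
  proof -
    have "ln s \<le> 0" using s by simp
    have "norm (1 - complex_of_real s powr z) = norm (1 - exp (z * of_real (ln s)))"
      using s by (simp add: powr_def Ln_of_real)
    also have "\<dots> \<le> norm (z * of_real (ln s))"
      using z \<open>ln s \<le> 0\<close> by (intro norm_exp_minus_one_le) (auto intro: mult_nonneg_nonpos)
    also have "\<dots> = norm z * (- ln s)" using \<open>ln s \<le> 0\<close> by (simp add: norm_mult)
    also have "\<dots> \<le> norm z * ((s powr (- \<epsilon>) - 1) / \<epsilon>)"
    proof (rule mult_left_mono)
      have "1 + (- \<epsilon> * ln s) \<le> s powr (- \<epsilon>)" using s exp_ge_add_one_self[of "- \<epsilon> * ln s"] by (simp add: powr_def)
      then show "- ln s \<le> (s powr (- \<epsilon>) - 1) / \<epsilon>" using \<epsilon> by (simp add: field_simps)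
    qed simp
    finally show ?thesis by (simp add: c_def)
  qed
  have c0: "c s \<ge> 0" if "0 < s" "s \<le> 1" for s
    using c_bound[OF that] norm_ge_zero order_trans by blast
  define hk where "hk = (\<lambda>k s. c s * p k s)"
  define h where "h = (\<lambda>s. c s * g s)"
  have hk_lim: "(\<lambda>k. hk k s) \<longlonglongrightarrow> h s" if "s \<in> {0..1}" for s
  proof (cases "s = 1")
    case True
    then show ?thesis by (simp add: hk_def h_def c_def)
  next
    case False
    then show ?thesis unfolding hk_def h_def using that by (intro tendsto_intros p_lim) auto
  qed
  have hk_mono: "hk k s \<le> hk (Suc k) s" if "s \<in> {0..1}" for k s
  proof (cases "s = 0")
    case True
    then show ?thesis by (simp add: hk_def p_def)
  next
    case False
    then show ?thesis using that c0[of s] p_mono unfolding hk_def by (intro mult_left_mono) auto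
  qed
  have hk_int: "(hk k has_integral (\<Sum>m<k. norm z * ?w m / ((real m + ?b) * (real m + ?b - \<epsilon>)))) {0..1}" for k
  proof -
    have "((\<lambda>s. \<Sum>m<k. norm z / \<epsilon> * ?w m * (s powr (real m + ?b - \<epsilon> - 1) - s powr (real m + ?b - 1))) has_integral
       (\<Sum>m<k. norm z / \<epsilon> * ?w m * (1 / (real m + ?b - \<epsilon>) - 1 / (real m + ?b)))) {0..1}"
    proof (intro has_integral_sum has_integral_mult_right has_integral_diff)
      fix m
      have 1: "real m + ?b - \<epsilon> > 0" "real m + ?b > 0" using \<epsilon> by auto
      show "((\<lambda>s. s powr (real m + ?b - \<epsilon> - 1)) has_integral 1 / (real m + ?b - \<epsilon>)) {0..1}"
        using has_integral_powr_from_0[of "real m + ?b - \<epsilon> - 1" 1] 1 by (simp add: algebra_simps)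
      show "((\<lambda>s. s powr (real m + ?b - 1)) has_integral 1 / (real m + ?b)) {0..1}"
        using has_integral_powr_from_0[of "real m + ?b - 1" 1] 1 by (simp add: algebra_simps)
    qed auto
    moreover have "(\<Sum>m<k. norm z / \<epsilon> * ?w m * (s powr (real m + ?b - \<epsilon> - 1) - s powr (real m + ?b - 1))) = hk k s" for s
    proof (cases "s = 0")
      case False
      have "s powr (real m + ?b - \<epsilon> - 1) = s powr (-\<epsilon>) * s powr (real m + ?b - 1)" for m
        by (simp add: powr_add[symmetric] algebra_simps)
      then show ?thesis unfolding hk_def p_def c_def sum_distrib_left
        by (intro sum.cong) (simp_all add: algebra_simps)
    qed (simp add: hk_def p_def)
    moreover have "(\<Sum>m<k. norm z / \<epsilon> * ?w m * (1 / (real m + ?b - \<epsilon>) - 1 / (real m + ?b)))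
      = (\<Sum>m<k. norm z * ?w m / ((real m + ?b) * (real m + ?b - \<epsilon>)))"
    proof (intro sum.cong refl)
      fix m
      have "real m + ?b - \<epsilon> > 0" "real m + ?b > 0" using \<epsilon> by auto
      then have "1 / (real m + ?b - \<epsilon>) - 1 / (real m + ?b) = \<epsilon> / ((real m + ?b) * (real m + ?b - \<epsilon>))"
        by (simp add: divide_simps)
      then show "norm z / \<epsilon> * ?w m * (1 / (real m + ?b - \<epsilon>) - 1 / (real m + ?b)) = norm z * ?w m / ((real m + ?b) * (real m + ?b - \<epsilon>))"
        using \<epsilon> by simp
    qed
    ultimately show ?thesis by simp
  qed
  have h_int: "h integrable_on {0..1}"
  proof (rule monotone_convergence_increasing[THEN conjunct1, of hk])
    show "hk k integrable_on {0..1}" for k using hk_int by blast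
    show "bounded (range (\<lambda>k. integral {0..1} (hk k)))"
    proof (rule boundedI)
      fix x assume "x \<in> range (\<lambda>k. integral {0..1} (hk k))"
      then obtain k where x: "x = (\<Sum>m<k. norm z * ?w m / ((real m + ?b) * (real m + ?b - \<epsilon>)))"
        using integral_unique[OF hk_int] by auto
      have pos: "real m + ?b - \<epsilon> > 0" "real m + ?b > 0" for m using \<epsilon> by auto
      have "x \<ge> 0" unfolding x using pos wpos by (intro sum_nonneg divide_nonneg_nonneg mult_nonneg_nonneg) (auto intro: less_imp_le)
      have "x \<le> (\<Sum>m<k. 2 * norm z * (?w m / (real m + ?b)\<^sup>2))" unfolding x
      proof (rule sum_mono)
        fix m
        have "(real m + ?b) / 2 \<le> real m + ?b - \<epsilon>" by (simp add: \<epsilon>_def field_simps)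
        then have "(real m + ?b) * ((real m + ?b) / 2) \<le> (real m + ?b) * (real m + ?b - \<epsilon>)"
          using pos(2)[of m] by (intro mult_left_mono) auto
        then have "(real m + ?b)\<^sup>2 / 2 \<le> (real m + ?b) * (real m + ?b - \<epsilon>)"
          by (simp add: power2_eq_square)
        then have "norm z * ?w m / ((real m + ?b) * (real m + ?b - \<epsilon>)) \<le> norm z * ?w m / ((real m + ?b)\<^sup>2 / 2)"
          using pos[of m] wpos[of m] by (intro divide_left_mono mult_pos_pos) auto
        then show "norm z * ?w m / ((real m + ?b) * (real m + ?b - \<epsilon>)) \<le> 2 * norm z * (?w m / (real m + ?b)\<^sup>2)" by (simp add: mult_ac)
      qed
      also have "\<dots> \<le> (\<Sum>m. 2 * norm z * (?w m / (real m + ?b)\<^sup>2))"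
        using w wpos by (intro sum_le_suminf summable_mult) (auto simp: weights_def less_imp_le)
      finally show "norm x \<le> (\<Sum>m. 2 * norm z * (?w m / (real m + ?b)\<^sup>2))" using \<open>x \<ge> 0\<close> by simp
    qed
  qed (use hk_mono hk_lim in auto)
  define fk where "fk = (\<lambda>k s. (1 - complex_of_real s powr z) * of_real (p k s))"
  have fk_int: "(fk k has_integral (\<Sum>m<k. of_real (?w m) * (z / (of_real (real m + ?b) * (of_real (real m + ?b) + z))))) {0..1}" for k
  proof -
    have "((\<lambda>s. \<Sum>m<k. of_real (?w m) * ((1 - complex_of_real s powr z) * of_real (s powr (real m + ?b - 1)))) has_integral
      (\<Sum>m<k. of_real (?w m) * (z / (of_real (real m + ?b) * (of_real (real m + ?b) + z))))) {0..1}"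
      using \<beta> z by (intro has_integral_sum has_integral_mult_right has_integral_phi_term) auto
    moreover have "(\<Sum>m<k. of_real (?w m) * ((1 - complex_of_real s powr z) * of_real (s powr (real m + ?b - 1)))) = fk k s" for s
      by (simp add: fk_def p_def sum_distrib_left mult_ac)
    ultimately show ?thesis by simp
  qed
  have "(\<lambda>k. integral {0..1} (fk k)) \<longlonglongrightarrow> integral {0..1} (\<lambda>s. (1 - complex_of_real s powr z) * of_real (g s))"
  proof (rule dominated_convergence(2)[OF _ h_int])
    show "fk k integrable_on {0..1}" for k using fk_int by blast
    fix s :: real assume s: "s \<in> {0..1}"
    show "norm (fk k s) \<le> h s" for k
    proof (cases "s = 0")
      case True
      then show ?thesis by (simp add: fk_def p_def h_def g_def)
    next
      case False
      have "norm (fk k s) = norm (1 - complex_of_real s powr z) * p k s" using p_mono by (simp add: fk_def norm_mult)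
      also have "\<dots> \<le> hk k s" unfolding hk_def using False s c_bound[of s] p_mono by (intro mult_right_mono) auto
      also have "\<dots> \<le> h s"
        using hk_lim[OF s] hk_mono[OF s] by (intro incseq_le) (auto intro: incseq_SucI)
      finally show ?thesis .
    qed
    show "(\<lambda>k. fk k s) \<longlonglongrightarrow> (1 - complex_of_real s powr z) * of_real (g s)"
    proof (cases "s = 1")
      case False
      then show ?thesis unfolding fk_def using s by (intro tendsto_intros p_lim) auto
    qed (simp add: fk_def)
  qed
  then have "(\<lambda>k. \<Sum>m<k. of_real (?w m) * (z / (of_real (real m + ?b) * (of_real (real m + ?b) + z)))) \<longlonglongrightarrow> phi_int \<beta> z"
    using integral_unique[OF fk_int] by (simp add: phi_int_def g_def)
  then show ?thesis unfolding stieltjes_def sums_def[symmetric] by (simp add: sums_unique)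
qed

section \<open>The meromorphic extension and its derivatives at the origin\<close>

text \<open>
  The difference vanishes near one point and hence, after removing singularities, everywhere. The two
  functions then agree near every point, and the conventions for poles and removable singularities
  determine the value at the point itself.
\<close>
lemma nicely_meromorphic_eqI:
  assumes f: "f nicely_meromorphic_on UNIV" and g: "g nicely_meromorphic_on UNIV"
    and eq: "eventually (\<lambda>z. f z = g z) (at z0)"
  shows "f = g"
proof
  fix z
  define h where "h = remove_sings (\<lambda>z. f z - g z)"
  have mero: "(\<lambda>z. f z - g z) meromorphic_on UNIV"
    using f g by (intro meromorphic_intros) (auto simp: nicely_meromorphic_on_def)
  have h: "h nicely_meromorphic_on UNIV"
    unfolding h_def by (rule remove_sings_nicely_meromorphic[OF mero])
  have ev: "eventually (\<lambda>w. h w = f w - g w) (at w0)" for w0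
    unfolding h_def using mero
    by (intro eventually_remove_sings_eq_at meromorphic_on_isolated_singularity) (auto intro: meromorphic_on_subset)
  have "eventually (\<lambda>w. h w = 0) (at z0)"
    using ev[of z0] eq by eventually_elim simp
  then have "frequently (\<lambda>w. h w = 0) (at z0)" by (intro eventually_frequently) auto
  then have "h w = 0" for w
    by (rule frequently_eq_meromorphic_imp_constant[OF _ h]) auto
  then have fg: "eventually (\<lambda>w. f w = g w) (at z)" using ev[of z] by simp
  then have pole: "is_pole f z \<longleftrightarrow> is_pole g z" by (intro is_pole_cong) auto
  show "f z = g z"
  proof (cases "is_pole f z")
    case True
    then have "\<not> f \<midarrow>z\<rightarrow> f z" "\<not> g \<midarrow>z\<rightarrow> g z" using pole
      by (auto simp: is_pole_def dest: not_tendsto_and_filterlim_at_infinity[rotated 2])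
    then show ?thesis using f g unfolding nicely_meromorphic_on_def by (metis UNIV_I)
  next
    case False
    then have "f \<midarrow>z\<rightarrow> f z" "g \<midarrow>z\<rightarrow> g z" using f g pole by (auto simp: nicely_meromorphic_on_def)
    moreover from this(2) have "f \<midarrow>z\<rightarrow> g z" using fg by (subst tendsto_cong)
    ultimately show ?thesis using LIM_unique by blast
  qed
qed

lemma off_poles_open: "open {z :: complex. off_poles b w z}"
  unfolding open_subopen[of "{z. off_poles b w z}"]
proof safe
  fix z :: complex assume "off_poles b w z"
  then have "eventually (off_poles b w) (nhds z)"
    using eventually_off_poles[of b w z] by (auto simp: eventually_nhds_conv_at)
  then show "\<exists>T. open T \<and> z \<in> T \<and> T \<subseteq> {z. off_poles b w z}"
    by (auto simp: eventually_nhds)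
qed

lemma stieltjes_holomorphic:
  assumes "weights b w"
  shows "stieltjes b w holomorphic_on {z. off_poles b w z}"
  using has_field_derivative_stieltjes[OF assms] by (auto simp: holomorphic_on_open[OF off_poles_open])

text \<open>
  The plain series omits its singular term at a pole; a nicely meromorphic function is 0 there.
\<close>
definition stieltjes_mero :: "real \<Rightarrow> (nat \<Rightarrow> real) \<Rightarrow> complex \<Rightarrow> complex" where
  "stieltjes_mero b w z = (if off_poles b w z then stieltjes b w z else 0)"

lemma stieltjes_mero_analytic:
  assumes "weights b w"
  shows "stieltjes_mero b w analytic_on {z. off_poles b w z}"
  using stieltjes_holomorphic[OF assms] 
  by (subst analytic_on_open[OF off_poles_open], elim holomorphic_transform) (simp add: stieltjes_mero_def)

lemma stieltjes_mero_pole: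
  assumes w: "weights b w" and z: "\<not> off_poles b w z"
  shows "is_pole (stieltjes_mero b w) z"
proof -
  have b: "b > 0" using w by (auto simp: weights_def)
  from z obtain k where k: "w k \<noteq> 0" "complex_of_real (real k + b) + z = 0"
    by (auto simp: off_poles_def)
  then have zk: "z = - of_real (real k + b)" by (metis eq_neg_iff_add_eq_0 add.commute)
  have a0: "complex_of_real (real k + b) \<noteq> 0" using b by (metis add_nonneg_pos of_nat_0_le_iff of_real_eq_0_iff less_irrefl)
  have "off_poles b (w(k := 0)) z"
    unfolding off_poles_def zk
    by (metis add.commute add.right_inverse add_diff_cancel_right' eq_neg_iff_add_eq_0 fun_upd_apply minus_minus of_nat_eq_iff of_real_eq_iff)
  then have "stieltjes b (w(k := 0)) \<midarrow>z\<rightarrow> stieltjes b (w(k := 0)) z"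
    using stieltjes_isCont[OF weights_update_0[OF w]] by (simp add: isCont_def)
  moreover have "filterlim (\<lambda>x. of_real (w k) * x / of_real (real k + b) / (of_real (real k + b) + x)) at_infinity (at z)"
  proof (rule filterlim_divide_at_infinity)
    show "((\<lambda>x. of_real (w k) * x / of_real (real k + b)) \<longlongrightarrow> of_real (w k) * z / of_real (real k + b)) (at z)"
      using a0 by (intro tendsto_intros)
    have "z \<noteq> 0" using a0 k(2) by auto
    then show "of_real (w k) * z / of_real (real k + b) \<noteq> 0" using a0 k by simp
    show "filterlim (\<lambda>x. of_real (real k + b) + x) (at 0) (at z)"
      unfolding filterlim_at
    proof
      show "((\<lambda>x. of_real (real k + b) + x) \<longlongrightarrow> 0) (at z)"
        using tendsto_add[OF tendsto_const tendsto_ident_at, of "of_real (real k + b)" z UNIV] k by simp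
      show "\<forall>\<^sub>F x in at z. of_real (real k + b) + x \<in> UNIV \<and> of_real (real k + b) + x \<noteq> 0"
        using eventually_neq_at_within[of z] by eventually_elim (metis UNIV_I add_left_cancel k(2))
    qed
  qed
  ultimately have "filterlim (\<lambda>x. stieltjes b (w(k := 0)) x + of_real (w k) * x / of_real (real k + b) / (of_real (real k + b) + x)) at_infinity (at z)"
    by (rule tendsto_add_filterlim_at_infinity)
  moreover have "eventually (\<lambda>x. stieltjes_mero b w x = stieltjes b (w(k := 0)) x + of_real (w k) * x / of_real (real k + b) / (of_real (real k + b) + x)) (at z)"
    using eventually_off_poles[of b w z] by eventually_elim (simp add: stieltjes_mero_def stieltjes_split[OF w, of _ k])
  ultimately show ?thesis unfolding is_pole_def by (simp add: filterlim_cong)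
qed

lemma stieltjes_mero_nicely_meromorphic:
  assumes w: "weights b w"
  shows "stieltjes_mero b w nicely_meromorphic_on UNIV"
proof (rule nicely_meromorphic_onI_open[where pts = "{z. \<not> off_poles b w z}"])
  show "stieltjes_mero b w analytic_on UNIV - {z. \<not> off_poles b w z}"
    using stieltjes_mero_analytic[OF w] by (rule analytic_on_subset) auto
  fix z :: complex
  show "z \<in> {z. \<not> off_poles b w z} \<Longrightarrow> is_pole (stieltjes_mero b w) z \<and> stieltjes_mero b w z = 0"
    using stieltjes_mero_pole[OF w] by (auto simp: stieltjes_mero_def)
  obtain r where "r > 0" "\<forall>x. x \<noteq> z \<and> dist x z < r \<longrightarrow> off_poles b w x"
    using eventually_off_poles[of b w z] by (auto simp: eventually_at)
  then have "ball z r - {z} \<subseteq> {z. off_poles b w z}" by (auto simp: dist_commute)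
  then show "isolated_singularity_at (stieltjes_mero b w) z"
    unfolding isolated_singularity_at_def using \<open>r > 0\<close> stieltjes_mero_analytic[OF w] analytic_on_subset by blast
qed auto

lemma off_poles_right_half_plane: 
  assumes "b > 0" "Re z \<ge> 0" shows "off_poles b w (z :: complex)"
  unfolding off_poles_def
proof safe
  fix m assume "of_real (real m + b) + z = 0"
  then have "Re (of_real (real m + b) + z) = 0" by simp
  then show False using assms by simp
qed

lemma phi_eq:
  assumes \<beta>: "-2 < \<beta>" "\<beta> < 0"
  shows "phi \<beta> = stieltjes_mero (\<beta> + 2) (binomial_weight \<beta>)"
  unfolding phi_def
proof (rule the_equality)
  let ?F = "stieltjes_mero (\<beta> + 2) (binomial_weight \<beta>)"
  have F: "?F nicely_meromorphic_on UNIV"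
    by (intro stieltjes_mero_nicely_meromorphic weights_binomial \<beta>)
  have F': "?F z = phi_int \<beta> z" if "Re z \<ge> 0" for z
    using that \<beta> by (simp add: stieltjes_mero_def phi_int_eq_stieltjes off_poles_right_half_plane)
  show "?F nicely_meromorphic_on UNIV \<and> (\<forall>z. 0 \<le> Re z \<longrightarrow> ?F z = phi_int \<beta> z)" using F F' by blast
  fix f assume f: "f nicely_meromorphic_on UNIV \<and> (\<forall>z. 0 \<le> Re z \<longrightarrow> f z = phi_int \<beta> z)"
  have "eventually (\<lambda>z::complex. z \<in> {z. Re z > 0}) (at 1)"
    by (intro eventually_at_in_open' open_halfspace_Re_gt) auto
  then have "eventually (\<lambda>z. f z = ?F z) (at 1)" by eventually_elim (use f F' in auto)
  then show "f = ?F" using f F nicely_meromorphic_eqI by blast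
qed

lemma deriv_stieltjes_mero:
  assumes w: "weights b w" and z: "off_poles b w z"
  shows "deriv (stieltjes_mero b w) z = stieltjes_deriv b w z"
proof -
  have "eventually (\<lambda>x. stieltjes b w x = stieltjes_mero b w x) (nhds z)"
    using eventually_nhds_in_open[OF off_poles_open, of z b w] z by (auto elim: eventually_mono simp: stieltjes_mero_def)
  then have "deriv (stieltjes b w) z = deriv (stieltjes_mero b w) z" by (intro deriv_cong_ev) auto
  then show ?thesis using DERIV_imp_deriv[OF has_field_derivative_stieltjes[OF w z]] by simp
qed

text \<open>
  The difference quotient of each term is a multiple of \<open>w m / ((m + b) (m + b + x))\<close> with a bounded
  factor, so the limit can be taken under the sum.
\<close>
lemma has_field_derivative_stieltjes_deriv_0:
  assumes w: "weights b w"
  shows "(stieltjes_deriv b w has_field_derivative - 2 * of_real (cube_sum b w)) (at (0 :: complex))"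
proof -
  have b: "b > 0" using w by (auto simp: weights_def)
  define A where "A = (\<lambda>m. complex_of_real (real m + b))"
  have A0: "A m \<noteq> 0" for m
  proof -
    have "real m + b \<noteq> 0" using b by (metis add_nonneg_pos of_nat_0_le_iff less_irrefl)
    then show ?thesis unfolding A_def of_real_eq_0_iff .
  qed
  define q where "q = (\<lambda>m x. - (of_real (w m) / (A m * (A m + x)) * (inverse (A m) + inverse (A m + x))))"
  have q_lim: "((\<lambda>x. \<Sum>m. q m x) \<longlongrightarrow> (\<Sum>m. q m 0)) (at 0)"
  proof (rule tannery_uniform[where P = "\<lambda>x. norm x < 1" and K = 2 and B = "\<lambda>m. 16 * (w m / (real m + b)\<^sup>2)"])
    show "(q m \<longlongrightarrow> q m 0) (at 0)" for m
      unfolding q_def using A0 by (intro tendsto_intros) auto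
    show "eventually (\<lambda>x::complex. norm x < 1) (at 0)"
      by (auto simp: eventually_at intro: exI[of _ 1])
    fix m :: nat and x :: complex assume m: "2 \<le> m" "norm x < 1"
    have 1: "norm (of_real (w m) / ((A m + 0) * (A m + x))) \<le> 4 * (w m / (real m + b)\<^sup>2)"
      unfolding A_def using m by (intro stieltjes_kernel_bound[OF w, of _ 1]) auto
    have i: "norm (inverse (A m + y)) \<le> 2" if "norm y < 1" for y
    proof -
      have "norm (inverse (A m + y)) \<le> 2 / (real m + b)"
        unfolding A_def using b m that by (intro norm_inverse_shift_le[of _ 1]) auto
      also have "\<dots> \<le> 2" using b m by (simp add: field_simps)
      finally show ?thesis .
    qed
    have "norm (inverse (A m) + inverse (A m + x)) \<le> 2 + 2"
      using i[of 0] i[OF m(2)] by (intro norm_triangle_mono) auto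
    with 1 have "norm (q m x) \<le> 4 * (w m / (real m + b)\<^sup>2) * (2 + 2)"
      unfolding q_def norm_minus_cancel norm_mult[of "_ / _"] using w by (intro mult_mono) (auto simp: weights_def)
    then show "norm (q m x) \<le> 16 * (w m / (real m + b)\<^sup>2)" by simp
  next
    show "summable (\<lambda>m. 16 * (w m / (real m + b)\<^sup>2))"
      using w by (intro summable_mult) (auto simp: weights_def)
  qed simp
  have "(\<Sum>m. q m 0) = (\<Sum>m. of_real ((- 2) * (w m / (real m + b) ^ 3)))"
  proof (intro suminf_cong)
    fix m
    have "q m 0 = (- 2) * (of_real (w m) / A m ^ 3)"
      using A0[of m] by (simp add: q_def power3_eq_cube field_simps)
    then show "q m 0 = of_real ((- 2) * (w m / (real m + b) ^ 3))" by (simp add: A_def)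
  qed
  also have "\<dots> = complex_of_real (\<Sum>m. (- 2) * (w m / (real m + b) ^ 3))"
    by (rule suminf_of_real[symmetric], rule summable_mult, rule summable_cube[OF w])
  also have "(\<Sum>m. (- 2) * (w m / (real m + b) ^ 3)) = (- 2) * cube_sum b w"
    unfolding cube_sum_def by (rule suminf_mult[OF summable_cube[OF w]])
  finally have "((\<lambda>x. \<Sum>m. q m x) \<longlongrightarrow> - 2 * of_real (cube_sum b w)) (at 0)" using q_lim by simp
  moreover have "eventually (\<lambda>x. (\<Sum>m. q m x) = (stieltjes_deriv b w x - stieltjes_deriv b w 0) / (x - 0)) (at 0)"
    using eventually_off_poles[of b w 0] eventually_neq_at_within[of 0]
  proof eventually_elim
    case (elim x)
    have "(stieltjes_deriv b w x - stieltjes_deriv b w 0) / (x - 0) =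
       (\<Sum>m. (of_real (w m) / (A m + x)\<^sup>2 - of_real (w m) / (A m + 0)\<^sup>2)) / (x - 0)"
      unfolding stieltjes_deriv_def A_def by (intro arg_cong2[where f = "(/)"] suminf_diff summable_stieltjes_deriv w refl)
    also have "\<dots> = (\<Sum>m. (of_real (w m) / (A m + x)\<^sup>2 - of_real (w m) / (A m + 0)\<^sup>2) / (x - 0))"
      unfolding A_def by (intro suminf_divide[symmetric] summable_diff summable_stieltjes_deriv w)
    also have "\<dots> = (\<Sum>m. q m x)"
    proof (intro suminf_cong)
      fix m
      have *: "w m \<noteq> 0 \<Longrightarrow> A m + x \<noteq> 0" using elim by (auto simp: off_poles_def A_def)
      have "(c / (a + x)\<^sup>2 - c / a\<^sup>2) / x = - (c / (a * (a + x)) * (inverse a + inverse (a + x)))"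
        if "a \<noteq> 0" "a + x \<noteq> 0" for a c :: complex
      proof -
        have "c / (a + x)\<^sup>2 - c / a\<^sup>2 = - x * (c / (a * (a + x)) * (inverse a + inverse (a + x)))"
          using that by (simp add: divide_simps power2_eq_square) (simp add: algebra_simps)
        then show ?thesis using elim by simp
      qed
      from this[OF A0[of m], of "of_real (w m)"] *
      show "(of_real (w m) / (A m + x)\<^sup>2 - of_real (w m) / (A m + 0)\<^sup>2) / (x - 0) = q m x"
        by (cases "w m = 0") (auto simp: q_def)
    qed
    finally show ?case by simp
  qed
  ultimately show ?thesis unfolding has_field_derivative_iff by (rule Lim_transform_eventually)
qed

lemma deriv2_stieltjes_mero_0:
  assumes w: "weights b w"
  shows "(deriv ^^ 2) (stieltjes_mero b w) 0 = - 2 * of_real (cube_sum b w)"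
proof -
  have off: "off_poles b w (0 :: complex)" using w by (intro off_poles_right_half_plane) (auto simp: weights_def)
  have "eventually (\<lambda>x. deriv (stieltjes_mero b w) x = stieltjes_deriv b w x) (nhds 0)"
    using eventually_nhds_in_open[OF off_poles_open, of 0 b w] off deriv_stieltjes_mero[OF w] by (auto elim: eventually_mono)
  then have "deriv (deriv (stieltjes_mero b w)) 0 = deriv (stieltjes_deriv b w) (0 :: complex)"
    by (intro deriv_cong_ev) auto
  then show ?thesis using DERIV_imp_deriv[OF has_field_derivative_stieltjes_deriv_0[OF w]]
    by (simp add: numeral_2_eq_2)
qed

section \<open>The complex zeros\<close>

text \<open>
  At a zero \<open>z \<noteq> 0\<close> the series of \<open>w m / ((m + b) (m + b + z))\<close> vanishes. The imaginary parts of its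
  terms never have the sign of \<open>Im z\<close>, so they can only cancel if \<open>z\<close> is real.
\<close>
lemma stieltjes_zero_real:
  fixes z :: complex
  assumes w: "weights b w" "w 0 > 0" and z: "off_poles b w z" "stieltjes b w z = 0"
  shows "Im z = 0"
proof (rule ccontr)
  assume im: "Im z \<noteq> 0"
  have b: "b > 0" using w by (auto simp: weights_def)
  define t where "t = (\<lambda>m. of_real (w m) / ((of_real (real m + b) + 0) * (of_real (real m + b) + z)))"
  have off: "off_poles b w (0 :: complex)" using b by (intro off_poles_right_half_plane) auto
  have sm: "summable t" unfolding t_def by (rule summable_stieltjes_kernel[OF w(1)])
  have "(z - 0) * suminf t = 0"
    using stieltjes_diff[OF w(1) off z(1)] z(2) unfolding t_def by (simp add: stieltjes_def)
  then have "suminf t = 0" using im by auto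
  then have "(\<lambda>m. Im (t m)) sums 0" using sums_Im[OF summable_sums[OF sm]] by simp
  then have "(\<lambda>m. - Im (t m) / Im z) sums 0" using sums_divide[of _ 0 "- Im z"] by fastforce
  moreover have Im: "- Im (t m) / Im z = w m / ((real m + b) * norm (of_real (real m + b) + z) ^ 2)" for m
  proof -
    have a: "real m + b > 0" using b by simp
    have "t m = of_real (w m / (real m + b)) * inverse (of_real (real m + b) + z)"
      by (simp add: t_def divide_inverse)
    then have "Im (t m) = w m / (real m + b) * Im (inverse (of_real (real m + b) + z))"
      by (simp only: times_complex.sel Re_complex_of_real Im_complex_of_real)
    also have "Im (inverse (of_real (real m + b) + z)) = - Im z / norm (of_real (real m + b) + z) ^ 2"
      by (simp add: cmod_power2)
    finally show ?thesis using im by simp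
  qed
  moreover have "0 < (\<Sum>m. w m / ((real m + b) * norm (of_real (real m + b) + z) ^ 2))"
  proof (rule suminf_pos2[of _ 0])
    show "summable (\<lambda>m. w m / ((real m + b) * norm (of_real (real m + b) + z) ^ 2))"
      using calculation(1) unfolding Im by (rule sums_summable)
    show "0 \<le> w m / ((real m + b) * norm (of_real (real m + b) + z) ^ 2)" for m
      using w b by (auto simp: weights_def)
    have "of_real (real 0 + b) + z \<noteq> 0" using im
      by (metis Im_complex_of_real add_0 plus_complex.sel(2) zero_complex.sel(2))
    then have "norm (of_real (real 0 + b) + z) ^ 2 > 0" by simp
    then show "0 < w 0 / ((real 0 + b) * norm (of_real (real 0 + b) + z) ^ 2)"
      using w b by (auto intro!: divide_pos_pos mult_pos_pos)
  qed
  ultimately show False using sums_unique by force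
qed

text \<open>
  To the right of all poles the series is \<open>x\<close> times a positive number; every other point that is not
  a pole lies between two consecutive poles.
\<close>
lemma stieltjes_real_zero_cases:
  fixes x :: real
  assumes w: "weights b w" "\<And>m. w m > 0" and x: "off_poles b w x" "stieltjes b w x = 0"
  shows "x \<in> range (node b w)"
proof (cases "x > - b")
  case True
  have b: "b > 0" using w by (auto simp: weights_def)
  have off: "off_poles b w (0 :: real)" using b by (auto simp: off_poles_def)
  have pos: "0 < (\<Sum>m. w m / ((real m + b + 0) * (real m + b + x)))"
  proof (rule suminf_pos2[of _ 0])
    show "summable (\<lambda>m. w m / ((real m + b + 0) * (real m + b + x)))"
      using summable_stieltjes_kernel[OF w(1), of 0 x] by simp
    have "real m + b + 0 > 0" "real m + b + x > 0" for m using b True by auto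
    then show "0 \<le> w m / ((real m + b + 0) * (real m + b + x))" "0 < w 0 / ((real 0 + b + 0) * (real 0 + b + x))" for m
      using w(2) by (meson divide_nonneg_pos divide_pos_pos less_imp_le mult_pos_pos)+
  qed
  have "(x - 0) * (\<Sum>m. w m / ((real m + b + 0) * (real m + b + x))) = 0"
    using stieltjes_diff[OF w(1) off x(1)] x(2) by (simp add: stieltjes_def)
  then have "x = 0" using pos by simp
  then show ?thesis by (auto simp: node_def image_iff intro!: exI[of _ 0])
next
  case False
  define k where "k = nat \<lfloor>- x - b\<rfloor>"
  have "real k \<le> - x - b" "- x - b < real k + 1" using False unfolding k_def by linarith+
  moreover have "- x - b \<noteq> real k"
  proof
    assume "- x - b = real k"
    then have "real k + b + x = 0" by simp
    moreover have "w k \<noteq> 0" using w(2)[of k] by simp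
    ultimately show False using x(1) by (auto simp: off_poles_def)
  qed
  ultimately have "- (real (Suc k) + b) < x" "x < - (real k + b)" by auto
  then have "x = stieltjes_zero b w k"
    using ex1_stieltjes_zero_between[OF w(1) w(2) w(2), of k] stieltjes_zero[OF w(1) w(2) w(2), of k] x(2) by blast
  then show ?thesis by (auto simp: node_def image_iff intro!: exI[of _ "Suc k"])
qed

text \<open>
  Makes the description of the enumeration of the zeros by its range unambiguous.
\<close>
lemma strict_decreasing_range_unique:
  fixes f g :: "nat \<Rightarrow> 'a :: linorder"
  assumes f: "\<And>j k. j < k \<Longrightarrow> f k < f j" and g: "\<And>j k. j < k \<Longrightarrow> g k < g j"
    and range: "range f = range g"
  shows "f = g"
proof
  fix n show "f n = g n"
  proof (induction n rule: less_induct)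
    case (less n)
    obtain m where m: "f n = g m" using range by (metis rangeE rangeI)
    obtain l where l: "g n = f l" using range by (metis rangeE rangeI)
    have "n \<le> m" using less.IH[of m] f[of m n] m by (metis less_irrefl not_le)
    moreover have "n \<le> l" using less.IH[of l] g[of l n] l by (metis less_irrefl not_le)
    ultimately have "g m \<le> g n" "f l \<le> f n" using f g by (metis le_less order.refl)+
    then show ?case using m l by simp
  qed
qed

lemma off_poles_of_real: "off_poles b w (complex_of_real x) \<longleftrightarrow> off_poles b w x"
  unfolding off_poles_def of_real_add[symmetric] of_real_eq_0_iff by simp

lemma phi_zeros_eq:
  assumes \<beta>: "-2 < \<beta>" "\<beta> < 0"
  shows "phi_zeros \<beta> = range (\<lambda>k. complex_of_real (node (\<beta> + 2) (binomial_weight \<beta>) k))"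
proof -
  let ?b = "\<beta> + 2" and ?w = "binomial_weight \<beta>"
  note w = weights_binomial(1)[OF \<beta>]
  have wpos: "?w m > 0" for m by (rule binomial_weight_pos[OF \<beta>(2)])
  have not_pole: "is_pole (phi \<beta>) z \<longleftrightarrow> \<not> off_poles ?b ?w z" for z
  proof
    assume pole: "is_pole (phi \<beta>) z"
    show "\<not> off_poles ?b ?w z"
    proof
      assume "off_poles ?b ?w z"
      then have "stieltjes_mero ?b ?w analytic_on {z}"
        using analytic_on_subset[OF stieltjes_mero_analytic[OF w], of "{z}"] by simp
      then show False using pole analytic_at_imp_no_pole unfolding phi_eq[OF \<beta>] by blast
    qed
  qed (use stieltjes_mero_pole[OF w] phi_eq[OF \<beta>] in auto)
  have "z \<in> phi_zeros \<beta> \<longleftrightarrow> off_poles ?b ?w z \<and> stieltjes ?b ?w z = 0" for z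
    unfolding phi_zeros_def mem_Collect_eq not_pole by (auto simp: phi_eq[OF \<beta>] stieltjes_mero_def)
  moreover have "off_poles ?b ?w z \<and> stieltjes ?b ?w z = 0 \<longleftrightarrow> z \<in> range (\<lambda>k. complex_of_real (node ?b ?w k))" for z
  proof
    assume z: "off_poles ?b ?w z \<and> stieltjes ?b ?w z = 0"
    then have "Im z = 0" using stieltjes_zero_real[OF w wpos] by blast
    then have zx: "z = of_real (Re z)" by (simp add: complex_eq_iff)
    then have "off_poles ?b ?w (Re z)" "stieltjes ?b ?w (Re z) = 0"
      using z stieltjes_of_real[OF w, of "Re z", where 'a = complex] off_poles_of_real[of ?b ?w "Re z"] by auto
    then have "Re z \<in> range (node ?b ?w)" by (intro stieltjes_real_zero_cases w wpos)
    then show "z \<in> range (\<lambda>k. complex_of_real (node ?b ?w k))" using zx by auto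
  next
    assume "z \<in> range (\<lambda>k. complex_of_real (node ?b ?w k))"
    then show "off_poles ?b ?w z \<and> stieltjes ?b ?w z = 0"
      using node_facts(1,2)[OF w _ lessI] wpos by (auto simp: off_poles_of_real stieltjes_of_real[OF w])
  qed
  ultimately show ?thesis by blast
qed

lemma phi_zero_eq:
  assumes \<beta>: "-2 < \<beta>" "\<beta> < 0"
  shows "phi_zero \<beta> = node (\<beta> + 2) (binomial_weight \<beta>)"
  unfolding phi_zero_def
proof (rule the_equality)
  let ?n = "node (\<beta> + 2) (binomial_weight \<beta>)"
  have n: "?n k < ?n j" if "j < k" for j k
    using binomial_weight_pos[OF \<beta>(2)] by (intro node_facts(3)[OF weights_binomial(1)[OF \<beta>] _ lessI that]) simp
  have "?n 0 = 0" by (simp add: node_def)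
  then show "?n 0 = 0 \<and> (\<forall>j k. j < k \<longrightarrow> ?n k < ?n j) \<and> range (\<lambda>k. complex_of_real (?n k)) = phi_zeros \<beta>"
    using n phi_zeros_eq[OF \<beta>] by metis
  fix s :: "nat \<Rightarrow> real" assume s: "s 0 = 0 \<and> (\<forall>j k. j < k \<longrightarrow> s k < s j) \<and> range (\<lambda>k. complex_of_real (s k)) = phi_zeros \<beta>"
  then have "complex_of_real ` range s = complex_of_real ` range ?n"
    using phi_zeros_eq[OF \<beta>] by (simp add: image_image)
  then have "range s = range ?n" by (metis inj_image_eq_iff inj_of_real)
  then show "s = ?n" using s n by (intro strict_decreasing_range_unique) auto
qed

section \<open>The block of a tagged label\<close>

text \<open>
  Up to the factor \<open>j!\<close>, the factorial moment of order \<open>j\<close> of the binomial distribution.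
\<close>
lemma binomial_factorial_moment:
  fixes s :: "'a :: comm_ring_1"
  assumes "j \<le> n"
  shows "(\<Sum>l\<le>n. of_nat (n choose l) * of_nat (l choose j) * s ^ l * (1 - s) ^ (n - l)) = of_nat (n choose j) * s ^ j"
proof -
  have "(\<Sum>l\<le>n. of_nat (n choose l) * of_nat (l choose j) * s ^ l * (1 - s) ^ (n - l))
      = (\<Sum>l\<in>{j..n}. of_nat (n choose l) * of_nat (l choose j) * s ^ l * (1 - s) ^ (n - l))"
    by (intro sum.mono_neutral_right) (auto simp: binomial_eq_0)
  also have "\<dots> = (\<Sum>k\<le>n - j. of_nat (n choose j) * s ^ j * (of_nat (n - j choose k) * s ^ k * (1 - s) ^ (n - j - k)))"
  proof (rule sum.reindex_bij_witness[of _ "\<lambda>k. k + j" "\<lambda>l. l - j"])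
    fix l assume l: "l \<in> {j..n}"
    then obtain k where k: "l = j + k" by (auto simp: le_iff_add)
    have "(n choose l) * (l choose j) = (n choose j) * ((n - j) choose k)"
      using choose_mult[of j l n] l k by simp
    then have "of_nat (n choose l) * of_nat (l choose j) = (of_nat (n choose j) * of_nat (n - j choose k) :: 'a)"
      by (metis of_nat_mult)
    then show "of_nat (n choose j) * s ^ j * (of_nat (n - j choose (l - j)) * s ^ (l - j) * (1 - s) ^ (n - j - (l - j)))
       = of_nat (n choose l) * of_nat (l choose j) * s ^ l * (1 - s) ^ (n - l)"
      using k by (simp add: power_add mult_ac)
  qed (use assms in auto)
  also have "\<dots> = of_nat (n choose j) * s ^ j * (s + (1 - s)) ^ (n - j)"
    unfolding binomial_ring sum_distrib_left by (simp add: mult_ac)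
  finally show ?thesis by simp
qed

text \<open>
  The rate at which the block of a tagged label shrinks from size \<open>m\<close> to size \<open>i\<close>. The label may be in
  either part of the ordered split, which cancels the factor 2 of the splitting probabilities.
\<close>
definition tagged_rate :: "real \<Rightarrow> nat \<Rightarrow> nat \<Rightarrow> real" where
  "tagged_rate \<beta> m i = real ((m - 1) choose (i - 1)) * Beta (real i + \<beta> + 1) (real (m - i) + \<beta> + 1)"

lemma tagged_rate_nonneg:
  assumes "-2 < \<beta>" "i \<in> {1..m-1}"
  shows "tagged_rate \<beta> m i \<ge> 0"
  unfolding tagged_rate_def using assms by (intro mult_nonneg_nonneg Beta_nonneg) auto

text \<open>
  The functions \<open>m \<mapsto> (m - 1 choose j)\<close> are eigenfunctions of the generator of the tagged block size,
  with eigenvalue \<open>\<phi>\<^sub>\<beta>(j)\<close>. Under the Beta integral the rates turn into binomial probabilities with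
  success probability \<open>s\<close>, and a factorial moment replaces the binomial coefficient by \<open>s ^ j\<close> times
  itself. For \<open>j = m - 1\<close> this computes the total rate.
\<close>
lemma tagged_rate_binomial:
  assumes \<beta>: "-2 < \<beta>" "\<beta> < 0" and j: "j \<le> m - 1" and m: "m \<ge> 1"
  shows "(\<Sum>i=1..m-1. tagged_rate \<beta> m i * (real ((m - 1) choose j) - real ((i - 1) choose j)))
    = real ((m - 1) choose j) * stieltjes (\<beta> + 2) (binomial_weight \<beta>) (real j)"
proof -
  define C where "C = real ((m - 1) choose j)"
  have C: "C > 0" using j by (simp add: C_def)
  define I where "I = (\<Sum>i=1..m-1. tagged_rate \<beta> m i * (C - real ((i - 1) choose j)))"
  define g where "g = (\<lambda>s::real. (1 - s ^ j) * (s powr (\<beta> + 1) * (1 - s) powr \<beta>))"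
  let ?f = "\<lambda>s. \<Sum>i=1..m-1. (C - real ((i - 1) choose j)) * real ((m - 1) choose (i - 1)) *
         (s powr (real i + \<beta> + 1 - 1) * (1 - s) powr (real (m - i) + \<beta> + 1 - 1))"
  have int: "(?f has_integral
      (\<Sum>i=1..m-1. (C - real ((i - 1) choose j)) * real ((m - 1) choose (i - 1)) * Beta (real i + \<beta> + 1) (real (m - i) + \<beta> + 1))) {0..1}"
    using \<beta> by (intro has_integral_sum has_integral_mult_right has_integral_Beta_real) auto
  have I: "(\<Sum>i=1..m-1. (C - real ((i - 1) choose j)) * real ((m - 1) choose (i - 1)) * Beta (real i + \<beta> + 1) (real (m - i) + \<beta> + 1)) = I"
    unfolding I_def tagged_rate_def by (intro sum.cong refl) (simp add: mult_ac)
  have pt: "?f s = C * g s" if s: "s \<in> {0..1}" for s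
  proof (cases "s = 0 \<or> s = 1")
    case True
    then show ?thesis by (auto simp: g_def)
  next
    case False
    then have s: "s > 0" "1 - s > 0" using s by auto
    define n where "n = m - 1"
    define t where "t = (\<lambda>l. (C - real (l choose j)) * real (n choose l) * (s ^ l * (1 - s) ^ (n - l)))"
    have "?f s
      = (\<Sum>l<n. t l * (s powr (\<beta> + 1) * (1 - s) powr \<beta>))"
    proof (rule sum.reindex_bij_witness[of _ Suc "\<lambda>i. i - 1"])
      fix i assume i: "i \<in> {1..m-1}"
      then obtain l where l: "i = Suc l" by (cases i) auto
      have "s powr (real i + \<beta> + 1 - 1) = s powr (\<beta> + 1) * s ^ l"
        using s by (simp add: l powr_realpow[symmetric] powr_add[symmetric] algebra_simps)
      moreover have "(1 - s) powr (real (m - i) + \<beta> + 1 - 1) = (1 - s) powr \<beta> * (1 - s) ^ (n - l)"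
        using s by (simp add: l n_def powr_realpow[symmetric] powr_add[symmetric] algebra_simps)
      ultimately show "t (i - 1) * (s powr (\<beta> + 1) * (1 - s) powr \<beta>) = (C - real ((i - 1) choose j)) * real ((m - 1) choose (i - 1)) *
         (s powr (real i + \<beta> + 1 - 1) * (1 - s) powr (real (m - i) + \<beta> + 1 - 1))"
        by (simp add: t_def l n_def mult_ac)
    qed (use m in \<open>auto simp: n_def\<close>)
    also have "\<dots> = (\<Sum>l\<le>n. t l) * (s powr (\<beta> + 1) * (1 - s) powr \<beta>)"
    proof -
      \<comment> \<open>the event that all labels go to the block of the tagged one is no split and has weight 0\<close>
      have "t n = 0" by (simp add: t_def C_def n_def)
      then have "(\<Sum>l<n. t l) = (\<Sum>l\<le>n. t l)" by (simp add: lessThan_Suc_atMost[symmetric])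
      then show ?thesis by (simp add: sum_distrib_right[symmetric])
    qed
    also have "(\<Sum>l\<le>n. t l) = C * (\<Sum>l\<le>n. real (n choose l) * real (l choose 0) * s ^ l * (1 - s) ^ (n - l))
         - (\<Sum>l\<le>n. real (n choose l) * real (l choose j) * s ^ l * (1 - s) ^ (n - l))"
      unfolding t_def sum_distrib_left sum_subtractf[symmetric] by (intro sum.cong refl) (simp add: algebra_simps)
    also have "\<dots> = C * (1 - s ^ j)"
      using binomial_factorial_moment[of 0 n s] binomial_factorial_moment[of j n s] j
      by (simp add: C_def n_def algebra_simps)
    finally show ?thesis by (simp add: g_def)
  qed
  have "((\<lambda>s. C * g s) has_integral I) {0..1}"
    by (rule has_integral_eq[OF pt int[unfolded I]])
  from has_integral_mult_right[OF this, of "1 / C"] have "(g has_integral I / C) {0..1}" using C by simp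
  then have "((\<lambda>s. complex_of_real (g s)) has_integral of_real (I / C)) {0..1}" by (rule has_integral_of_real)
  moreover have "complex_of_real (g s) = (1 - of_real s powr of_nat j) * of_real (s powr (\<beta> + 1) * (1 - s) powr \<beta>)" for s
    by (cases "s = 0") (auto simp: g_def powr_nat')
  ultimately have "phi_int \<beta> (of_nat j) = of_real (I / C)" unfolding phi_int_def
    by (simp add: integral_unique)
  moreover have "phi_int \<beta> (of_nat j) = of_real (stieltjes (\<beta> + 2) (binomial_weight \<beta>) (real j))"
    using phi_int_eq_stieltjes[OF \<beta>, of "of_nat j"] stieltjes_of_real[OF weights_binomial(1)[OF \<beta>], of "real j", where 'a = complex]
    by simp
  ultimately have "I / C = stieltjes (\<beta> + 2) (binomial_weight \<beta>) (real j)" using of_real_eq_iff by metis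
  then show ?thesis using C unfolding I_def C_def by (simp add: field_simps)
qed

text \<open>
  The solution of the recursion below: expand the constant 1 in the eigenfunctions and divide each
  coefficient by the eigenvalue.
\<close>
definition mean_height :: "real \<Rightarrow> nat \<Rightarrow> real" where
  "mean_height \<beta> n = (\<Sum>j=1..n-1. (-1) ^ Suc j * real ((n - 1) choose j) / stieltjes (\<beta> + 2) (binomial_weight \<beta>) (real j))"

lemma mean_height_recursion:
  assumes \<beta>: "-2 < \<beta>" "\<beta> < 0" and m: "m \<ge> 2"
  shows "(\<Sum>i=1..m-1. tagged_rate \<beta> m i * (mean_height \<beta> m - mean_height \<beta> i)) = 1"
proof -
  define \<phi> where "\<phi> = (\<lambda>j. stieltjes (\<beta> + 2) (binomial_weight \<beta>) (real j))"
  have \<phi>: "\<phi> j > 0" if "j \<ge> 1" for j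
    unfolding \<phi>_def using that by (intro stieltjes_pos weights_binomial \<beta> binomial_weight_pos) auto
  have ext: "mean_height \<beta> i = (\<Sum>j=1..m-1. (-1) ^ Suc j * real ((i - 1) choose j) / \<phi> j)" if "i \<le> m" for i
    unfolding mean_height_def \<phi>_def using that by (intro sum.mono_neutral_left) (auto simp: binomial_eq_0)
  have "(\<Sum>i=1..m-1. tagged_rate \<beta> m i * (mean_height \<beta> m - mean_height \<beta> i)) =
    (\<Sum>i=1..m-1. \<Sum>j=1..m-1. (-1) ^ Suc j / \<phi> j * (tagged_rate \<beta> m i * (real ((m - 1) choose j) - real ((i - 1) choose j))))"
  proof (intro sum.cong refl)
    fix i assume i: "i \<in> {1..m-1}"
    then have "i \<le> m" by auto
    have "mean_height \<beta> m - mean_height \<beta> i = (\<Sum>j=1..m-1. (-1) ^ Suc j / \<phi> j * (real ((m - 1) choose j) - real ((i - 1) choose j)))"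
      unfolding ext[OF \<open>i \<le> m\<close>] ext[OF order.refl] sum_subtractf[symmetric]
      by (intro sum.cong refl) (simp add: algebra_simps diff_divide_distrib)
    then show "tagged_rate \<beta> m i * (mean_height \<beta> m - mean_height \<beta> i) = 
      (\<Sum>j=1..m-1. (-1) ^ Suc j / \<phi> j * (tagged_rate \<beta> m i * (real ((m - 1) choose j) - real ((i - 1) choose j))))"
      by (simp add: sum_distrib_left mult_ac)
  qed
  also have "\<dots> = (\<Sum>j=1..m-1. (-1) ^ Suc j / \<phi> j * (\<Sum>i=1..m-1. tagged_rate \<beta> m i * (real ((m - 1) choose j) - real ((i - 1) choose j))))"
    unfolding sum_distrib_left by (rule sum.swap)
  also have "\<dots> = (\<Sum>j=1..m-1. (-1) ^ Suc j * real ((m - 1) choose j))"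
  proof (intro sum.cong refl)
    fix j assume j: "j \<in> {1..m-1}"
    then have "(\<Sum>i=1..m-1. tagged_rate \<beta> m i * (real ((m - 1) choose j) - real ((i - 1) choose j))) = real ((m - 1) choose j) * \<phi> j"
      unfolding \<phi>_def using m by (intro tagged_rate_binomial \<beta>) auto
    then show "(-1) ^ Suc j / \<phi> j * (\<Sum>i=1..m-1. tagged_rate \<beta> m i * (real ((m - 1) choose j) - real ((i - 1) choose j)))
       = (-1) ^ Suc j * real ((m - 1) choose j)"
      using \<phi>[of j] j by simp
  qed
  also have "\<dots> = 1" using m by (intro sum_alternating_binomial_tail) auto
  finally show ?thesis .
qed

lemma split_rate_eq:
  assumes \<beta>: "-2 < \<beta>" "\<beta> < 0"
  shows "split_rate \<beta> m = stieltjes (\<beta> + 2) (binomial_weight \<beta>) (real (m - 1))"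
  using phi_int_eq_stieltjes[OF \<beta>, of "of_nat (m - 1)"] stieltjes_of_real[OF weights_binomial(1)[OF \<beta>], of "real (m - 1)", where 'a = complex]
  by (simp add: split_rate_def)

lemma split_rate_pos:
  assumes \<beta>: "-2 < \<beta>" "\<beta> < 0" and "m \<ge> 2"
  shows "split_rate \<beta> m > 0"
  unfolding split_rate_eq[OF \<beta>] using assms(3)
  by (intro stieltjes_pos weights_binomial \<beta> binomial_weight_pos) auto

lemma sum_tagged_rate:
  assumes \<beta>: "-2 < \<beta>" "\<beta> < 0" and m: "m \<ge> 1"
  shows "(\<Sum>i=1..m-1. tagged_rate \<beta> m i) = split_rate \<beta> m"
proof -
  have "(\<Sum>i=1..m-1. tagged_rate \<beta> m i) = (\<Sum>i=1..m-1. tagged_rate \<beta> m i * (real ((m - 1) choose (m - 1)) - real ((i - 1) choose (m - 1))))"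
    by (intro sum.cong refl) (auto simp: binomial_eq_0)
  also have "\<dots> = split_rate \<beta> m"
    unfolding split_rate_eq[OF \<beta>] using tagged_rate_binomial[OF \<beta> order.refl m] by simp
  finally show ?thesis .
qed

lemma mean_height_nonneg:
  assumes \<beta>: "-2 < \<beta>" "\<beta> < 0"
  shows "mean_height \<beta> m \<ge> 0"
proof (induction m rule: less_induct)
  case (less m)
  show ?case
  proof (cases "m \<ge> 2")
    case True
    have "split_rate \<beta> m * mean_height \<beta> m = 1 + (\<Sum>i=1..m-1. tagged_rate \<beta> m i * mean_height \<beta> i)"
      using mean_height_recursion[OF \<beta> True] sum_tagged_rate[OF \<beta>, of m] True
      by (simp add: right_diff_distrib sum_subtractf sum_distrib_right[symmetric])
    also have "\<dots> \<ge> 0"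
      using less.IH True tagged_rate_nonneg[OF \<beta>(1), of _ m] by (intro add_nonneg_nonneg sum_nonneg mult_nonneg_nonneg) auto
    finally show ?thesis using split_rate_pos[OF \<beta> True] by (simp add: zero_le_mult_iff)
  qed (simp add: mean_height_def)
qed

text \<open>
  A label of the block is in the first part with probability \<open>i / m\<close>. The splitting probabilities are
  symmetric in \<open>i\<close> and \<open>m - i\<close>, so the two parts contribute equally.
\<close>
lemma split_prob_size_biased:
  assumes \<beta>: "-2 < \<beta>" "\<beta> < 0" and m: "m \<ge> 2"
  shows "split_rate \<beta> m * (\<Sum>i=1..m-1. split_prob \<beta> m i * (real i / real m * f i + real (m - i) / real m * f (m - i)))
    = (\<Sum>i=1..m-1. tagged_rate \<beta> m i * f i)"
proof -
  define p where "p = (\<lambda>i. split_prob \<beta> m i * (real i / real m) * f i)"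
  have sym: "split_prob \<beta> m (m - i) = split_prob \<beta> m i" if "i \<in> {1..m-1}" for i
  proof -
    have *: "m - (m - i) = i" "m choose (m - i) = m choose i"
      using that binomial_symmetric[of i m] by auto
    show ?thesis unfolding split_prob_def * by (subst Beta_commute) (rule refl)
  qed
  have "(\<Sum>i=1..m-1. split_prob \<beta> m i * (real i / real m * f i + real (m - i) / real m * f (m - i)))
    = (\<Sum>i=1..m-1. p i) + (\<Sum>i=1..m-1. p (m - i))"
    unfolding sum.distrib[symmetric] by (intro sum.cong refl) (simp add: p_def sym algebra_simps)
  also have "(\<Sum>i=1..m-1. p (m - i)) = (\<Sum>i=1..m-1. p i)"
    by (rule sum.reindex_bij_witness[of _ "\<lambda>i. m - i" "\<lambda>i. m - i"]) auto
  also have "(\<Sum>i=1..m-1. p i) + (\<Sum>i=1..m-1. p i) = (\<Sum>i=1..m-1. tagged_rate \<beta> m i * f i) / split_rate \<beta> m"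
    unfolding sum.distrib[symmetric] sum_divide_distrib
  proof (intro sum.cong refl)
    fix i assume "i \<in> {1..m-1}"
    then obtain l where l: "i = Suc l" by (cases i) auto
    obtain n where n: "m = Suc n" using m by (cases m) auto
    have "real (Suc l) * real (Suc n choose Suc l) = real (Suc n) * real (n choose l)"
      using Suc_times_binomial_eq[of n l] by (metis of_nat_mult mult.commute)
    then have "real (m choose i) * (real i / real m) = real ((m - 1) choose (i - 1))"
      unfolding l n by (simp add: field_simps del: of_nat_Suc binomial_Suc_Suc)
    then have "tagged_rate \<beta> m i = real (m choose i) * (real i / real m) * Beta (real i + \<beta> + 1) (real (m - i) + \<beta> + 1)"
      unfolding tagged_rate_def by simp
    then show "p i + p i = tagged_rate \<beta> m i * f i / split_rate \<beta> m"
      unfolding p_def split_prob_def using split_rate_pos[OF \<beta> m] by (simp add: field_simps)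
  qed
  finally show ?thesis using split_rate_pos[OF \<beta> m] by simp
qed

lemma sum_split_prob:
  assumes \<beta>: "-2 < \<beta>" "\<beta> < 0" and m: "m \<ge> 2"
  shows "(\<Sum>i=1..m-1. split_prob \<beta> m i) = 1"
proof -
  have "(\<Sum>i=1..m-1. split_prob \<beta> m i) = (\<Sum>i=1..m-1. split_prob \<beta> m i * (real i / real m * 1 + real (m - i) / real m * 1))"
    using m by (intro sum.cong refl) (auto simp: add_divide_distrib[symmetric] of_nat_diff)
  then have "split_rate \<beta> m * (\<Sum>i=1..m-1. split_prob \<beta> m i) = split_rate \<beta> m"
    using split_prob_size_biased[OF \<beta> m, of "\<lambda>_. 1"] sum_tagged_rate[OF \<beta>, of m] m by simp
  then show ?thesis using split_rate_pos[OF \<beta> m] by simp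
qed

lemma mean_height_split:
  assumes \<beta>: "-2 < \<beta>" "\<beta> < 0" and m: "m \<ge> 2"
  shows "split_rate \<beta> m * ((\<Sum>i=1..m-1. split_prob \<beta> m i * (real i / real m * mean_height \<beta> i
      + real (m - i) / real m * mean_height \<beta> (m - i))) - mean_height \<beta> m) = - 1"
  using split_prob_size_biased[OF \<beta> m, of "mean_height \<beta>"] mean_height_recursion[OF \<beta> m] sum_tagged_rate[OF \<beta>, of m] m
  by (simp add: right_diff_distrib sum_subtractf sum_distrib_right[symmetric])

section \<open>Semigroups of finite generator matrices\<close>

definition gen_apply :: "'s set \<Rightarrow> ('s \<Rightarrow> 's \<Rightarrow> real) \<Rightarrow> ('s \<Rightarrow> real) \<Rightarrow> 's \<Rightarrow> real" where
  "gen_apply S Q f x = (\<Sum>y\<in>S. Q x y * f y)"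

definition semigroup_apply :: "'s set \<Rightarrow> ('s \<Rightarrow> 's \<Rightarrow> real) \<Rightarrow> real \<Rightarrow> ('s \<Rightarrow> real) \<Rightarrow> 's \<Rightarrow> real" where
  "semigroup_apply S Q t f x = (\<Sum>y\<in>S. transition S Q t x y * f y)"

lemma sum_gen_power:
  assumes "finite S" "x \<in> S"
  shows "(\<Sum>y\<in>S. gen_power S Q k x y * f y) = (gen_apply S Q ^^ k) f x"
  using assms(2)
proof (induction k arbitrary: x)
  case 0
  then show ?case using assms(1) by (simp add: of_bool_def if_distrib[of "\<lambda>c. c * _"] cong: if_cong)
next
  case (Suc k)
  have "(\<Sum>y\<in>S. gen_power S Q (Suc k) x y * f y) = (\<Sum>y\<in>S. \<Sum>z\<in>S. Q x z * (gen_power S Q k z y * f y))"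
    by (simp add: sum_distrib_right mult.assoc)
  also have "\<dots> = (\<Sum>z\<in>S. Q x z * (\<Sum>y\<in>S. gen_power S Q k z y * f y))"
    unfolding sum_distrib_left by (rule sum.swap)
  also have "\<dots> = (\<Sum>z\<in>S. Q x z * (gen_apply S Q ^^ k) f z)"
    using Suc.IH by (intro sum.cong) auto
  finally show ?case by (simp add: gen_apply_def[of S Q "(gen_apply S Q ^^ k) f"])
qed

lemma gen_apply_power_bound:
  assumes "finite S" "x \<in> S"
  shows "\<bar>(gen_apply S Q ^^ k) f x\<bar> \<le> (\<Sum>x\<in>S. \<Sum>y\<in>S. \<bar>Q x y\<bar>) ^ k * (\<Sum>y\<in>S. \<bar>f y\<bar>)"
  using assms(2)
proof (induction k arbitrary: x)
  case 0
  then show ?case using assms(1) member_le_sum[of x S "\<lambda>y. \<bar>f y\<bar>"] by simp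
next
  case (Suc k)
  let ?C = "\<Sum>x\<in>S. \<Sum>y\<in>S. \<bar>Q x y\<bar>" and ?F = "\<Sum>y\<in>S. \<bar>f y\<bar>"
  have "\<bar>(gen_apply S Q ^^ Suc k) f x\<bar> \<le> (\<Sum>y\<in>S. \<bar>Q x y * (gen_apply S Q ^^ k) f y\<bar>)"
    by (simp add: gen_apply_def sum_abs)
  also have "\<dots> \<le> (\<Sum>y\<in>S. \<bar>Q x y\<bar> * (?C ^ k * ?F))"
    unfolding abs_mult by (intro sum_mono mult_left_mono Suc.IH) auto
  also have "\<dots> = (\<Sum>y\<in>S. \<bar>Q x y\<bar>) * (?C ^ k * ?F)" by (simp add: sum_distrib_right)
  also have "\<dots> \<le> ?C * (?C ^ k * ?F)"
    using Suc.prems assms(1) member_le_sum[of x S "\<lambda>x. \<Sum>y\<in>S. \<bar>Q x y\<bar>"]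
    by (intro mult_right_mono mult_nonneg_nonneg zero_le_power sum_nonneg) auto
  finally show ?case by (simp add: mult.assoc)
qed

lemma summable_gen_apply_power:
  assumes "finite S" "x \<in> S"
  shows "summable (\<lambda>k. (gen_apply S Q ^^ k) f x / fact k * (t::real) ^ k)"
proof (rule summable_comparison_test'[where N = 0])
  let ?C = "\<Sum>x\<in>S. \<Sum>y\<in>S. \<bar>Q x y\<bar>" and ?F = "\<Sum>y\<in>S. \<bar>f y\<bar>"
  show "summable (\<lambda>k. inverse (fact k) * (?C * \<bar>t\<bar>) ^ k * ?F)"
    by (intro summable_mult2 summable_exp)
  fix k :: nat
  have "\<bar>(gen_apply S Q ^^ k) f x\<bar> / fact k * \<bar>t\<bar> ^ k \<le> (?C ^ k * ?F) / fact k * \<bar>t\<bar> ^ k"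
    by (intro mult_right_mono divide_right_mono gen_apply_power_bound assms) auto
  then show "norm ((gen_apply S Q ^^ k) f x / fact k * t ^ k) \<le> inverse (fact k) * (?C * \<bar>t\<bar>) ^ k * ?F"
    by (simp add: abs_mult power_abs power_mult_distrib divide_inverse mult_ac)
qed

text \<open>
  Brings the semigroup into the form of a power series in \<open>t\<close>, which can be differentiated
  termwise.
\<close>
lemma semigroup_apply_series:
  assumes S: "finite S" "x \<in> S"
  shows "semigroup_apply S Q t f x = (\<Sum>k. (gen_apply S Q ^^ k) f x / fact k * t ^ k)"
proof -
  have gp: "gen_power S Q k x y = (gen_apply S Q ^^ k) (\<lambda>z. of_bool (z = y)) x" if "y \<in> S" for y k
    using sum_gen_power[OF S, of Q k "\<lambda>z. of_bool (z = y)"] that S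
    by (simp add: of_bool_def if_distrib[of "\<lambda>c. _ * c"] cong: if_cong)
  have sm: "summable (\<lambda>k. t ^ k / fact k * gen_power S Q k x y * f y)" if "y \<in> S" for y
    using summable_mult2[OF summable_gen_apply_power[OF S, of Q "\<lambda>z. of_bool (z = y)" t], of "f y"]
    unfolding gp[OF that] by (simp add: mult_ac)
  have sm': "summable (\<lambda>k. t ^ k / fact k * gen_power S Q k x y)" if "y \<in> S" for y
    using summable_gen_apply_power[OF S, of Q "\<lambda>z. of_bool (z = y)" t]
    unfolding gp[OF that] by (simp add: mult_ac)
  have "semigroup_apply S Q t f x = (\<Sum>y\<in>S. \<Sum>k. t ^ k / fact k * gen_power S Q k x y * f y)"
    unfolding semigroup_apply_def transition_def by (intro sum.cong refl suminf_mult2 sm')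
  also have "\<dots> = (\<Sum>k. \<Sum>y\<in>S. t ^ k / fact k * gen_power S Q k x y * f y)"
    by (intro suminf_sum[symmetric] sm)
  also have "\<dots> = (\<Sum>k. (gen_apply S Q ^^ k) f x / fact k * t ^ k)"
    unfolding sum_gen_power[OF S, symmetric] by (intro suminf_cong) (simp add: sum_distrib_left sum_divide_distrib sum_distrib_right mult_ac)
  finally show ?thesis .
qed

lemma semigroup_apply_0:
  assumes S: "finite S" "x \<in> S"
  shows "semigroup_apply S Q 0 f x = f x"
  unfolding semigroup_apply_series[OF S] using powser_zero[of "\<lambda>k. (gen_apply S Q ^^ k) f x / fact k"] by simp

lemma semigroup_apply_cong:
  "(\<And>y. y \<in> S \<Longrightarrow> f y = g y) \<Longrightarrow> semigroup_apply S Q t f x = semigroup_apply S Q t g x"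
  unfolding semigroup_apply_def by (intro sum.cong) auto

lemma semigroup_apply_deriv:
  assumes S: "finite S" "x \<in> S"
  shows "((\<lambda>t. semigroup_apply S Q t f x) has_real_derivative semigroup_apply S Q t (gen_apply S Q f) x) (at t)"
proof -
  define c where "c = (\<lambda>k. (gen_apply S Q ^^ k) f x / fact k)"
  have "((\<lambda>t. \<Sum>k. c k * t ^ k) has_real_derivative (\<Sum>k. diffs c k * t ^ k)) (at t)"
    by (rule termdiffs_strong_converges_everywhere) (simp only: c_def summable_gen_apply_power[OF S])
  moreover have "diffs c k = (gen_apply S Q ^^ k) (gen_apply S Q f) x / fact k" for k
    by (simp add: diffs_def c_def funpow_swap1[symmetric] del: of_nat_Suc)
  ultimately show ?thesis by (simp add: semigroup_apply_series[OF S] c_def)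
qed

text \<open>
  If the generator preserves the functions that vanish on \<open>K\<close>, so do its powers; in particular the
  indicator function of a state outside \<open>K\<close> never acquires mass on \<open>K\<close>.
\<close>
lemma transition_zero:
  assumes S: "finite S" "x \<in> S" "y \<in> S" and K: "x \<in> K" "y \<notin> K"
    and absorb: "\<And>f z. (\<And>z. z \<in> S \<Longrightarrow> z \<in> K \<Longrightarrow> f z = 0) \<Longrightarrow> z \<in> S \<Longrightarrow> z \<in> K \<Longrightarrow> gen_apply S Q f z = 0"
  shows "transition S Q t x y = 0"
proof -
  have "(gen_apply S Q ^^ k) (\<lambda>z. of_bool (z = y)) z = 0" if "z \<in> S" "z \<in> K" for z k
    using that
  proof (induction k arbitrary: z)
    case 0
    then show ?case using K by auto
  next
    case (Suc k)
    then show ?case using absorb[of "(gen_apply S Q ^^ k) (\<lambda>z. of_bool (z = y))" z] by simp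
  qed
  then have "gen_power S Q k x y = 0" for k
    using sum_gen_power[OF S(1,2), of Q k "\<lambda>z. of_bool (z = y)"] S K
    by (simp add: of_bool_def if_distrib[of "\<lambda>c. _ * c"] cong: if_cong)
  then show ?thesis by (simp add: transition_def)
qed

section \<open>The generator of the splitting tree\<close>

lemma finite_partitions: "finite A \<Longrightarrow> finite {P. partition_on A P}"
  by (rule finite_subset[of _ "Pow (Pow A)"]) (auto simp: partition_on_def)

lemma split_block_partition:
  assumes P: "partition_on X P" and "B \<in> P" "A \<subseteq> B" "A \<noteq> {}" "A \<noteq> B"
  shows "partition_on X (split_block P B A)"
  unfolding partition_on_def
proof (intro conjI)
  show "\<Union> (split_block P B A) = X"
    using P assms(2,3) by (auto simp: split_block_def partition_on_def)
  show "disjoint (split_block P B A)"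
    using P assms(2,3) unfolding split_block_def partition_on_def disjoint_def by (auto; blast)
  show "{} \<notin> split_block P B A"
    using P assms by (auto simp: split_block_def partition_on_def)
qed

lemma gen_apply_split_generator:
  assumes "partition_on {1..n} P"
  shows "gen_apply {P. partition_on {1..n} P} (split_generator \<beta>) f P =
    (\<Sum>B | B \<in> P \<and> card B \<ge> 2. split_rate \<beta> (card B) *
       ((\<Sum>i=1..card B - 1. split_prob \<beta> (card B) i * (\<Sum>A | A \<subseteq> B \<and> card A = i. f (split_block P B A) / real (card B choose i))) - f P))"
proof -
  let ?mean = "\<lambda>B. \<Sum>i=1..card B - 1. split_prob \<beta> (card B) i * (\<Sum>A | A \<subseteq> B \<and> card A = i. f (split_block P B A) / real (card B choose i))"
  let ?at = "\<lambda>P' B i. \<Sum>A | A \<subseteq> B \<and> card A = i. of_bool (split_block P B A = P') * f P' / real (card B choose i)"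
  let ?S = "{P. partition_on {1..n} P}"
  have fin: "finite ?S" by (intro finite_partitions) auto
  have "gen_apply ?S (split_generator \<beta>) f P = (\<Sum>B | B \<in> P \<and> card B \<ge> 2. \<Sum>P'\<in>?S. 
      split_rate \<beta> (card B) * (split_kernel \<beta> P B P' - of_bool (P' = P)) * f P')"
    unfolding gen_apply_def split_generator_def sum_distrib_right by (rule sum.swap)
  also have "\<dots> = (\<Sum>B | B \<in> P \<and> card B \<ge> 2. split_rate \<beta> (card B) *
       (?mean B - f P))"
  proof (intro sum.cong refl)
    fix B assume B: "B \<in> {B. B \<in> P \<and> card B \<ge> 2}"
    have "(\<Sum>P'\<in>?S. of_bool (P' = P) * f P') = f P"
      using assms fin by (simp add: of_bool_def if_distrib[of "\<lambda>c. c * _"] cong: if_cong)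
    moreover have "(\<Sum>P'\<in>?S. split_kernel \<beta> P B P' * f P') =
      ?mean B"
    proof -
      have "(\<Sum>P'\<in>?S. split_kernel \<beta> P B P' * f P') = (\<Sum>P'\<in>?S. \<Sum>i=1..card B - 1. split_prob \<beta> (card B) i * 
         ?at P' B i)"
        unfolding split_kernel_def by (simp add: sum_distrib_right sum_distrib_left mult_ac)
      also have "\<dots> = (\<Sum>i=1..card B - 1. split_prob \<beta> (card B) i * (\<Sum>P'\<in>?S. 
         ?at P' B i))"
        by (subst sum.swap) (simp add: sum_distrib_left)
      also have "\<dots> = ?mean B"
      proof (intro sum.cong refl arg_cong2[where f = "(*)"])
        fix i assume i: "i \<in> {1..card B - 1}"
        have "(\<Sum>P'\<in>?S. ?at P' B i)
          = (\<Sum>A | A \<subseteq> B \<and> card A = i. (\<Sum>P'\<in>?S. of_bool (split_block P B A = P') * f P' / real (card B choose i)))"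
          by (rule sum.swap)
        also have "\<dots> = (\<Sum>A | A \<subseteq> B \<and> card A = i. f (split_block P B A) / real (card B choose i))"
        proof (intro sum.cong refl)
          fix A assume A: "A \<in> {A. A \<subseteq> B \<and> card A = i}"
          then have "A \<noteq> {}" "A \<noteq> B" using i by auto
          then have "split_block P B A \<in> ?S"
            using split_block_partition[OF assms, of B A] A B by auto
          then show "(\<Sum>P'\<in>?S. of_bool (split_block P B A = P') * f P' / real (card B choose i)) = f (split_block P B A) / real (card B choose i)"
            using fin by (simp add: of_bool_def if_distrib[of "\<lambda>c. c * _ / _"] cong: if_cong)
        qed
        finally show "(\<Sum>P'\<in>?S. ?at P' B i)
          = (\<Sum>A | A \<subseteq> B \<and> card A = i. f (split_block P B A) / real (card B choose i))" .
      qed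
      finally show ?thesis .
    qed
    ultimately show "(\<Sum>P'\<in>?S. split_rate \<beta> (card B) * (split_kernel \<beta> P B P' - of_bool (P' = P)) * f P') =
      split_rate \<beta> (card B) *
       (?mean B - f P)"
      by (simp add: mult.assoc sum_distrib_left[symmetric] left_diff_distrib sum_subtractf)
  qed
  finally show ?thesis .
qed

text \<open>
  Only blocks with at least two elements split, so the block \<open>{u}\<close> is never touched.
\<close>
lemma singleton_absorbing:
  assumes P: "partition_on {1..n} P" "{u} \<in> P" and f: "\<And>P. partition_on {1..n} P \<Longrightarrow> {u} \<in> P \<Longrightarrow> f P = 0"
  shows "gen_apply {P. partition_on {1..n} P} (split_generator \<beta>) f P = 0"
  unfolding gen_apply_split_generator[OF P(1)]
proof (intro sum.neutral ballI)
  fix B assume B: "B \<in> {B. B \<in> P \<and> 2 \<le> card B}"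
  have "f (split_block P B A) = 0" if "i \<in> {1..card B - 1}" "A \<in> {A. A \<subseteq> B \<and> card A = i}" for i A
  proof (rule f)
    have "A \<noteq> {}" "A \<noteq> B" using that by auto
    then show "partition_on {1..n} (split_block P B A)" using P B that by (intro split_block_partition) auto
    have "B \<noteq> {u}" using B by auto
    then show "{u} \<in> split_block P B A" using P(2) by (auto simp: split_block_def)
  qed
  then have "(\<Sum>i=1..card B - 1. split_prob \<beta> (card B) i * (\<Sum>A | A \<subseteq> B \<and> card A = i. f (split_block P B A) / real (card B choose i))) = 0"
    by (intro sum.neutral ballI) (simp add: sum.neutral)
  then show "split_rate \<beta> (card B) *
       ((\<Sum>i=1..card B - 1. split_prob \<beta> (card B) i * (\<Sum>A | A \<subseteq> B \<and> card A = i. f (split_block P B A) / real (card B choose i))) - f P) = 0"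
    using f[OF P] by simp
qed

text \<open>
  The value of \<open>h\<close> at the size of the block of \<open>u\<close>. As a sum over all blocks it changes under a split
  only by the summands of the blocks involved.
\<close>
definition block_stat :: "nat \<Rightarrow> (nat \<Rightarrow> real) \<Rightarrow> nat set set \<Rightarrow> real" where
  "block_stat u h P = (\<Sum>B\<in>P. of_bool (u \<in> B) * h (card B))"

lemma block_stat_split:
  assumes P: "partition_on {1..n} P" and B: "B \<in> P" and A: "A \<subseteq> B" "A \<noteq> {}" "A \<noteq> B"
  shows "block_stat u h (split_block P B A) = block_stat u h P
    + of_bool (u \<in> A) * h (card A) + of_bool (u \<in> B - A) * h (card B - card A) - of_bool (u \<in> B) * h (card B)"
proof -
  have fin: "finite P" using P finite_elements[of "{1..n}" P] by simp
  have finB: "finite B" using P B by (metis finite_atLeastAtMost partition_on_def Sup_upper finite_subset)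
  have dis: "C \<inter> B = {}" if "C \<in> P - {B}" for C
    using P B that by (auto simp: partition_on_def disjoint_def)
  have ne: "{} \<notin> P" using P by (simp add: partition_on_def)
  have 1: "A \<notin> P - {B}" using dis[of A] A by auto
  have 2: "B - A \<notin> P - {B}" using dis[of "B - A"] A by auto
  have 3: "A \<noteq> B - A" using A by auto
  have "block_stat u h (split_block P B A) = of_bool (u \<in> A) * h (card A) + (of_bool (u \<in> B - A) * h (card (B - A))
     + (\<Sum>C\<in>P - {B}. of_bool (u \<in> C) * h (card C)))"
    unfolding block_stat_def split_block_def using 1 2 3 fin by (subst sum.insert; auto)+
  moreover have "block_stat u h P = of_bool (u \<in> B) * h (card B) + (\<Sum>C\<in>P - {B}. of_bool (u \<in> C) * h (card C))"
    unfolding block_stat_def using B fin by (rule sum.remove[rotated])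
  moreover have "card (B - A) = card B - card A" using A finB by (intro card_Diff_subset) (auto intro: finite_subset)
  ultimately show ?thesis by simp
qed

lemma card_subsets_containing:
  assumes "finite B" "u \<in> B" "i \<ge> 1"
  shows "card {A. A \<subseteq> B \<and> card A = i \<and> u \<in> A} = (card B - 1) choose (i - 1)"
proof -
  have "card {A. A \<subseteq> B \<and> card A = i \<and> u \<in> A} = card {A. A \<subseteq> B - {u} \<and> card A = i - 1}"
  proof (rule bij_betw_same_card[of "\<lambda>A. A - {u}"], rule bij_betw_byWitness[of _ "insert u"])
    show "(\<lambda>A. A - {u}) ` {A. A \<subseteq> B \<and> card A = i \<and> u \<in> A} \<subseteq> {A. A \<subseteq> B - {u} \<and> card A = i - 1}"
      by (auto simp: card_Diff_singleton)
    show "insert u ` {A. A \<subseteq> B - {u} \<and> card A = i - 1} \<subseteq> {A. A \<subseteq> B \<and> card A = i \<and> u \<in> A}"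
    proof safe
      fix A assume A: "A \<subseteq> B - {u}" "card A = i - 1"
      then have "finite A" "u \<notin> A" using assms finite_subset by auto
      then show "card (insert u A) = i" using A assms by simp
    qed (use assms in auto)
  qed auto
  also have "\<dots> = (card (B - {u})) choose (i - 1)" using assms by (intro n_subsets) auto
  finally show ?thesis using assms by simp
qed

text \<open>
  A uniformly chosen subset of size \<open>i\<close> of a block contains a given label of the block with probability
  \<open>i\<close> divided by the size of the block.
\<close>
lemma block_stat_mean_split:
  assumes P: "partition_on {1..n} P" and B: "B \<in> P" and i: "i \<in> {1..card B - 1}"
  shows "(\<Sum>A | A \<subseteq> B \<and> card A = i. block_stat u h (split_block P B A) / real (card B choose i))
    = block_stat u h P + of_bool (u \<in> B) * (real i / real (card B) * h i + real (card B - i) / real (card B) * h (card B - i) - h (card B))"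
proof -
  define m where "m = card B"
  have finB: "finite B" using P B by (metis finite_atLeastAtMost partition_on_def Sup_upper finite_subset)
  let ?T = "{A. A \<subseteq> B \<and> card A = i}"
  have finT: "finite ?T" using finB by simp
  have cT: "card ?T = m choose i" unfolding m_def using finB by (rule n_subsets)
  have i': "1 \<le> i \<and> i \<le> m - 1" using i by (simp add: m_def)
  have m2: "m \<ge> 2" "i \<le> m" "i \<ge> 1" using i' by linarith+
  have c0: "real (m choose i) > 0" using m2 by simp
  have bs: "block_stat u h (split_block P B A) = (block_stat u h P - of_bool (u \<in> B) * h m + of_bool (u \<in> B) * h (m - i))
     + of_bool (u \<in> A) * (h i - h (m - i))" if "A \<in> ?T" for A
  proof -
    have A: "A \<subseteq> B" "A \<noteq> {}" "A \<noteq> B" "card A = i" using that i by auto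
    show ?thesis using block_stat_split[OF P B A(1-3), of u h] A by (auto simp: m_def of_bool_def)
  qed
  have cu: "(\<Sum>A\<in>?T. of_bool (u \<in> A)) = of_bool (u \<in> B) * real (m choose i) * (real i / real m)"
  proof (cases "u \<in> B")
    case True
    have "(\<Sum>A\<in>?T. of_bool (u \<in> A)) = real (card {A. A \<subseteq> B \<and> card A = i \<and> u \<in> A})"
      using finT by (simp add: of_bool_def sum.If_cases Int_def conj_assoc)
    also have "\<dots> = real ((m - 1) choose (i - 1))"
      using card_subsets_containing[OF finB True] m2 by (simp add: m_def)
    also have "\<dots> = real (m choose i) * (real i / real m)"
    proof -
      obtain l k where l: "i = Suc l" "m = Suc k" using m2 by (metis Suc_le_D one_le_numeral order_trans Suc_1 One_nat_def)
      have "real (Suc l) * real (Suc k choose Suc l) = real (Suc k) * real (k choose l)"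
        using Suc_times_binomial_eq[of k l] by (metis of_nat_mult mult.commute)
      then show ?thesis unfolding l by (simp add: field_simps del: of_nat_Suc binomial_Suc_Suc)
    qed
    finally show ?thesis using True by simp
  next
    case False
    then show ?thesis by (auto intro!: sum.neutral)
  qed
  have "(\<Sum>A\<in>?T. block_stat u h (split_block P B A) / real (m choose i)) = 
     (\<Sum>A\<in>?T. (block_stat u h P - of_bool (u \<in> B) * h m + of_bool (u \<in> B) * h (m - i)) + of_bool (u \<in> A) * (h i - h (m - i))) / real (m choose i)"
    unfolding sum_divide_distrib by (intro sum.cong refl) (simp add: bs)
  also have "\<dots> = (block_stat u h P - of_bool (u \<in> B) * h m + of_bool (u \<in> B) * h (m - i)) + of_bool (u \<in> B) * (real i / real m) * (h i - h (m - i))"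
    unfolding sum.distrib sum_distrib_right[symmetric] cu using c0 by (simp add: cT add_divide_distrib)
  also have "\<dots> = block_stat u h P + of_bool (u \<in> B) * (real i / real m * h i + real (m - i) / real m * h (m - i) - h m)"
    using m2 by (simp add: of_nat_diff field_simps)
  finally show ?thesis by (simp add: m_def)
qed

lemma block_stat_eq:
  assumes P: "partition_on {1..n} P" and u: "u \<in> B" "B \<in> P"
  shows "block_stat u h P = h (card B)"
proof -
  have fin: "finite P" using P finite_elements[of "{1..n}" P] by simp
  have "u \<notin> C" if "C \<in> P - {B}" for C
    using P u that by (auto simp: partition_on_def disjoint_def)
  then show ?thesis unfolding block_stat_def using fin u by (subst sum.remove[of _ B]) (auto intro!: sum.neutral)
qed

text \<open>
  By the recursion for the mean height, the statistic decreases on average at rate 1 as long as \<open>u\<close> is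
  not isolated.
\<close>
lemma gen_apply_block_stat:
  assumes \<beta>: "-2 < \<beta>" "\<beta> < 0" and P: "partition_on {1..n} P" and u: "u \<in> {1..n}"
  shows "gen_apply {P. partition_on {1..n} P} (split_generator \<beta>) (block_stat u (mean_height \<beta>)) P = - of_bool ({u} \<notin> P)"
proof -
  let ?h = "mean_height \<beta>"
  have fin: "finite P" using P finite_elements[of "{1..n}" P] by simp
  obtain D where D: "D \<in> P" "u \<in> D" using P u by (metis UnionE partition_on_def)
  have finD: "finite D" using P D by (metis finite_atLeastAtMost partition_on_def Sup_upper finite_subset)
  have uniq: "C = D" if "C \<in> P" "u \<in> C" for C using P D that by (auto simp: partition_on_def disjoint_def)
  have "gen_apply {P. partition_on {1..n} P} (split_generator \<beta>) (block_stat u ?h) P =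
    (\<Sum>B | B \<in> P \<and> card B \<ge> 2. - of_bool (u \<in> B))"
    unfolding gen_apply_split_generator[OF P]
  proof (intro sum.cong refl)
    fix B assume B: "B \<in> {B. B \<in> P \<and> card B \<ge> 2}"
    let ?m = "card B"
    let ?d = "\<lambda>i. real i / real ?m * ?h i + real (?m - i) / real ?m * ?h (?m - i)"
    have "(\<Sum>i=1..?m - 1. split_prob \<beta> ?m i * (\<Sum>A | A \<subseteq> B \<and> card A = i. block_stat u ?h (split_block P B A) / real (?m choose i)))
      = (\<Sum>i=1..?m - 1. split_prob \<beta> ?m i * (block_stat u ?h P + of_bool (u \<in> B) * (?d i - ?h ?m)))"
      using B by (intro sum.cong refl) (simp add: block_stat_mean_split[OF P])
    also have "\<dots> = (\<Sum>i=1..?m - 1. split_prob \<beta> ?m i) * (block_stat u ?h P - of_bool (u \<in> B) * ?h ?m) + of_bool (u \<in> B) * (\<Sum>i=1..?m - 1. split_prob \<beta> ?m i * ?d i)"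
      unfolding sum_distrib_left sum_distrib_right sum.distrib[symmetric] by (intro sum.cong refl) (simp add: algebra_simps)
    also have "\<dots> = block_stat u ?h P + of_bool (u \<in> B) * ((\<Sum>i=1..?m - 1. split_prob \<beta> ?m i * ?d i) - ?h ?m)"
      using B sum_split_prob[OF \<beta>, of ?m] by (simp add: algebra_simps)
    finally show "split_rate \<beta> ?m * ((\<Sum>i=1..?m - 1. split_prob \<beta> ?m i * (\<Sum>A | A \<subseteq> B \<and> card A = i. block_stat u ?h (split_block P B A) / real (?m choose i)))
       - block_stat u ?h P) = - of_bool (u \<in> B)"
      using B mean_height_split[OF \<beta>, of ?m] by (simp add: of_bool_def)
  qed
  also have "\<dots> = - of_bool ({u} \<notin> P)"
  proof (cases "card D \<ge> 2")
    case True
    then have "{u} \<notin> P" using uniq[of "{u}"] by auto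
    have "(\<Sum>B | B \<in> P \<and> card B \<ge> 2. - of_bool (u \<in> B)) = (\<Sum>B\<in>{D}. - of_bool (u \<in> B) :: real)"
    proof (rule sum.mono_neutral_right)
      show "\<forall>B\<in>{B \<in> P. 2 \<le> card B} - {D}. - of_bool (u \<in> B) = (0 :: real)" by (auto dest: uniq)
    qed (use fin D True in auto)
    with \<open>{u} \<notin> P\<close> D show ?thesis by simp
  next
    case False
    moreover have "card D \<noteq> 0" using D finD by auto
    ultimately have "card D = 1" by linarith
    then have "D = {u}" using D by (metis card_1_singletonE singletonD)
    moreover have "(\<Sum>B | B \<in> P \<and> card B \<ge> 2. - of_bool (u \<in> B)) = (0::real)"
    proof (intro sum.neutral ballI)
      fix B assume "B \<in> {B. B \<in> P \<and> card B \<ge> 2}"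
      then show "- of_bool (u \<in> B) = (0 :: real)" using uniq[of B] False by auto
    qed
    ultimately show ?thesis using D by simp
  qed
  finally show ?thesis .
qed

section \<open>The height of a uniform leaf\<close>

text \<open>
  The Markov property says nothing about states of probability 0, but for those both sides vanish.
\<close>
lemma ctmc_two_times:
  assumes c: "ctmc M S Q x0 X" and st: "0 \<le> s" "s \<le> t" and xy: "x \<in> S" "y \<in> S"
  shows "measure M {\<omega> \<in> space M. X s \<omega> = x \<and> X t \<omega> = y}
    = measure M {\<omega> \<in> space M. X s \<omega> = x} * transition S Q (t - s) x y"
proof -
  interpret prob_space M using c by (simp add: ctmc_def)
  have X: "X r \<in> measurable M (count_space S)" if "r \<ge> 0" for r using c that by (simp add: ctmc_def)
  note [measurable] = X[OF st(1)] X[OF order.trans[OF st]]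
  \<comment> \<open>the Markov property for the single past time \<open>s\<close> (\<open>k = 0\<close>)\<close>
  define ti where "ti = (\<lambda>i::nat. if i = 0 then s else t)"
  define xi where "xi = (\<lambda>i::nat. if i = 0 then x else y)"
  show ?thesis
  proof (cases "measure M {\<omega> \<in> space M. X s \<omega> = x} > 0")
    case True
    have markov: "\<forall>k (t :: nat \<Rightarrow> real) x.
        0 \<le> t 0 \<longrightarrow> (\<forall>i\<le>k. t i \<le> t (Suc i)) \<longrightarrow> (\<forall>i\<le>Suc k. x i \<in> S) \<longrightarrow>
        \<P>(\<omega> in M. \<forall>i\<le>k. X (t i) \<omega> = x i) > 0 \<longrightarrow>
        \<P>(\<omega> in M. X (t (Suc k)) \<omega> = x (Suc k) \<bar> \<forall>i\<le>k. X (t i) \<omega> = x i) =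
          transition S Q (t (Suc k) - t k) (x k) (x (Suc k))"
      using c by (simp add: ctmc_def)
    have "\<P>(\<omega> in M. X t \<omega> = y \<bar> X s \<omega> = x) = transition S Q (t - s) x y"
      using markov[rule_format, of ti 0 xi] st xy True by (simp add: ti_def xi_def)
    then show ?thesis using True by (simp add: cond_prob_def field_simps conj_commute)
  next
    case False
    then have 0: "measure M {\<omega> \<in> space M. X s \<omega> = x} = 0" by (simp add: zero_less_measure_iff)
    have "measure M {\<omega> \<in> space M. X s \<omega> = x \<and> X t \<omega> = y} \<le> measure M {\<omega> \<in> space M. X s \<omega> = x}"
      by (intro finite_measure_mono) auto
    then show ?thesis using 0 by (simp add: measure_le_0_iff)
  qed
qed

lemma ctmc_marginal:
  assumes c: "ctmc M S Q x0 X" and t: "0 \<le> t" and y: "y \<in> S"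
  shows "measure M {\<omega> \<in> space M. X t \<omega> = y} = transition S Q t x0 y"
proof -
  interpret prob_space M using c by (simp add: ctmc_def)
  have X: "X r \<in> measurable M (count_space S)" if "r \<ge> 0" for r using c that by (simp add: ctmc_def)
  note [measurable] = X[of 0] X[OF t]
  have ae: "AE \<omega> in M. X 0 \<omega> = x0" and x0: "x0 \<in> S" using c by (auto simp: ctmc_def)
  have "measure M {\<omega> \<in> space M. X 0 \<omega> = x0} = 1"
    using ae by (intro prob_Collect_eq_1[THEN iffD2]) auto
  moreover have "measure M {\<omega> \<in> space M. X 0 \<omega> = x0 \<and> X t \<omega> = y} = measure M {\<omega> \<in> space M. X t \<omega> = y}"
    using ae by (intro measure_eq_AE) auto
  ultimately show ?thesis using ctmc_two_times[OF c order.refl t x0 y] by simp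
qed

lemma ctmc_state:
  assumes "ctmc M S Q x0 X" "0 \<le> t" "\<omega> \<in> space M"
  shows "X t \<omega> \<in> S"
proof -
  have "X t \<in> measurable M (count_space S)" using assms by (simp add: ctmc_def)
  from measurable_space[OF this assms(3)] show ?thesis by simp
qed

lemma ctmc_prob_in:
  assumes c: "ctmc M S Q x0 X" and t: "0 \<le> t" 
  shows "measure M {\<omega> \<in> space M. X t \<omega> \<in> K} = semigroup_apply S Q t (\<lambda>P. of_bool (P \<in> K)) x0"
proof -
  interpret prob_space M using c by (simp add: ctmc_def)
  have S: "finite S" using c by (simp add: ctmc_def)
  have X: "X t \<in> measurable M (count_space S)" using c t by (simp add: ctmc_def)
  note [measurable] = X
  have "{\<omega> \<in> space M. X t \<omega> \<in> K} = (\<Union>y\<in>S \<inter> K. {\<omega> \<in> space M. X t \<omega> = y})"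
    using ctmc_state[OF c t] by auto
  also have "measure M \<dots> = (\<Sum>y\<in>S \<inter> K. measure M {\<omega> \<in> space M. X t \<omega> = y})"
    using S by (intro finite_measure_finite_Union) (auto simp: disjoint_family_on_def)
  also have "\<dots> = (\<Sum>y\<in>S \<inter> K. transition S Q t x0 y)"
    by (intro sum.cong refl ctmc_marginal[OF c t]) auto
  also have "\<dots> = (\<Sum>y\<in>S. transition S Q t x0 y * of_bool (y \<in> K))"
    using S by (simp add: of_bool_def if_distrib[of "\<lambda>c. _ * c"] sum.inter_restrict cong: if_cong)
  finally show ?thesis by (simp add: semigroup_apply_def)
qed

lemma ctmc_transition_nonneg:
  assumes c: "ctmc M S Q x0 X" and t: "0 \<le> t" and y: "y \<in> S"
  shows "0 \<le> transition S Q t x0 y"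
  using ctmc_marginal[OF assms] by (metis measure_nonneg)

text \<open>
  By the mean value theorem \<open>F 0 - F t\<close> is \<open>t\<close> times a value of \<open>p\<close> at an earlier time.
\<close>
lemma tail_le_of_antimono_deriv:
  fixes F p :: "real \<Rightarrow> real"
  assumes F: "\<And>t. (F has_real_derivative - p t) (at t)"
    and anti: "\<And>s t. 0 \<le> s \<Longrightarrow> s \<le> t \<Longrightarrow> p t \<le> p s" and F0: "\<And>t. 0 \<le> t \<Longrightarrow> F t \<ge> 0" and t: "t > 0"
  shows "t * p t \<le> F 0"
proof -
  obtain \<xi> where \<xi>: "0 < \<xi>" "\<xi> < t" "F t - F 0 = (t - 0) * - p \<xi>"
    using MVT2[OF t, of F "\<lambda>x. - p x"] F by auto
  have "t * p t \<le> t * p \<xi>" using anti[of \<xi> t] \<xi> t by (intro mult_left_mono) auto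
  also have "\<dots> = F 0 - F t" using \<xi> by simp
  finally show ?thesis using F0[of t] t by simp
qed

context
  fixes \<beta> :: real and n :: nat and M :: "'w measure" and X :: "real \<Rightarrow> 'w \<Rightarrow> nat set set" and U :: "'w \<Rightarrow> nat"
  assumes \<beta>: "-2 < \<beta>" "\<beta> < 0" and n: "n \<ge> 1" and tree: "beta_splitting_tree \<beta> n M X U"
begin

private abbreviation "S \<equiv> {P. partition_on {1..n} P}"
private abbreviation "Q \<equiv> split_generator \<beta>"
private abbreviation "x0 \<equiv> {{1..n}}"

lemma tree_ctmc: "ctmc M S Q x0 X"
  using tree by (simp add: beta_splitting_tree_def)

lemma tree_prob_space: "prob_space M" using tree_ctmc by (simp add: ctmc_def)

interpretation prob_space M by (rule tree_prob_space)

lemma finite_states: "finite S" by (intro finite_partitions) simp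

lemma root_state: "x0 \<in> S" using tree_ctmc by (simp add: ctmc_def)

lemma meas_X [measurable]: "0 \<le> t \<Longrightarrow> X t \<in> measurable M (count_space S)"
  using tree_ctmc by (simp add: ctmc_def)

lemma meas_U [measurable]: "U \<in> measurable M (count_space {1..n})"
  using tree by (simp add: beta_splitting_tree_def)

lemma pred_singleton:
  assumes "0 \<le> t" shows "Measurable.pred M (\<lambda>\<omega>. {u} \<in> X t \<omega>)"
  by (rule measurable_compose[OF meas_X[OF assms]]) simp

lemma U_in: "\<omega> \<in> space M \<Longrightarrow> U \<omega> \<in> {1..n}"
  using measurable_space[OF meas_U] by simp

lemma right_const: "\<omega> \<in> space M \<Longrightarrow> 0 \<le> t \<Longrightarrow> \<forall>\<^sub>F u in at_right t. X u \<omega> = X t \<omega>"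
  using tree_ctmc by (simp add: ctmc_def)

text \<open>
  As it is defined through the semigroup, the function is differentiable at every real \<open>t\<close>; it is a
  probability for \<open>t \<ge> 0\<close>.
\<close>
definition survival :: "nat \<Rightarrow> real \<Rightarrow> real" where
  "survival u t = semigroup_apply S Q t (\<lambda>P. of_bool ({u} \<notin> P)) x0"

definition remaining :: "nat \<Rightarrow> real \<Rightarrow> real" where
  "remaining u t = semigroup_apply S Q t (block_stat u (mean_height \<beta>)) x0"

lemma survival_eq_prob: "0 \<le> t \<Longrightarrow> survival u t = prob {\<omega> \<in> space M. {u} \<notin> X t \<omega>}"
  using ctmc_prob_in[OF tree_ctmc, of t "{P. {u} \<notin> P}"] by (simp add: survival_def)

text \<open>
  The mean of the block statistic is a primitive of minus the survival probability. This evaluates the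
  integral of the survival probability without computing the transition probabilities.
\<close>
lemma remaining_deriv:
  assumes u: "u \<in> {1..n}"
  shows "(remaining u has_real_derivative - survival u t) (at t)"
proof -
  have "semigroup_apply S Q t (gen_apply S Q (block_stat u (mean_height \<beta>))) x0
     = semigroup_apply S Q t (\<lambda>P. - of_bool ({u} \<notin> P)) x0"
    by (intro semigroup_apply_cong) (use gen_apply_block_stat[OF \<beta> _ u] in auto)
  also have "\<dots> = - survival u t" by (simp add: survival_def semigroup_apply_def sum_negf)
  finally have "semigroup_apply S Q t (gen_apply S Q (block_stat u (mean_height \<beta>))) x0 = - survival u t" .
  moreover have "remaining u = (\<lambda>t. semigroup_apply S Q t (block_stat u (mean_height \<beta>)) x0)"
    by (simp add: fun_eq_iff remaining_def)
  ultimately show ?thesis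
    using semigroup_apply_deriv[OF finite_states root_state, of Q "block_stat u (mean_height \<beta>)" t] by simp
qed

lemma remaining_0:
  assumes u: "u \<in> {1..n}" shows "remaining u 0 = mean_height \<beta> n"
  using semigroup_apply_0[OF finite_states root_state] block_stat_eq[of n x0 u "{1..n}" "mean_height \<beta>"] root_state u by (simp add: remaining_def)

lemma block_stat_nonneg: "block_stat u (mean_height \<beta>) P \<ge> 0"
  unfolding block_stat_def by (intro sum_nonneg mult_nonneg_nonneg mean_height_nonneg \<beta>) auto

lemma remaining_nonneg: "0 \<le> t \<Longrightarrow> remaining u t \<ge> 0"
  unfolding remaining_def semigroup_apply_def
  by (intro sum_nonneg mult_nonneg_nonneg block_stat_nonneg ctmc_transition_nonneg[OF tree_ctmc]) auto

lemma survival_nonneg: "0 \<le> t \<Longrightarrow> survival u t \<ge> 0"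
  by (simp add: survival_eq_prob)

lemma revival_null:
  assumes "0 \<le> s" "s \<le> t" 
  shows "prob {\<omega> \<in> space M. {u} \<in> X s \<omega> \<and> {u} \<notin> X t \<omega>} = 0"
proof -
  note [measurable] = pred_singleton[OF assms(1)] pred_singleton[OF order.trans[OF assms]]
    meas_X[OF assms(1)] meas_X[OF order.trans[OF assms]]
  let ?I = "{(P, P'). P \<in> S \<and> P' \<in> S \<and> {u} \<in> P \<and> {u} \<notin> P'}"
  have fin: "finite ?I" by (rule finite_subset[of _ "S \<times> S"]) (use finite_states in auto)
  have "{\<omega> \<in> space M. {u} \<in> X s \<omega> \<and> {u} \<notin> X t \<omega>} = (\<Union>(P, P')\<in>?I. {\<omega> \<in> space M. X s \<omega> = P \<and> X t \<omega> = P'})"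
    using ctmc_state[OF tree_ctmc, of s] ctmc_state[OF tree_ctmc, of t] assms by auto
  also have "prob \<dots> \<le> (\<Sum>I\<in>?I. prob (case I of (P, P') \<Rightarrow> {\<omega> \<in> space M. X s \<omega> = P \<and> X t \<omega> = P'}))"
    by (intro finite_measure_subadditive_finite fin) auto
  also have "\<dots> = 0"
  proof (intro sum.neutral ballI)
    fix I assume I: "I \<in> ?I"
    then obtain P P' where PP: "I = (P, P')" "P \<in> S" "P' \<in> S" "{u} \<in> P" "{u} \<notin> P'" by auto
    have "transition S Q (t - s) P P' = 0"
      by (rule transition_zero[OF finite_states PP(2,3), of "{P. {u} \<in> P}"]) (use PP singleton_absorbing in auto)
    then show "prob (case I of (P, P') \<Rightarrow> {\<omega> \<in> space M. X s \<omega> = P \<and> X t \<omega> = P'}) = 0"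
      using ctmc_two_times[OF tree_ctmc assms PP(2,3)] PP(1) by simp
  qed
  finally show ?thesis by (simp add: measure_le_0_iff)
qed

lemma survival_antimono:
  assumes "0 \<le> s" "s \<le> t" shows "survival u t \<le> survival u s"
proof -
  note [measurable] = pred_singleton[OF assms(1)] pred_singleton[OF order.trans[OF assms]]
    meas_X[OF assms(1)] meas_X[OF order.trans[OF assms]]
  have "prob {\<omega> \<in> space M. {u} \<notin> X t \<omega>} \<le> prob ({\<omega> \<in> space M. {u} \<notin> X s \<omega>} \<union> {\<omega> \<in> space M. {u} \<in> X s \<omega> \<and> {u} \<notin> X t \<omega>})"
    by (intro finite_measure_mono) auto
  also have "\<dots> \<le> prob {\<omega> \<in> space M. {u} \<notin> X s \<omega>} + prob {\<omega> \<in> space M. {u} \<in> X s \<omega> \<and> {u} \<notin> X t \<omega>}"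
    by (intro measure_Un_le) auto
  finally show ?thesis using revival_null[OF assms] assms by (simp add: survival_eq_prob)
qed

text \<open>
  A decreasing function whose integral up to \<open>t\<close> is at most \<open>mean_height \<beta> n\<close> is at most
  \<open>mean_height \<beta> n / t\<close> at \<open>t\<close>.
\<close>
lemma survival_tendsto_0:
  assumes u: "u \<in> {1..n}" shows "(survival u \<longlongrightarrow> 0) at_top"
proof (rule tendsto_sandwich[OF _ _ tendsto_const])
  show "eventually (\<lambda>t. 0 \<le> survival u t) at_top"
    using eventually_ge_at_top[of 0] by eventually_elim (rule survival_nonneg)
  show "eventually (\<lambda>t. survival u t \<le> mean_height \<beta> n / t) at_top"
    using eventually_gt_at_top[of 0]
  proof eventually_elim
    case (elim t)
    have "t * survival u t \<le> remaining u 0"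
      by (rule tail_le_of_antimono_deriv[OF remaining_deriv[OF u] survival_antimono remaining_nonneg elim])
    then show ?case using elim remaining_0[OF u] by (simp add: field_simps)
  qed
  show "((\<lambda>t. mean_height \<beta> n / t) \<longlongrightarrow> 0) at_top"
    by (intro tendsto_divide_0[OF tendsto_const] filterlim_at_top_imp_at_infinity filterlim_ident)
qed

text \<open>
  The statistic is bounded and vanishes once \<open>u\<close> is isolated, because \<open>mean_height \<beta> 1 = 0\<close>.
\<close>
lemma remaining_tendsto_0:
  assumes u: "u \<in> {1..n}" shows "(remaining u \<longlongrightarrow> 0) at_top"
proof -
  define C where "C = (\<Sum>P\<in>S. block_stat u (mean_height \<beta>) P)"
  have le: "block_stat u (mean_height \<beta>) P \<le> C * of_bool ({u} \<notin> P)" if "P \<in> S" for P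
  proof (cases "{u} \<in> P")
    case True
    then have "block_stat u (mean_height \<beta>) P = mean_height \<beta> 1"
      using block_stat_eq[of n P u "{u}"] that by simp
    then show ?thesis using True by (simp add: mean_height_def)
  next
    case False
    have "block_stat u (mean_height \<beta>) P \<le> C" unfolding C_def
      using that finite_states block_stat_nonneg by (intro member_le_sum) auto
    then show ?thesis using False by simp
  qed
  have "remaining u t \<le> C * survival u t" if t: "t \<ge> 0" for t
  proof -
    have "remaining u t \<le> (\<Sum>P\<in>S. transition S Q t x0 P * (C * of_bool ({u} \<notin> P)))"
      unfolding remaining_def semigroup_apply_def
      by (intro sum_mono mult_left_mono le ctmc_transition_nonneg[OF tree_ctmc t])
    also have "\<dots> = C * survival u t"
      unfolding survival_def semigroup_apply_def by (simp add: sum_distrib_left mult_ac)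
    finally show ?thesis .
  qed
  then have "eventually (\<lambda>t. remaining u t \<le> C * survival u t) at_top"
    by (rule eventually_mono[OF eventually_ge_at_top[of 0]])
  note upper = this
  have lower: "eventually (\<lambda>t. 0 \<le> remaining u t) at_top"
    using eventually_ge_at_top[of 0] by eventually_elim (rule remaining_nonneg)
  have "((\<lambda>t. C * survival u t) \<longlongrightarrow> 0) at_top"
    using tendsto_mult_left[OF survival_tendsto_0[OF u], of C] by simp
  then show ?thesis by (rule tendsto_sandwich[OF lower upper tendsto_const])
qed

lemma survival_borel [measurable]: "survival u \<in> borel_measurable borel"
proof -
  have "isCont (survival u) t" for t
    unfolding survival_def using DERIV_isCont[OF semigroup_apply_deriv[OF finite_states root_state]] by blast
  then show ?thesis by (intro borel_measurable_continuous_onI continuous_at_imp_continuous_on) auto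
qed

lemma integral_survival:
  assumes u: "u \<in> {1..n}"
  shows "(\<integral>\<^sup>+t. ennreal (survival u t) * indicator {0..} t \<partial>lborel) = ennreal (mean_height \<beta> n)"
proof -
  have "(\<integral>\<^sup>+t. ennreal (survival u t) * indicator {0..} t \<partial>lborel) = ennreal (0 - (- remaining u 0))"
  proof (rule nn_integral_FTC_atLeast[where F = "\<lambda>t. - remaining u t"])
    show "((\<lambda>t. - remaining u t) has_real_derivative survival u t) (at t)" for t
      using DERIV_minus[OF remaining_deriv[OF u]] by simp
    show "((\<lambda>t. - remaining u t) \<longlongrightarrow> 0) at_top"
      using tendsto_minus[OF remaining_tendsto_0[OF u]] by simp
  qed (auto intro: survival_nonneg)
  then show ?thesis using remaining_0[OF u] by simp
qed

lemma prob_U: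
  assumes "u \<in> {1..n}" shows "prob {\<omega> \<in> space M. U \<omega> = u} = 1 / n"
proof -
  have "distr M (count_space {1..n}) U = uniform_count_measure {1..n}" using tree by (simp add: beta_splitting_tree_def)
  then have "measure (distr M (count_space {1..n}) U) {u} = 1 / n"
    using assms by (simp add: measure_uniform_count_measure)
  moreover have "measure (distr M (count_space {1..n}) U) {u} = prob (U -` {u} \<inter> space M)"
    using assms by (intro measure_distr meas_U) auto
  moreover have "U -` {u} \<inter> space M = {\<omega> \<in> space M. U \<omega> = u}" by auto
  ultimately show ?thesis by simp
qed

lemma U_indep:
  assumes u: "u \<in> {1..n}" and t: "0 \<le> t"
  shows "prob {\<omega> \<in> space M. U \<omega> = u \<and> {u} \<notin> X t \<omega>} = 1 / n * survival u t"
proof -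
  let ?N = "Pi\<^sub>M {0..} (\<lambda>_::real. count_space S)"
  let ?XX = "\<lambda>\<omega>. \<lambda>t\<in>{0..}. X t \<omega>"
  have ind: "indep_set (sets (vimage_algebra (space M) U (count_space {1..n}))) (sets (vimage_algebra (space M) ?XX ?N))"
    using tree by (simp add: beta_splitting_tree_def)
  have "U -` {u} \<inter> space M \<in> sets (vimage_algebra (space M) U (count_space {1..n}))"
    using u by (intro in_vimage_algebra) auto
  moreover have "?XX -` ((\<lambda>f. f t) -` {P \<in> S. {u} \<notin> P} \<inter> space ?N) \<inter> space M \<in> sets (vimage_algebra (space M) ?XX ?N)"
    using t by (intro in_vimage_algebra measurable_sets[OF measurable_component_singleton]) auto
  ultimately have "prob ((U -` {u} \<inter> space M) \<inter> (?XX -` ((\<lambda>f. f t) -` {P \<in> S. {u} \<notin> P} \<inter> space ?N) \<inter> space M))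
     = prob (U -` {u} \<inter> space M) * prob (?XX -` ((\<lambda>f. f t) -` {P \<in> S. {u} \<notin> P} \<inter> space ?N) \<inter> space M)"
    by (rule indep_setD[OF ind])
  moreover have "U -` {u} \<inter> space M = {\<omega> \<in> space M. U \<omega> = u}" by auto
  moreover have "?XX -` ((\<lambda>f. f t) -` {P \<in> S. {u} \<notin> P} \<inter> space ?N) \<inter> space M = {\<omega> \<in> space M. {u} \<notin> X t \<omega>}"
  proof -
    have "?XX \<omega> \<in> space ?N" if "\<omega> \<in> space M" for \<omega>
      using ctmc_state[OF tree_ctmc _ that] by (auto simp: space_PiM)
    then show ?thesis using t ctmc_state[OF tree_ctmc t] by auto
  qed
  moreover have "{\<omega> \<in> space M. U \<omega> = u} \<inter> {\<omega> \<in> space M. {u} \<notin> X t \<omega>} = {\<omega> \<in> space M. U \<omega> = u \<and> {u} \<notin> X t \<omega>}" by auto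
  ultimately show ?thesis using prob_U[OF u] survival_eq_prob[OF t] by simp
qed

lemma tagged_event [measurable]:
  assumes t: "0 \<le> t" shows "{\<omega> \<in> space M. {U \<omega>} \<in> X t \<omega>} \<in> events"
proof -
  note [measurable] = pred_singleton[OF t]
  have "{\<omega> \<in> space M. {U \<omega>} \<in> X t \<omega>} = (\<Union>u\<in>{1..n}. {\<omega> \<in> space M. U \<omega> = u} \<inter> {\<omega> \<in> space M. {u} \<in> X t \<omega>})"
    using U_in by auto
  also have "\<dots> \<in> events" by (intro sets.finite_UN sets.Int) auto
  finally show ?thesis .
qed

lemma prob_tagged_survival:
  assumes t: "0 \<le> t"
  shows "prob {\<omega> \<in> space M. {U \<omega>} \<notin> X t \<omega>} = (\<Sum>u=1..n. survival u t) / n"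
proof -
  note [measurable] = pred_singleton[OF t]
  have "{\<omega> \<in> space M. {U \<omega>} \<notin> X t \<omega>} = (\<Union>u\<in>{1..n}. {\<omega> \<in> space M. U \<omega> = u \<and> {u} \<notin> X t \<omega>})"
    using U_in by auto
  also have "prob \<dots> = (\<Sum>u=1..n. prob {\<omega> \<in> space M. U \<omega> = u \<and> {u} \<notin> X t \<omega>})"
    by (intro finite_measure_finite_Union) (auto simp: disjoint_family_on_def)
  also have "\<dots> = (\<Sum>u=1..n. survival u t) / n"
    unfolding sum_divide_distrib by (intro sum.cong refl) (simp add: U_indep[OF _ t])
  finally show ?thesis .
qed

lemma rational_times:
  assumes \<omega>: "\<omega> \<in> space M" and t: "0 \<le> t" "t < r"
  shows "\<exists>q\<in>\<rat>. t < q \<and> q < r \<and> X q \<omega> = X t \<omega>"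
proof -
  obtain e where e: "e > t" "\<And>u. t < u \<Longrightarrow> u < e \<Longrightarrow> X u \<omega> = X t \<omega>"
    using right_const[OF \<omega> t(1)] unfolding eventually_at_right[OF t(2)] by blast
  obtain q where "q \<in> \<rat>" "t < q" "q < min e r" using Rats_dense_in_real[of t "min e r"] e t by auto
  then show ?thesis using e by (intro bexI[of _ q]) auto
qed

text \<open>
  For a pair of fixed times this is a null event. Countably many rational pairs suffice, because by
  right-continuity the state at any time is also the state at some slightly later rational time.
\<close>
lemma AE_no_revival:
  "AE \<omega> in M. \<forall>s t. 0 \<le> s \<longrightarrow> s \<le> t \<longrightarrow> {U \<omega>} \<in> X s \<omega> \<longrightarrow> {U \<omega>} \<in> X t \<omega>"
proof -
  have "AE \<omega> in M. {u} \<in> X s \<omega> \<longrightarrow> {u} \<in> X t \<omega>" if "0 \<le> s" "s \<le> t" for s t u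
  proof -
    note [measurable] = pred_singleton[OF that(1)] pred_singleton[OF order.trans[OF that]]
    have "{\<omega> \<in> space M. \<not> ({u} \<in> X s \<omega> \<longrightarrow> {u} \<in> X t \<omega>)} \<in> null_sets M"
      using revival_null[OF that, of u] by (auto simp: null_sets_def emeasure_eq_measure)
    then show ?thesis by (rule AE_I') auto
  qed
  then have "AE \<omega> in M. \<forall>s\<in>\<rat>. \<forall>t\<in>\<rat>. \<forall>u\<in>{1..n}. 0 \<le> s \<longrightarrow> s \<le> t \<longrightarrow> {u} \<in> X s \<omega> \<longrightarrow> {u} \<in> X t \<omega>"
    by (intro AE_ball_countable[THEN iffD2] ballI countable_rat countable_finite) auto
  then show ?thesis
  proof (rule AE_mp, intro AE_I2 impI allI)
    fix \<omega> s t
    assume \<omega>: "\<omega> \<in> space M" and H: "\<forall>s\<in>\<rat>. \<forall>t\<in>\<rat>. \<forall>u\<in>{1..n}. 0 \<le> s \<longrightarrow> s \<le> t \<longrightarrow> {u} \<in> X s \<omega> \<longrightarrow> {u} \<in> X t \<omega>"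
      and st: "0 \<le> s" "s \<le> t" "{U \<omega>} \<in> X s \<omega>"
    show "{U \<omega>} \<in> X t \<omega>"
    proof (cases "s = t")
      case False
      then have "s < t" "0 \<le> t" using st by auto
      obtain q where q: "q \<in> \<rat>" "s < q" "q < t" "X q \<omega> = X s \<omega>"
        using rational_times[OF \<omega> st(1) \<open>s < t\<close>] by blast
      obtain q' where q': "q' \<in> \<rat>" "t < q'" "X q' \<omega> = X t \<omega>"
        using rational_times[OF \<omega> \<open>0 \<le> t\<close> less_add_one] by blast
      have "{U \<omega>} \<in> X q' \<omega>"
        by (rule H[rule_format, OF q(1) q'(1) U_in[OF \<omega>]]) (use q q' st in auto)
      then show ?thesis using q' by simp
    qed (use st in simp)
  qed
qed

lemma AE_leaf_reached: "AE \<omega> in M. \<exists>t\<ge>0. {U \<omega>} \<in> X t \<omega>"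
proof -
  let ?N = "{\<omega> \<in> space M. \<forall>k. {U \<omega>} \<notin> X (real k) \<omega>}"
  have N: "?N \<in> events" by measurable
  have "prob ?N \<le> (\<Sum>u=1..n. survival u (real k)) / n" for k
    unfolding prob_tagged_survival[OF of_nat_0_le_iff, symmetric]
    by (intro finite_measure_mono) (auto intro: sets.sets_Collect_neg tagged_event)
  moreover have "(\<lambda>k. (\<Sum>u=1..n. survival u (real k)) / n) \<longlonglongrightarrow> (\<Sum>u=1..n. 0) / n"
    by (intro tendsto_intros filterlim_compose[OF survival_tendsto_0 filterlim_real_sequentially]) (use n in auto)
  ultimately have "prob ?N \<le> 0" by (intro LIMSEQ_le_const) auto
  then have "?N \<in> null_sets M" using N by (auto simp: null_sets_def emeasure_eq_measure measure_le_0_iff)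
  then show ?thesis by (rule AE_I') auto
qed

text \<open>
  By right-continuity the infimum is less than \<open>a\<close> exactly if the leaf is isolated at some rational
  time before \<open>a\<close>. Paths on which it is never isolated need separate treatment, since there the height
  is the fixed number \<open>Inf {}\<close>.
\<close>
lemma leaf_height_borel: "leaf_height X U \<in> borel_measurable M"
proof (rule borel_measurableI_less)
  fix a :: real
  let ?A = "\<lambda>\<omega>. {t. 0 \<le> t \<and> {U \<omega>} \<in> X t \<omega>}"
  let ?R = "{q \<in> \<rat>. 0 \<le> (q::real)}"
  have R: "countable ?R" using countable_rat by (rule countable_subset[rotated]) auto
  have rat: "\<exists>q\<in>?R. q < r \<and> {U \<omega>} \<in> X q \<omega>" if \<omega>: "\<omega> \<in> space M" and tA: "t \<in> ?A \<omega>" and tr: "t < r" for \<omega> t r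
  proof -
    have t: "0 \<le> t" "{U \<omega>} \<in> X t \<omega>" using tA by auto
    obtain q where "q \<in> \<rat>" "t < q" "q < r" "X q \<omega> = X t \<omega>"
      using rational_times[OF \<omega> t(1) tr] by blast
    then show ?thesis using t by (intro bexI[of _ q]) auto
  qed
  have "{\<omega> \<in> space M. leaf_height X U \<omega> < a} =
     (\<Union>q\<in>{q \<in> ?R. q < a}. {\<omega> \<in> space M. {U \<omega>} \<in> X q \<omega>}) \<union>
     (if Inf {} < a then space M - (\<Union>q\<in>?R. {\<omega> \<in> space M. {U \<omega>} \<in> X q \<omega>}) else {})" (is "_ = ?B")
  proof (intro set_eqI)
    fix \<omega>
    show "\<omega> \<in> {\<omega> \<in> space M. leaf_height X U \<omega> < a} \<longleftrightarrow> \<omega> \<in> ?B"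
    proof (cases "\<omega> \<in> space M")
      case \<omega>: True
      have bdd: "bdd_below (?A \<omega>)" by (rule bdd_belowI[of _ 0]) auto
      show ?thesis
      proof (cases "?A \<omega> = {}")
        case True
        then have "leaf_height X U \<omega> = Inf {}" unfolding leaf_height_def by (rule arg_cong)
        moreover have "{U \<omega>} \<notin> X q \<omega>" if "q \<in> ?R" for q using True that by auto
        ultimately show ?thesis using \<omega> by auto
      next
        case False
        then obtain t where t: "t \<in> ?A \<omega>" by auto
        then obtain q where "q \<in> ?R" "{U \<omega>} \<in> X q \<omega>" using rat[OF \<omega>, of t "t + 1"] by auto
        then have "\<omega> \<in> ?B \<longleftrightarrow> (\<exists>q\<in>?R. q < a \<and> {U \<omega>} \<in> X q \<omega>)" using \<omega> by auto
        also have "\<dots> \<longleftrightarrow> (\<exists>t\<in>?A \<omega>. t < a)" using rat[OF \<omega>, of _ a] by auto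
        also have "\<dots> \<longleftrightarrow> leaf_height X U \<omega> < a" unfolding leaf_height_def
          using cInf_less_iff[OF False bdd] by simp
        finally show ?thesis using \<omega> by simp
      qed
    qed (auto split: if_splits)
  qed
  also have "?B \<in> events"
    by (intro sets.Un sets.countable_UN' countable_subset[OF _ R] sets.Diff sets.top sets.empty_sets)
       (auto intro!: tagged_event sets.Diff sets.countable_UN' R)
  finally show "{\<omega> \<in> space M. leaf_height X U \<omega> < a} \<in> events" .
qed

text \<open>
  If the leaf is not isolated at time \<open>t\<close>, then by right-continuity it is not isolated at some later time,
  nor before that time as it cannot merge again; hence the inequality is strict.
\<close>
lemma AE_leaf_height_gt:
  "AE \<omega> in M. 0 \<le> leaf_height X U \<omega> \<and> (\<forall>t\<ge>0. t < leaf_height X U \<omega> \<longleftrightarrow> {U \<omega>} \<notin> X t \<omega>)"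
  using AE_no_revival AE_leaf_reached AE_space
proof eventually_elim
  case (elim \<omega>)
  let ?A = "{t. 0 \<le> t \<and> {U \<omega>} \<in> X t \<omega>}"
  have ne: "?A \<noteq> {}" using elim by auto
  have bdd: "bdd_below ?A" by (rule bdd_belowI[of _ 0]) auto
  have "0 \<le> Inf ?A" using ne by (intro cInf_greatest) auto
  moreover have "t < Inf ?A \<longleftrightarrow> {U \<omega>} \<notin> X t \<omega>" if t: "t \<ge> 0" for t
  proof
    assume "t < Inf ?A"
    then show "{U \<omega>} \<notin> X t \<omega>" using cInf_lower[OF _ bdd, of t] t by auto
  next
    assume not: "{U \<omega>} \<notin> X t \<omega>"
    obtain q where q: "q \<in> \<rat>" "t < q" "q < t + 1" "X q \<omega> = X t \<omega>"
      using rational_times[OF elim(3) t less_add_one] by blast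
    have "q \<le> s" if s: "s \<in> ?A" for s
    proof (rule ccontr)
      assume "\<not> q \<le> s"
      then have "{U \<omega>} \<in> X q \<omega>" using elim(1)[rule_format, of s q] s by auto
      then show False using not q by simp
    qed
    then have "q \<le> Inf ?A" using ne by (intro cInf_greatest)
    then show "t < Inf ?A" using q by simp
  qed
  ultimately show ?case by (simp add: leaf_height_def)
qed

text \<open>
  The mean of the height is the integral over \<open>t\<close> of the probability that it exceeds \<open>t\<close>. As the leaf is
  independent of the tree, this is the average over \<open>u\<close> of the integrated survival probabilities, all
  of which equal \<open>mean_height \<beta> n\<close>.
\<close>
lemma expected_leaf_height:
  "has_bochner_integral M (leaf_height X U) (mean_height \<beta> n)"
proof (rule has_bochner_integral_nn_integral)
  note [measurable] = leaf_height_borel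
  show "leaf_height X U \<in> borel_measurable M" by (rule leaf_height_borel)
  show "AE \<omega> in M. 0 \<le> leaf_height X U \<omega>" using AE_leaf_height_gt by eventually_elim simp
  show "0 \<le> mean_height \<beta> n" by (rule mean_height_nonneg[OF \<beta>])
  interpret P: pair_sigma_finite M lborel ..
  let ?T = "leaf_height X U"
  let ?I = "{(\<omega>, t). 0 \<le> t \<and> t < ?T \<omega>}"
  have "(\<integral>\<^sup>+\<omega>. ennreal (?T \<omega>) \<partial>M) = (\<integral>\<^sup>+\<omega>. (\<integral>\<^sup>+t. indicator {0..<?T \<omega>} t \<partial>lborel) \<partial>M)"
  proof (intro nn_integral_cong)
    fix \<omega>
    show "ennreal (?T \<omega>) = (\<integral>\<^sup>+t. indicator {0..<?T \<omega>} t \<partial>lborel)"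
      by (cases "0 \<le> ?T \<omega>") (auto simp: ennreal_neg)
  qed
  also have "\<dots> = (\<integral>\<^sup>+\<omega>. (\<integral>\<^sup>+t. indicator ?I (\<omega>, t) \<partial>lborel) \<partial>M)"
    by (intro nn_integral_cong) (auto simp: indicator_def)
  also have "\<dots> = (\<integral>\<^sup>+t. (\<integral>\<^sup>+\<omega>. indicator ?I (\<omega>, t) \<partial>M) \<partial>lborel)"
    by (rule P.Fubini'[symmetric]) measurable
  also have "\<dots> = (\<integral>\<^sup>+t. ennreal ((\<Sum>u=1..n. survival u t) / n) * indicator {0..} t \<partial>lborel)"
  proof (intro nn_integral_cong)
    fix t :: real
    show "(\<integral>\<^sup>+\<omega>. indicator ?I (\<omega>, t) \<partial>M) = ennreal ((\<Sum>u=1..n. survival u t) / n) * indicator {0..} t"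
    proof (cases "t \<ge> 0")
      case True
      have ev: "{\<omega> \<in> space M. {U \<omega>} \<notin> X t \<omega>} \<in> events" using tagged_event[OF True] by (rule sets.sets_Collect_neg)
      have "(\<integral>\<^sup>+\<omega>. indicator ?I (\<omega>, t) \<partial>M) = (\<integral>\<^sup>+\<omega>. indicator {\<omega> \<in> space M. {U \<omega>} \<notin> X t \<omega>} \<omega> \<partial>M)"
      proof (rule nn_integral_cong_AE)
        show "AE \<omega> in M. indicator ?I (\<omega>, t) = (indicator {\<omega> \<in> space M. {U \<omega>} \<notin> X t \<omega>} \<omega> :: ennreal)"
          using AE_leaf_height_gt AE_space by eventually_elim (use True in \<open>auto simp: indicator_def\<close>)
      qed
      also have "\<dots> = ennreal (prob {\<omega> \<in> space M. {U \<omega>} \<notin> X t \<omega>})"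
        using ev by (simp add: emeasure_eq_measure)
      finally show ?thesis using True by (simp add: prob_tagged_survival)
    qed simp
  qed
  also have "\<dots> = (\<integral>\<^sup>+t. (\<Sum>u=1..n. ennreal (1 / n) * (ennreal (survival u t) * indicator {0..} t)) \<partial>lborel)"
  proof (intro nn_integral_cong)
    fix t :: real
    show "ennreal ((\<Sum>u=1..n. survival u t) / n) * indicator {0..} t = (\<Sum>u=1..n. ennreal (1 / n) * (ennreal (survival u t) * indicator {0..} t))"
    proof (cases "t \<ge> 0")
      case True
      have "ennreal ((\<Sum>u=1..n. survival u t) / n) = ennreal (\<Sum>u=1..n. 1 / n * survival u t)"
        by (simp add: sum_divide_distrib)
      also have "\<dots> = (\<Sum>u=1..n. ennreal (1 / n * survival u t))"
        using survival_nonneg[OF True] by (intro sum_ennreal[symmetric]) auto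
      also have "\<dots> = (\<Sum>u=1..n. ennreal (1 / n) * ennreal (survival u t))"
        using survival_nonneg[OF True] by (intro sum.cong refl ennreal_mult) auto
      finally show ?thesis using True by simp
    qed simp
  qed
  also have "\<dots> = (\<Sum>u=1..n. ennreal (1 / n) * (\<integral>\<^sup>+t. ennreal (survival u t) * indicator {0..} t \<partial>lborel))"
    by (simp add: nn_integral_sum nn_integral_cmult)
  also have "\<dots> = (\<Sum>u=1..n. ennreal (1 / n) * ennreal (mean_height \<beta> n))"
    by (intro sum.cong refl) (simp add: integral_survival)
  also have "\<dots> = ennreal (\<Sum>u=1..n. 1 / n * mean_height \<beta> n)"
    using mean_height_nonneg[OF \<beta>, of n]
    by (subst sum_ennreal[symmetric]) (auto simp del: sum_constant simp add: ennreal_mult[symmetric])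
  also have "(\<Sum>u=1..n. 1 / n * mean_height \<beta> n) = mean_height \<beta> n" using n by simp
  finally show "(\<integral>\<^sup>+\<omega>. ennreal (?T \<omega>) \<partial>M) = ennreal (mean_height \<beta> n)" .
qed

end

section \<open>The expansion of the mean height\<close>

lemma mean_height_expansion:
  fixes \<beta> :: real and n :: nat
  assumes \<beta>: "-2 < \<beta>" "\<beta> < 0" and n: "n \<ge> 2"
  shows "summable (\<lambda>k. zero_term \<beta> n (Suc k))"
    and "complex_of_real (mean_height \<beta> n) = expansion_main \<beta> n - (\<Sum>k. zero_term \<beta> n (Suc k))"
    and "zero_term \<beta> n (Suc k) = complex_of_real (Beta (- stieltjes_zero (\<beta> + 2) (binomial_weight \<beta>) k) (real n)
       / stieltjes_deriv (\<beta> + 2) (binomial_weight \<beta>) (stieltjes_zero (\<beta> + 2) (binomial_weight \<beta>) k))"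
proof -
  let ?b = "\<beta> + 2" and ?w = "binomial_weight \<beta>"
  let ?s = "stieltjes_zero ?b ?w"
  note w = weights_binomial[OF \<beta>]
  have wpos: "?w m > 0" for m by (rule binomial_weight_pos[OF \<beta>(2)])
  have N: "n - 1 > 0" "real (n - 1) + 1 = real n" using n by (auto simp: of_nat_diff)
  let ?t = "\<lambda>k. Beta (- ?s k) (real n) / stieltjes_deriv ?b ?w (?s k)"
  have zt: "zero_term \<beta> n (Suc k) = complex_of_real (?t k)" for k
  proof -
    have s: "complex_of_real (phi_zero \<beta> (Suc k)) = complex_of_real (?s k)"
      by (simp add: phi_zero_eq[OF \<beta>] node_def)
    have "off_poles ?b ?w (?s k)" using node_facts(2)[OF w(1) _ lessI, of "Suc k"] wpos by (simp add: node_def)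
    then have d: "deriv (phi \<beta>) (complex_of_real (?s k)) = complex_of_real (stieltjes_deriv ?b ?w (?s k))"
      unfolding phi_eq[OF \<beta>] using deriv_stieltjes_mero[OF w(1)] stieltjes_deriv_of_real[OF w(1)]
      by (simp add: off_poles_of_real)
    have g: "Gamma (- complex_of_real (?s k)) = complex_of_real (Gamma (- ?s k))"
      "Gamma (of_nat n) = complex_of_real (Gamma (real n))"
      "Gamma (of_nat n - complex_of_real (?s k)) = complex_of_real (Gamma (real n - ?s k))"
      using Gamma_complex_of_real[of "- ?s k"] Gamma_complex_of_real[of "real n"] Gamma_complex_of_real[of "real n - ?s k"] by simp_all
    show ?thesis unfolding zero_term_def Let_def s d g by (simp add: Beta_def mult_ac)
  qed
  show "zero_term \<beta> n (Suc k) = complex_of_real (?t k)" by (rule zt)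
  note rice = rice_sum[OF w(1) wpos N(1) w(2), unfolded N(2)]
  show "summable (\<lambda>k. zero_term \<beta> n (Suc k))" unfolding zt summable_of_real_iff by (rule rice(1))
  have off0: "off_poles ?b ?w (0 :: complex)" using \<beta> by (intro off_poles_right_half_plane) auto
  have mu: "mu \<beta> = complex_of_real (stieltjes_deriv ?b ?w 0)"
    unfolding mu_def phi_eq[OF \<beta>] using deriv_stieltjes_mero[OF w(1) off0] stieltjes_deriv_of_real[OF w(1), of 0, where 'a = complex] by simp
  have main: "expansion_main \<beta> n = complex_of_real (harm (n - 1) / stieltjes_deriv ?b ?w 0 + cube_sum ?b ?w / (stieltjes_deriv ?b ?w 0)\<^sup>2)"
    unfolding expansion_main_def mu unfolding phi_eq[OF \<beta>] deriv2_stieltjes_mero_0[OF w(1)]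
    by (simp add: of_real_harm)
  have "mean_height \<beta> n = harm (n - 1) / stieltjes_deriv ?b ?w 0 + cube_sum ?b ?w / (stieltjes_deriv ?b ?w 0)\<^sup>2 - suminf ?t"
    unfolding mean_height_def by (rule rice(2))
  then show "complex_of_real (mean_height \<beta> n) = expansion_main \<beta> n - (\<Sum>k. zero_term \<beta> n (Suc k))"
    unfolding main zt suminf_of_real[OF rice(1), symmetric] by (simp only: of_real_diff)
qed

lemma mean_height_asymptotics:
  fixes \<beta> :: real
  assumes \<beta>: "-2 < \<beta>" "\<beta> < 0"
  shows "(\<lambda>n. complex_of_real (mean_height \<beta> n) - (expansion_main \<beta> n - (\<Sum>k=1..r. zero_term \<beta> n k)))
    \<in> O(\<lambda>n. complex_of_real (real n powr phi_zero \<beta> (r + 1)))"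
proof -
  let ?b = "\<beta> + 2" and ?w = "binomial_weight \<beta>"
  let ?s = "stieltjes_zero ?b ?w"
  note w = weights_binomial[OF \<beta>]
  have wpos: "?w m > 0" for m by (rule binomial_weight_pos[OF \<beta>(2)])
  define tail where "tail = (\<lambda>n. \<Sum>i. Beta (- ?s (i + r)) (real n) / stieltjes_deriv ?b ?w (?s (i + r)))"
  have eq: "complex_of_real (mean_height \<beta> n) - (expansion_main \<beta> n - (\<Sum>k=1..r. zero_term \<beta> n k)) = - complex_of_real (tail n)"
    if n: "n \<ge> 2" for n
  proof -
    note sm = mean_height_expansion(1)[OF \<beta> n]
    have "(\<Sum>k=1..r. zero_term \<beta> n k) = (\<Sum>k<r. zero_term \<beta> n (Suc k))"
      by (rule sum.reindex_bij_witness[of _ Suc "\<lambda>k. k - 1"]) auto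
    moreover have "(\<Sum>k. zero_term \<beta> n (Suc k)) = (\<Sum>k. zero_term \<beta> n (Suc (k + r))) + (\<Sum>k<r. zero_term \<beta> n (Suc k))"
      by (rule suminf_split_initial_segment[OF sm])
    moreover have "(\<Sum>k. zero_term \<beta> n (Suc (k + r))) = complex_of_real (tail n)"
    proof -
      have "summable (\<lambda>k. zero_term \<beta> n (Suc (k + r)))" using sm by (subst summable_iff_shift)
      then have "summable (\<lambda>i. Beta (- ?s (i + r)) (real n) / stieltjes_deriv ?b ?w (?s (i + r)))"
        unfolding mean_height_expansion(3)[OF \<beta> n] summable_of_real_iff .
      then show ?thesis unfolding tail_def mean_height_expansion(3)[OF \<beta> n] by (rule suminf_of_real[symmetric])
    qed
    ultimately show ?thesis using mean_height_expansion(2)[OF \<beta> n] by simp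
  qed
  have "phi_zero \<beta> (r + 1) = ?s r" by (simp add: phi_zero_eq[OF \<beta>] node_def)
  moreover have "tail \<in> O(\<lambda>n. real n powr ?s r)"
    unfolding tail_def by (rule zero_series_tail[OF w(1) wpos w(2)])
  ultimately have "tail \<in> O(\<lambda>n. real n powr phi_zero \<beta> (r + 1))" by simp
  then obtain c where "eventually (\<lambda>n. norm (tail n) \<le> c * norm (real n powr phi_zero \<beta> (r + 1))) sequentially"
    by (rule landau_o.bigE)
  then have "(\<lambda>n. - complex_of_real (tail n)) \<in> O(\<lambda>n. complex_of_real (real n powr phi_zero \<beta> (r + 1)))"
    by (intro bigoI[of _ c]) simp
  moreover have "eventually (\<lambda>n. complex_of_real (mean_height \<beta> n) - (expansion_main \<beta> n - (\<Sum>k=1..r. zero_term \<beta> n k)) = - complex_of_real (tail n)) sequentially"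
    using eventually_ge_at_top[of 2] by eventually_elim (rule eq)
  ultimately show ?thesis by (subst landau_o.big.in_cong)
qed

theorem theorem2p5:
  fixes \<beta> :: real
  assumes "-2 < \<beta>" "\<beta> < 0"
  shows "(\<forall>n\<ge>2. \<forall>(M :: 'w measure) X U. beta_splitting_tree \<beta> n M X U \<longrightarrow>
            integrable M (leaf_height X U) \<and>
            summable (\<lambda>k. zero_term \<beta> n (Suc k)) \<and>
            complex_of_real (integral\<^sup>L M (leaf_height X U)) =
              expansion_main \<beta> n - (\<Sum>k. zero_term \<beta> n (Suc k))) \<and>
         (\<forall>(M :: nat \<Rightarrow> 'w measure) X U. (\<forall>n\<ge>2. beta_splitting_tree \<beta> n (M n) (X n) (U n)) \<longrightarrow>
            (\<forall>r. (\<lambda>n. complex_of_real (integral\<^sup>L (M n) (leaf_height (X n) (U n))) -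
                      (expansion_main \<beta> n - (\<Sum>k=1..r. zero_term \<beta> n k)))
                 \<in> O(\<lambda>n. complex_of_real (real n powr phi_zero \<beta> (r + 1)))))"
proof (intro conjI allI impI)
  fix n :: nat and M :: "'w measure" and X U
  assume n: "2 \<le> n" and tree: "beta_splitting_tree \<beta> n M X U"
  have "has_bochner_integral M (leaf_height X U) (mean_height \<beta> n)"
    using n by (intro expected_leaf_height[OF assms _ tree]) auto
  then show "integrable M (leaf_height X U)"
    and "complex_of_real (integral\<^sup>L M (leaf_height X U)) = expansion_main \<beta> n - (\<Sum>k. zero_term \<beta> n (Suc k))"
    using mean_height_expansion(2)[OF assms n] by (auto simp: has_bochner_integral_iff)
  show "summable (\<lambda>k. zero_term \<beta> n (Suc k))" by (rule mean_height_expansion(1)[OF assms n])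
next
  fix M :: "nat \<Rightarrow> 'w measure" and X U r
  assume tree: "\<forall>n\<ge>2. beta_splitting_tree \<beta> n (M n) (X n) (U n)"
  have "integral\<^sup>L (M n) (leaf_height (X n) (U n)) = mean_height \<beta> n" if "n \<ge> 2" for n
    using that tree by (intro has_bochner_integral_integral_eq expected_leaf_height[OF assms]) auto
  then have "eventually (\<lambda>n. complex_of_real (integral\<^sup>L (M n) (leaf_height (X n) (U n))) -
                      (expansion_main \<beta> n - (\<Sum>k=1..r. zero_term \<beta> n k)) =
      complex_of_real (mean_height \<beta> n) - (expansion_main \<beta> n - (\<Sum>k=1..r. zero_term \<beta> n k))) sequentially"
    by (intro eventually_mono[OF eventually_ge_at_top[of 2]]) simp
  then show "(\<lambda>n. complex_of_real (integral\<^sup>L (M n) (leaf_height (X n) (U n))) -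
                      (expansion_main \<beta> n - (\<Sum>k=1..r. zero_term \<beta> n k)))
                 \<in> O(\<lambda>n. complex_of_real (real n powr phi_zero \<beta> (r + 1)))"
    using mean_height_asymptotics[OF assms, of r] by (subst landau_o.big.in_cong)
qed

end
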